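(* Let $n\ge 1$, let $\mathcal{K}$ be the projection of a framed oriented link $K$ (blackboard framing) given as the closure of a braid with $\mathfrak{s}$ strings, let $G\mathcal{K}$ be its arc-graph and $P\mathcal{K}$ its part arc-graph. Then the framed colored Jones polynomial is given by $$J_n'(K)=t^{\delta'(\mathcal{K},n)}\sum_{f\in \mathcal{F}_n^*(G\mathcal{K})}t^{\delta(f)}\prod_{v}t^{n\varepsilon(v)f(e_v^b)}\binom{f(v)}{f(e_v^b)}_{t^{-\varepsilon(v)}}\Big\{n-\sum_{e<e_v^r}f(e)\Big\}_{f(e_v^r),\,t^{\varepsilon(v)}}\ \in\ \mathbb{Z}[t^{\pm 1/4}],$$ where the product runs over all crossings $v$ of $\mathcal{K}$ (equivalently all vertices of $G\mathcal{K}$ corresponding to overcrossing arcs). Moreover, this holds state by state: for each $f\in\mathcal{F}_n^*(G\mathcal{K})$ the summand $$t^{\delta'(\mathcal{K},n)+\delta(f)}\prod_{v}t^{n\varepsilon(v)f(e_v^b)}\binom{f(v)}{f(e_v^b)}_{t^{-\varepsilon(v)}}\Big\{n-\sum_{e<e_v^r}f(e)\Big\}_{f(e_v^r),\,t^{\varepsilon(v)}}$$ is equal to the $R$-matrix state-sum contribution $Z_R(\phi(f))$ of the corresponding state $\phi(f)\in\mathcal{F}^n_{+,*}(P\mathcal{K})$, where $\phi:\mathcal{F}_n^*(G\mathcal{K})\to\mathcal{F}^n_{+,*}(P\mathcal{K})$ is the flow-lemma bijection. Thus the $R$-matrix state model on part arc-graphs and the state model on arc-graphs are equivalent (there is a bijection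 of state sets preserving the contributions of the individual states).
   Context: Closed braids. Strings are oriented upwards; a braid word is read from bottom to top; $\sigma_k$ is a positive crossing in which the overstrand moves from position $k$ to $k+1$ (and the understrand from $k+1$ to $k$); $\sigma_k^{-1}$ is a negative crossing in which the overstrand moves from $k+1$ to $k$. The top of position $\ell$ is joined to the bottom of position $\ell$ by a closure arc on the right. $\varepsilon(v)=\pm1$ is the sign of the crossing $v$; $\omega(\mathcal{K})=\sum_v\varepsilon(v)$. Part arcs. Part arcs are the pieces of $\mathcal{K}$ between consecutive passages through crossings (a component without crossings is one part arc). A $\mathbb{Z}$-flow on $P\mathcal{K}$ is an integer coloring of the part arcs with sum of incoming colors $=$ sum of outgoing colors at each crossing. $\mathcal{F}^n_{+,*}(P\mathcal{K})$ (resp. $\mathcal{F}^n_{-,*}(P\mathcal{K})$) is the set of $\mathbb{Z}$-flows with all colors in $\{0,\dots,n\}$, weakly increasing (resp. weakly decreasing) along the overstrand at every crossing, and with color $0$ on the part arc containing the closure arc of the first string. For a state $s$, $b_\ell(s)$ denotes the color of the part arc containing the closure arc of string $\ell$. Quantum symbols. $t=v^2$ (here $v$ is a formal variable), $\{a\}=v^a-v^{-a}$, $\{a\}_b=\{a\}\{a-1\}\cdots\{a-b+1\}$ for $b\ge0$, $\binom{a}{b}=\{a\}_b/\{b\}_b$ (equal to $1$ for $b=0$). Further $\{a\}_{b,t}=\prod_{k=0}^{b-1}(1-t^{a-k})$, $(a)_t=\frac{t^a-1}{t-1}$, $(a)_t!=(1)_t\cdots(a)_t$, $\binom{a}{b}_t=\frac{(a)_t!}{(b)_t!\,(a-b)_t!}$;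 a subscript $t^{\pm1}$ means $t$ is replaced by $t^{\pm1}$. $R$-matrix functions. $$f_+(n,i,j,r)=(-1)^rv^{-((n-2i)(n-2j)+r(r-1))/2}\tbinom{j+r}{r}\{n+r-i\}_r,$$ $$f_-(n,i,j,r)=v^{((n-2i-2r)(n-2j+2r)+r(r-1))/2}\tbinom{i+r}{r}\{n+r-j\}_r .$$ Framed colored Jones polynomial. $J'_n(K)$ is the invariant of framed oriented links coming from the $(n+1)$-dimensional irreducible representation of $U_q(\mathrm{sl}(2,\mathbb{C}))$ (normalized to be $1$ on the $0$-framed unknot), given for any closed braid projection $\mathcal{K}$ of $K$ by the known state-sum $$J'_n(K)=\sum_{s\in\mathcal{F}^n_{-,*}(P\mathcal{K})}\ \prod_{\ell=2}^{\mathfrak{s}}v^{-n+2b_\ell(s)}\prod_{c}f_{\varepsilon(c)}(n,i(c),j(c),r(c)),$$ product over crossings $c$, where $i(c),j(c)$ are the colors of the left, respectively right, incoming (bottom) part arcs at $c$, and $r(c)\ge0$ is the decrease of the color along the overstrand at $c$. It is invariant under reversing the orientation of all components. $R$-matrix contribution of a $(+)$-state. For $s\in\mathcal{F}^n_{+,*}(P\mathcal{K})$ and a crossing $c$ let $r=r(c)\ge 0$ be the increase of color along the overstrand, $a=a(c)$ the color of the outgoing part arc of the overstrand, $b=b(c)$ the color of the outgoing part arc of the understrand. Then (this is the $R$-matrix contribution after reversing the orientation, which turns $(+)$-colorings into $(-)$-colorings and inverts the contributions of the closure arcs) $$Z_R(s)=\prod_{\ell=2}^{\mathfrak{s}}v^{\,n-2b_\ell(s)}\prod_{\varepsilon(c)=1}f_+(n,a,b,r)\prod_{\varepsilon(c)=-1}f_-(n,b,a,r).$$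 Arc-graph. An overcrossing arc is a piece of $\mathcal{K}$ from one undercrossing to the next undercrossing along the orientation; an overcrossing circle is a component without undercrossings. Vertices of $G\mathcal{K}$ are overcrossing arcs and circles. An overcrossing arc is identified with the crossing $v$ at which it ends; it has two outgoing edges: blue $e_v^b$ to the overcrossing arc starting at the crossing $v$, and red $e_v^r$ to the overcrossing arc or circle passing over at the crossing $v$. Incoming edges at an overcrossing arc $u$ are ordered along $u$, with the incoming blue edge first. $\mathcal{F}_n(G\mathcal{K})$ is the set of colorings $f$ of the edges, together with a color of one chosen part arc of each overcrossing circle, with values in $\{0,\dots,n\}$, such that at each overcrossing arc $v$ the sum of the incoming edge colors equals $f(v):=f(e_v^b)+f(e_v^r)\le n$, and such that the incoming red edge colors at each overcrossing circle sum to $0$. Flow-lemma bijection $\phi$. For $f\in\mathcal{F}_n(G\mathcal{K})$, $\phi(f)$ is the coloring of part arcs in which the part arc leaving the crossing $v$ on the understrand has color $f(e_v^b)$, and at each crossing $v$ the color increases by $f(e_v^r)$ along the overstrand and decreases by $f(e_v^r)$ along the understrand (and the chosen part arc of each circle gets the color assigned by $f$). $\mathcal{F}_n^*(G\mathcal{K})$ is the set of $f\in\mathcal{F}_n(G\mathcal{K})$ for which $\phi(f)$ has color $0$ on the part arc containing the closure arc of the first string; $\phi$ maps it onto $\mathcal{F}^n_{+,*}(P\mathcal{K})$. Remaining notation. $\sum_{e<e_v^r}f(e)$ is the sum of the colors of all edges that enter the same vertex as $e_v^r$ and precede $e_v^r$ in its order; equivalently it is the color under $\phi(f)$ of the part arc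 entering the crossing $v$ on the overstrand (this is the meaning also when the target of $e_v^r$ is an overcrossing circle). Moreover $$\mathrm{exc}(f)=\sum_v\varepsilon(v)f(e_v^b)\sum_{e<e_v^r}f(e),\qquad \mathrm{rot}(f)=\sum_{\ell=2}^{\mathfrak{s}}b_\ell(\phi(f)),\qquad \delta(f)=-(\mathrm{exc}(f)+\mathrm{rot}(f)),$$ $$\delta'(\mathcal{K},n)=-\frac{n^2}{4}\omega(\mathcal{K})+\frac n2(\mathfrak{s}-1).$$ *)

theory Defs
  imports
    Complex_Main
    "HOL-Library.FuncSet"
    "HOL-Computational_Algebra.Polynomial"
    "HOL-Computational_Algebra.Fraction_Field"
begin

section \<open>The coefficient field\<close>

text \<open>
  All computations take place in the field of rational functions in one formal variable
  \<open>q = t\<^sup>1\<^sup>/\<^sup>4 = v\<^sup>1\<^sup>/\<^sup>2\<close>.  The powers \<open>v_pow x\<close> and \<open>t_pow x\<close> are only meaningful for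
  \<open>x\<close> in \<open>(1/2)\<int>\<close> and \<open>x\<close> in \<open>(1/4)\<int>\<close> respectively, and all exponents below are of this form.
\<close>

type_synonym ratfun = "int poly fract"

definition q_var :: ratfun where
  "q_var = Fract [:0, 1:] 1"

definition t_pow :: "rat \<Rightarrow> ratfun" where
  "t_pow x = q_var powi \<lfloor>4 * x\<rfloor>"

definition v_pow :: "rat \<Rightarrow> ratfun" where
  "v_pow x = q_var powi \<lfloor>2 * x\<rfloor>"

definition laurent_polys :: "ratfun set" where
  "laurent_polys = {Fract p 1 * q_var powi (- int k) | (p :: int poly) (k :: nat). True}"


section \<open>Quantum symbols\<close>

definition v_bracket :: "int \<Rightarrow> ratfun" where
  "v_bracket a = v_pow (of_int a) - v_pow (- of_int a)"

definition v_falling :: "int \<Rightarrow> nat \<Rightarrow> ratfun" where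
  "v_falling a b = (\<Prod>k<b. v_bracket (a - int k))"

definition v_binom :: "int \<Rightarrow> nat \<Rightarrow> ratfun" where
  "v_binom a b = v_falling a b / v_falling (int b) b"

text \<open>The first argument \<open>x\<close> of the following symbols is the value \<open>t\<close> or \<open>t\<^sup>-\<^sup>1\<close> of the subscript.\<close>

definition t_falling :: "ratfun \<Rightarrow> int \<Rightarrow> nat \<Rightarrow> ratfun" where
  "t_falling x a b = (\<Prod>k<b. 1 - x powi (a - int k))"

definition t_int :: "ratfun \<Rightarrow> nat \<Rightarrow> ratfun" where
  "t_int x a = (x ^ a - 1) / (x - 1)"

definition t_fact :: "ratfun \<Rightarrow> nat \<Rightarrow> ratfun" where
  "t_fact x a = (\<Prod>k=1..a. t_int x k)"

definition t_binom :: "ratfun \<Rightarrow> nat \<Rightarrow> nat \<Rightarrow> ratfun" where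
  "t_binom x a b = t_fact x a / (t_fact x b * t_fact x (a - b))"


section \<open>Closed braids\<close>

text \<open>
  In the braid word, read from bottom to top, the letter \<open>k > 0\<close> stands for \<open>\<sigma>\<^sub>k\<close> and \<open>- k\<close> for its
  inverse.  Crossings are the indices of the letters.
\<close>

datatype braid = Braid (strings: nat) (braid_word: "int list")

definition is_braid :: "braid \<Rightarrow> bool" where
  "is_braid K \<longleftrightarrow> strings K \<ge> 1 \<and> (\<forall>x\<in>set (braid_word K). x \<noteq> 0 \<and> \<bar>x\<bar> < int (strings K))"

definition height :: "braid \<Rightarrow> nat" where
  "height K = length (braid_word K)"

definition crossings :: "braid \<Rightarrow> nat set" where
  "crossings K = {..<height K}"

definition cr_sign :: "braid \<Rightarrow> nat \<Rightarrow> int" where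
  "cr_sign K v = sgn (braid_word K ! v)"

definition cr_pos :: "braid \<Rightarrow> nat \<Rightarrow> nat" where
  "cr_pos K v = nat \<bar>braid_word K ! v\<bar>"

definition writhe :: "braid \<Rightarrow> int" where
  "writhe K = (\<Sum>v\<in>crossings K. cr_sign K v)"

text \<open>
  The point \<open>(h, p)\<close> lies on the string in position \<open>p\<close>, above the first \<open>h\<close> crossings and below
  the others.  The crossing \<open>v\<close> takes place between the levels \<open>v\<close> and \<open>v + 1\<close>; the closure arc of
  string \<open>p\<close> leads from \<open>(height K, p)\<close> to \<open>(0, p)\<close>.
\<close>

type_synonym point = "nat \<times> nat"

definition points :: "braid \<Rightarrow> point set" where
  "points K = {0..height K} \<times> {1..strings K}"

definition left_in :: "braid \<Rightarrow> nat \<Rightarrow> point" where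
  "left_in K v = (v, cr_pos K v)"

definition right_in :: "braid \<Rightarrow> nat \<Rightarrow> point" where
  "right_in K v = (v, cr_pos K v + 1)"

definition left_out :: "braid \<Rightarrow> nat \<Rightarrow> point" where
  "left_out K v = (v + 1, cr_pos K v)"

definition right_out :: "braid \<Rightarrow> nat \<Rightarrow> point" where
  "right_out K v = (v + 1, cr_pos K v + 1)"

definition over_in :: "braid \<Rightarrow> nat \<Rightarrow> point" where
  "over_in K v = (if cr_sign K v = 1 then left_in K v else right_in K v)"

definition over_out :: "braid \<Rightarrow> nat \<Rightarrow> point" where
  "over_out K v = (if cr_sign K v = 1 then right_out K v else left_out K v)"

definition under_in :: "braid \<Rightarrow> nat \<Rightarrow> point" where
  "under_in K v = (if cr_sign K v = 1 then right_in K v else left_in K v)"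

definition under_out :: "braid \<Rightarrow> nat \<Rightarrow> point" where
  "under_out K v = (if cr_sign K v = 1 then left_out K v else right_out K v)"

definition next_point :: "braid \<Rightarrow> point \<Rightarrow> point" where
  "next_point K x =
    (if fst x = height K then (0, snd x)
     else if x = over_in K (fst x) then over_out K (fst x)
     else if x = under_in K (fst x) then under_out K (fst x)
     else (fst x + 1, snd x))"

text \<open>
  Cutting the closed braid just after each point of a set \<open>B\<close> decomposes it into pieces, which are
  represented by the sets of points on them.
\<close>

definition cut_step :: "braid \<Rightarrow> point set \<Rightarrow> (point \<times> point) set" where
  "cut_step K B = {(x, next_point K x) | x. x \<in> points K \<and> x \<notin> B}"

definition cut_piece :: "braid \<Rightarrow> point set \<Rightarrow> point \<Rightarrow> point set" where
  "cut_piece K B x = {y. (x, y) \<in> (cut_step K B \<union> (cut_step K B)\<inverse>)\<^sup>*}"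

definition over_ins :: "braid \<Rightarrow> point set" where
  "over_ins K = over_in K ` crossings K"

definition under_ins :: "braid \<Rightarrow> point set" where
  "under_ins K = under_in K ` crossings K"

definition part_arc :: "braid \<Rightarrow> point \<Rightarrow> point set" where
  "part_arc K x = cut_piece K (over_ins K \<union> under_ins K) x"

definition part_arcs :: "braid \<Rightarrow> point set set" where
  "part_arcs K = part_arc K ` points K"

definition components :: "braid \<Rightarrow> point set set" where
  "components K = cut_piece K {} ` points K"


section \<open>States on the part arc-graph\<close>

type_synonym part_coloring = "point set \<Rightarrow> int"

abbreviation col_at :: "braid \<Rightarrow> part_coloring \<Rightarrow> point \<Rightarrow> int" where
  "col_at K s x \<equiv> s (part_arc K x)"

definition is_flow :: "braid \<Rightarrow> part_coloring \<Rightarrow> bool" where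
  "is_flow K s \<longleftrightarrow> s \<in> extensional (part_arcs K) \<and>
    (\<forall>v\<in>crossings K. col_at K s (left_in K v) + col_at K s (right_in K v)
                    = col_at K s (left_out K v) + col_at K s (right_out K v))"

definition closure_col :: "braid \<Rightarrow> part_coloring \<Rightarrow> nat \<Rightarrow> int" where
  "closure_col K s l = col_at K s (height K, l)"

definition plus_states :: "braid \<Rightarrow> nat \<Rightarrow> part_coloring set" where
  "plus_states K n = {s. is_flow K s \<and> (\<forall>P\<in>part_arcs K. s P \<in> {0..int n}) \<and>
    (\<forall>v\<in>crossings K. col_at K s (over_in K v) \<le> col_at K s (over_out K v)) \<and>
    closure_col K s 1 = 0}"

definition minus_states :: "braid \<Rightarrow> nat \<Rightarrow> part_coloring set" where
  "minus_states K n = {s. is_flow K s \<and> (\<forall>P\<in>part_arcs K. s P \<in> {0..int n}) \<and>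
    (\<forall>v\<in>crossings K. col_at K s (over_in K v) \<ge> col_at K s (over_out K v)) \<and>
    closure_col K s 1 = 0}"


section \<open>The framed colored Jones polynomial\<close>

definition f_plus :: "nat \<Rightarrow> int \<Rightarrow> int \<Rightarrow> nat \<Rightarrow> ratfun" where
  "f_plus n i j r = (-1) ^ r
     * v_pow (- (of_int ((int n - 2*i) * (int n - 2*j) + int r * (int r - 1)) / 2))
     * v_binom (j + int r) r * v_falling (int n + int r - i) r"

definition f_minus :: "nat \<Rightarrow> int \<Rightarrow> int \<Rightarrow> nat \<Rightarrow> ratfun" where
  "f_minus n i j r =
       v_pow (of_int ((int n - 2*i - 2*int r) * (int n - 2*j + 2*int r) + int r * (int r - 1)) / 2)
     * v_binom (i + int r) r * v_falling (int n + int r - j) r"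

definition R_factor :: "nat \<Rightarrow> int \<Rightarrow> int \<Rightarrow> int \<Rightarrow> nat \<Rightarrow> ratfun" where
  "R_factor n \<epsilon> i j r = (if \<epsilon> = 1 then f_plus n i j r else f_minus n i j r)"

text \<open>
  The framed colored Jones polynomial of the closure of \<open>K\<close> with the blackboard framing, for the
  representation of dimension \<open>n + 1\<close> and with the value 1 on the 0-framed unknot.  It is defined by
  its state sum on the closed braid, without recourse to its isotopy invariance.
\<close>

definition colored_jones :: "nat \<Rightarrow> braid \<Rightarrow> ratfun" where
  "colored_jones n K = (\<Sum>s\<in>minus_states K n.
     (\<Prod>l=2..strings K. v_pow (of_int (- int n + 2 * closure_col K s l))) *
     (\<Prod>c\<in>crossings K. R_factor n (cr_sign K c)
        (col_at K s (left_in K c)) (col_at K s (right_in K c))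
        (nat (col_at K s (over_in K c) - col_at K s (over_out K c)))))"

definition Z_R :: "nat \<Rightarrow> braid \<Rightarrow> part_coloring \<Rightarrow> ratfun" where
  "Z_R n K s =
     (let a = (\<lambda>c. col_at K s (over_out K c));
          b = (\<lambda>c. col_at K s (under_out K c));
          r = (\<lambda>c. nat (col_at K s (over_out K c) - col_at K s (over_in K c)))
      in (\<Prod>l=2..strings K. v_pow (of_int (int n - 2 * closure_col K s l))) *
         (\<Prod>c | c \<in> crossings K \<and> cr_sign K c = 1. f_plus n (a c) (b c) (r c)) *
         (\<Prod>c | c \<in> crossings K \<and> cr_sign K c = -1. f_minus n (b c) (a c) (r c)))"


section \<open>The arc-graph\<close>

definition overcrossing_arc :: "braid \<Rightarrow> nat \<Rightarrow> point set" where
  "overcrossing_arc K v = cut_piece K (under_ins K) (under_in K v)"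

definition overcrossing_circles :: "braid \<Rightarrow> point set set" where
  "overcrossing_circles K = {C \<in> components K. C \<inter> under_ins K = {}}"

text \<open>\<open>Blue v\<close> and \<open>Red v\<close> are the edges leaving the overcrossing arc that ends at the crossing \<open>v\<close>.\<close>

datatype edge = Blue nat | Red nat

definition edges :: "braid \<Rightarrow> edge set" where
  "edges K = Blue ` crossings K \<union> Red ` crossings K"

text \<open>
  The point at which an edge enters its target vertex; the target is the overcrossing arc or circle
  containing it.  As a red edge enters just after the overpass, the point is different for different
  edges, and a blue edge precedes all the other edges at its target.
\<close>

fun head_point :: "braid \<Rightarrow> edge \<Rightarrow> point" where
  "head_point K (Blue v) = under_out K v"
| "head_point K (Red v) = over_out K v"

definition in_edges :: "braid \<Rightarrow> point set \<Rightarrow> edge set" where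
  "in_edges K u = {e \<in> edges K. head_point K e \<in> u}"

text \<open>
  The order along the orientation of the edges entering the same overcrossing arc.  (It is not used
  for the edges entering a circle, where it would not be irreflexive.)
\<close>

definition edge_before :: "braid \<Rightarrow> edge \<Rightarrow> edge \<Rightarrow> bool" where
  "edge_before K e e' \<longleftrightarrow> (head_point K e, head_point K e') \<in> (cut_step K (under_ins K))\<^sup>+"

text \<open>The second component of a coloring gives the colors of the overcrossing circles.\<close>

type_synonym graph_coloring = "(edge \<Rightarrow> int) \<times> (point set \<Rightarrow> int)"

definition blue_col :: "graph_coloring \<Rightarrow> nat \<Rightarrow> int" where
  "blue_col f v = fst f (Blue v)"

definition red_col :: "graph_coloring \<Rightarrow> nat \<Rightarrow> int" where
  "red_col f v = fst f (Red v)"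

definition vertex_col :: "graph_coloring \<Rightarrow> nat \<Rightarrow> int" where
  "vertex_col f v = blue_col f v + red_col f v"

definition graph_states :: "braid \<Rightarrow> nat \<Rightarrow> graph_coloring set" where
  "graph_states K n =
    {f \<in> (edges K \<rightarrow>\<^sub>E {0..int n}) \<times> (overcrossing_circles K \<rightarrow>\<^sub>E {0..int n}).
       (\<forall>v\<in>crossings K. (\<Sum>e\<in>in_edges K (overcrossing_arc K v). fst f e) = vertex_col f v
                       \<and> vertex_col f v \<le> int n) \<and>
       (\<forall>C\<in>overcrossing_circles K. (\<Sum>e\<in>in_edges K C. fst f e) = 0)}"

definition circle_choice :: "braid \<Rightarrow> (point set \<Rightarrow> point set) \<Rightarrow> bool" where
  "circle_choice K ch \<longleftrightarrow> (\<forall>C\<in>overcrossing_circles K. ch C \<in> part_arcs K \<and> ch C \<subseteq> C)"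

definition induces ::
  "braid \<Rightarrow> (point set \<Rightarrow> point set) \<Rightarrow> graph_coloring \<Rightarrow> part_coloring \<Rightarrow> bool" where
  "induces K ch f s \<longleftrightarrow> s \<in> extensional (part_arcs K) \<and>
     (\<forall>v\<in>crossings K.
        col_at K s (under_out K v) = blue_col f v \<and>
        col_at K s (over_out K v) = col_at K s (over_in K v) + red_col f v \<and>
        col_at K s (under_out K v) = col_at K s (under_in K v) - red_col f v) \<and>
     (\<forall>C\<in>overcrossing_circles K. s (ch C) = snd f C)"

definition flow_map ::
  "braid \<Rightarrow> (point set \<Rightarrow> point set) \<Rightarrow> graph_coloring \<Rightarrow> part_coloring" where
  "flow_map K ch f = (THE s. induces K ch f s)"

definition based_graph_states ::
  "braid \<Rightarrow> (point set \<Rightarrow> point set) \<Rightarrow> nat \<Rightarrow> graph_coloring set" where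
  "based_graph_states K ch n =
     {f \<in> graph_states K n. closure_col K (flow_map K ch f) 1 = 0}"

text \<open>
  The sum of the colors of the edges preceding \<open>Red v\<close> at its target.  If the target is a circle, it
  is by convention the color of the part arc entering the crossing \<open>v\<close> on the overstrand.
\<close>

definition before_sum ::
  "braid \<Rightarrow> (point set \<Rightarrow> point set) \<Rightarrow> graph_coloring \<Rightarrow> nat \<Rightarrow> int" where
  "before_sum K ch f v =
     (if \<exists>C\<in>overcrossing_circles K. head_point K (Red v) \<in> C
      then col_at K (flow_map K ch f) (over_in K v)
      else \<Sum>e | e \<in> edges K \<and> edge_before K e (Red v). fst f e)"

definition exc :: "braid \<Rightarrow> (point set \<Rightarrow> point set) \<Rightarrow> graph_coloring \<Rightarrow> int" where
  "exc K ch f = (\<Sum>v\<in>crossings K. cr_sign K v * blue_col f v * before_sum K ch f v)"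

definition rot :: "braid \<Rightarrow> (point set \<Rightarrow> point set) \<Rightarrow> graph_coloring \<Rightarrow> int" where
  "rot K ch f = (\<Sum>l=2..strings K. closure_col K (flow_map K ch f) l)"

definition delta :: "braid \<Rightarrow> (point set \<Rightarrow> point set) \<Rightarrow> graph_coloring \<Rightarrow> int" where
  "delta K ch f = - (exc K ch f + rot K ch f)"

definition delta' :: "braid \<Rightarrow> nat \<Rightarrow> rat" where
  "delta' K n = - (of_nat n)\<^sup>2 / 4 * of_int (writhe K) + of_nat n / 2 * (of_nat (strings K) - 1)"

end

theory Submission
  imports Defs
begin

text \<open>
  Coloring a part arc by the sum of the colors of the edges that enter its overcrossing arc before it
  identifies graph states with \<open>(+)\<close>-states, up to the constant colors of the circles.  Under this identification the local contributions of the two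
  models agree up to the increment of a potential on the levels of the braid, which telescopes to 0
  around the closure.

  That the \<open>(-)\<close>-state sum defining the Jones polynomial equals the sum of \<open>Z_R\<close> over
  \<open>(+)\<close>-states, i.e. invariance under reversal of orientation, has two ingredients.  Charge
  conjugation \<open>c \<mapsto> n - c\<close> and a diagonal change of basis transform the latter sum into the
  \<open>(-)\<close>-state sum in which the first closure arc has color \<open>n\<close> instead of 0.
  The braid operator, partially closed on the strings \<open>2, ..., s\<close> with the quantum trace,
  commutes with the generator \<open>E\<close> of \<open>U_q(sl_2)\<close>, so all its diagonal entries
  coincide; this makes the two sums equal.
\<close>

section \<open>Powers of the variable and quantum symbols\<close>

text \<open>\<open>Z_R\<close> is matched with the arc-graph summand state by state, but reversal of
  orientation is proved only for the totals: conjugation moves the base color from 0 to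
  \<open>n\<close>, and it is brought back by an identity between sums, not by a bijection of
  states. That identity compares the base colors \<open>a\<close> and \<open>a + 1\<close>. Its
  terms for the strings 2, ..., s cancel because the closure weight gains the factor
  \<open>v^2\<close> when the color of such a string is raised, and the weight of the strings to its
  left loses the same factor when the first color is raised. What remains carries the factor
  \<open>{n - a}\<close>, nonzero for \<open>a < n\<close> since \<open>q\<close> is not a root of
  unity. The obstacle is that intertwining holds on all integer colors while states use
  \<open>{0..n}\<close>. The factors \<open>{n - a}\<close> at the upper end and the quantum
  binomials at the lower end vanish where a color would leave this range, so truncation is harmless.
  Both local comparisons are coboundaries: the discrepancy at a crossing is a quotient (for gauges)
  or difference (for the potential) of quantities attached to the levels above and below, and so
  disappears around the closure.\<close>

abbreviation qp :: "int \<Rightarrow> ratfun" where "qp k \<equiv> q_var powi k"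

lemma q_var_nonzero [simp]: "q_var \<noteq> 0"
  by (simp add: q_var_def Zero_fract_def eq_fract)

lemma q_var_power: "q_var ^ k = Fract (monom 1 k) 1"
proof (induction k)
  case (Suc k)
  then show ?case by (simp add: q_var_def monom_Suc)
qed (simp add: One_fract_def monom_0 one_pCons)

lemma q_var_power_eq_1_iff: "q_var ^ k = 1 \<longleftrightarrow> k = 0"
proof
  assume "q_var ^ k = 1"
  then have "monom (1::int) k = 1"
    by (simp add: q_var_power One_fract_def eq_fract)
  then have "degree (monom (1::int) k) = 0" by simp
  then show "k = 0" by (simp add: degree_monom_eq)
qed simp

text \<open>\<open>q\<close> has infinite order. This makes every bracket \<open>{a}\<close> with
  \<open>a \<noteq> 0\<close>, and with it every quantum factorial, invertible.\<close>

lemma qp_eq_1_iff: "qp k = 1 \<longleftrightarrow> k = 0"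
proof (cases "k \<ge> 0")
  case True
  then show ?thesis using q_var_power_eq_1_iff[of "nat k"] by (simp add: power_int_def)
next
  case False
  then show ?thesis using q_var_power_eq_1_iff[of "nat (- k)"]
    by (auto simp: power_int_def power_inverse)
qed

lemma qp_mult: "qp a * qp b = qp (a + b)"
  by (simp add: power_int_add)

lemma qp_mult_left: "qp a * (qp b * c) = qp (a + b) * c"
  by (simp add: power_int_add mult.assoc)

lemma qp_eq_iff: "qp a = qp b \<longleftrightarrow> a = b"
proof -
  have "qp a = qp (a - b) * qp b" by (simp add: qp_mult)
  then show ?thesis using qp_eq_1_iff[of "a - b"] by auto
qed

lemma qp_power: "qp a ^ k = qp (a * int k)"
  by (simp add: power_int_mult)

lemma qp_powi: "qp a powi k = qp (a * k)"
  by (simp add: power_int_mult)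

lemma v_pow_of_int: "v_pow (of_int a) = qp (2 * a)"
proof -
  have "\<lfloor>2 * (of_int a :: rat)\<rfloor> = 2 * a"
    by (metis floor_of_int of_int_mult of_int_numeral)
  then show ?thesis by (simp add: v_pow_def)
qed

lemma v_pow_half: "v_pow (of_int a / 2) = qp a"
  by (simp add: v_pow_def)

lemma t_pow_of_int: "t_pow (of_int a) = qp (4 * a)"
proof -
  have "\<lfloor>4 * (of_int a :: rat)\<rfloor> = 4 * a"
    by (metis floor_of_int of_int_mult of_int_numeral)
  then show ?thesis by (simp add: t_pow_def)
qed

lemma t_pow_add_int: "t_pow (x + of_int a) = t_pow x * t_pow (of_int a)"
proof -
  have "\<lfloor>4 * (x + of_int a)\<rfloor> = \<lfloor>4 * x\<rfloor> + 4 * a"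
  proof -
    have "4 * (x + of_int a) = 4 * x + of_int (4 * a)" by (simp add: algebra_simps)
    then show ?thesis by (simp only: floor_add_int)
  qed
  then show ?thesis unfolding t_pow_of_int by (simp add: t_pow_def qp_mult)
qed

lemma v_bracket_qp: "v_bracket a = qp (2 * a) - qp (- (2 * a))"
  using v_pow_of_int[of a] v_pow_of_int[of "- a"] by (simp add: v_bracket_def)

lemma v_bracket_eq_0_iff [simp]: "v_bracket a = 0 \<longleftrightarrow> a = 0"
  by (simp add: v_bracket_qp qp_eq_iff)

lemma v_falling_0 [simp]: "v_falling a 0 = 1"
  by (simp add: v_falling_def)

lemma v_falling_Suc: "v_falling a (Suc b) = v_falling a b * v_bracket (a - int b)"
  by (simp add: v_falling_def)

lemma v_falling_Suc': "v_falling a (Suc b) = v_bracket a * v_falling (a - 1) b"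
  unfolding v_falling_def
  by (simp add: prod.lessThan_Suc_shift algebra_simps del: prod.lessThan_Suc)

lemma v_falling_nonzero: "a \<ge> int b \<Longrightarrow> v_falling a b \<noteq> 0"
  by (auto simp: v_falling_def)

text \<open>The factor with index \<open>k = a\<close> is the bracket of 0. This cuts off
  transitions out of the forbidden color -1.\<close>

lemma v_falling_eq_0: "0 \<le> a \<Longrightarrow> a < int b \<Longrightarrow> v_falling a b = 0"
  by (auto simp: v_falling_def intro!: bexI[of _ "nat a"])

lemma f_plus_qp: "f_plus n i j r = (-1) ^ r
     * qp (- ((int n - 2*i) * (int n - 2*j) + int r * (int r - 1)))
     * v_binom (j + int r) r * v_falling (int n + int r - i) r"
  unfolding f_plus_def using v_pow_half[of "- ((int n - 2*i) * (int n - 2*j) + int r * (int r - 1))"]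
  by (simp only: of_int_minus minus_divide_left)

lemma f_minus_qp: "f_minus n i j r =
     qp ((int n - 2*i - 2*int r) * (int n - 2*j + 2*int r) + int r * (int r - 1))
     * v_binom (i + int r) r * v_falling (int n + int r - j) r"
  unfolding f_minus_def v_pow_half ..

lemma v_binom_Suc: "v_binom a (Suc r) = v_binom a r * v_bracket (a - int r) / v_bracket (int r + 1)"
  using v_falling_Suc'[of "int r + 1" r]
  by (simp add: v_binom_def v_falling_Suc add.commute)

lemma v_binom_Suc': "v_binom (a + 1) (Suc r) = v_bracket (a + 1) * v_binom a r / v_bracket (int r + 1)"
  using v_falling_Suc'[of "int r + 1" r]  v_falling_Suc'[of "a + 1" r]
  by (simp add: v_binom_def add.commute)

section \<open>The two R-matrices commute with the generator E\<close>

text \<open>The relation for outgoing colors \<open>x = j + r\<close> and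
  \<open>y = i - 1 - r\<close> at a positive crossing: two of the four terms have overstrand
  decrease \<open>r\<close> and two have \<open>Suc r\<close>. After division by a common factor an
  identity between sums of powers of \<open>q\<close> is left.\<close>

lemma f_plus_intertwines:
  "v_bracket (int n - i + 1) * f_plus n (i - 1) j r
     + qp (2 * (int n - 2 * i)) * v_bracket (int n - j + 1) * f_plus n i (j - 1) (Suc r)
   = v_bracket (int n - j - int r) * f_plus n i j (Suc r)
     + qp (2 * (int n - 2 * (j + int r))) * v_bracket (int n - i + int r + 1) * f_plus n i j r"
proof -
  define P where "P = v_falling (int n + int r - i + 1) (Suc r)"
  define D where "D = v_binom (j + int r) r"
  define e where "e = - ((int n - 2*i) * (int n - 2*j) + int r * (int r - 1))"
  have s: "v_bracket (int r + 1) \<noteq> 0" by simp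
  have P1: "v_bracket (int n - i + 1) * v_falling (int n + int r - (i - 1)) r = P"
    unfolding P_def v_falling_Suc by (simp add: algebra_simps)
  have P2: "v_falling (int n + int (Suc r) - i) (Suc r) = P"
    unfolding P_def by (simp add: algebra_simps)
  have P3: "v_bracket (int n - i + int r + 1) * v_falling (int n + int r - i) r = P"
    unfolding P_def v_falling_Suc' by (simp add: algebra_simps)
  have D2: "v_binom (j - 1 + int (Suc r)) (Suc r) = D * v_bracket j / v_bracket (int r + 1)"
    using v_binom_Suc[of "j + int r" r] by (simp add: D_def)
  have D3: "v_binom (j + int (Suc r)) (Suc r) = v_bracket (j + int r + 1) * D / v_bracket (int r + 1)"
    using v_binom_Suc'[of "j + int r" r] by (simp add: D_def add.assoc add.commute[of 1])
  have e1: "- ((int n - 2*(i - 1)) * (int n - 2*j) + int r * (int r - 1)) = e - 2 * (int n - 2 * j)"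
    by (simp add: e_def algebra_simps)
  have e2: "- ((int n - 2*i) * (int n - 2*(j - 1)) + int (Suc r) * (int (Suc r) - 1))
      = e - 2 * (int n - 2 * i) - 2 * int r"
    by (simp add: e_def algebra_simps)
  have e3: "- ((int n - 2*i) * (int n - 2*j) + int (Suc r) * (int (Suc r) - 1)) = e - 2 * int r"
    by (simp add: e_def algebra_simps)
  \<comment> \<open>The denominator stems from the binomials with lower index \<open>Suc r\<close>;
    the terms with index \<open>r\<close> carry a compensating bracket instead.\<close>
  let ?c = "(-1) ^ r * P * D / v_bracket (int r + 1)"
  have t1: "v_bracket (int n - i + 1) * f_plus n (i - 1) j r
      = ?c * (qp (e - 2 * (int n - 2 * j)) * v_bracket (int r + 1))"
    unfolding f_plus_qp e1 P1[symmetric] D_def using s by simp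
  have t2: "qp (2 * (int n - 2 * i)) * v_bracket (int n - j + 1) * f_plus n i (j - 1) (Suc r)
      = ?c * (- (qp (e - 2 * int r) * v_bracket (int n - j + 1) * v_bracket j))"
    unfolding f_plus_qp e2 P2 D2 by (simp add: ac_simps) (simp add: qp_mult)
  have t3: "v_bracket (int n - j - int r) * f_plus n i j (Suc r)
      = ?c * (- (qp (e - 2 * int r) * v_bracket (int n - j - int r) * v_bracket (j + int r + 1)))"
    unfolding f_plus_qp e3 P2 D3 by (simp add: ac_simps)
  have t4: "qp (2 * (int n - 2 * (j + int r))) * v_bracket (int n - i + int r + 1) * f_plus n i j r
      = ?c * (qp (e + 2 * (int n - 2 * (j + int r))) * v_bracket (int r + 1))"
    unfolding f_plus_qp e_def[symmetric] P3[symmetric] D_def[symmetric]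
    using s by (simp add: ac_simps) (simp add: qp_mult)
  have "qp (e - 2 * (int n - 2 * j)) * v_bracket (int r + 1)
      + - (qp (e - 2 * int r) * v_bracket (int n - j + 1) * v_bracket j)
    = - (qp (e - 2 * int r) * v_bracket (int n - j - int r) * v_bracket (j + int r + 1))
      + qp (e + 2 * (int n - 2 * (j + int r))) * v_bracket (int r + 1)"
    by (simp add: v_bracket_qp ring_distribs qp_mult mult.assoc) (simp add: algebra_simps)
  then show ?thesis unfolding t1 t2 t3 t4 by (simp only: distrib_left[symmetric])
qed

text \<open>Now the overstrand runs from right to left, with \<open>x = j - 1 - r\<close> and
  \<open>y = i + r\<close>, so \<open>r\<close> and \<open>Suc r\<close> change places among the
  four terms.\<close>

lemma f_minus_intertwines:
  "v_bracket (int n - i + 1) * f_minus n (i - 1) j (Suc r)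
     + qp (2 * (int n - 2 * i)) * v_bracket (int n - j + 1) * f_minus n i (j - 1) r
   = v_bracket (int n - j + int r + 1) * f_minus n i j r
     + qp (2 * (int n - 2 * (j - 1 - int r))) * v_bracket (int n - i - int r) * f_minus n i j (Suc r)"
proof -
  define P where "P = v_falling (int n + int r - j + 1) (Suc r)"
  define D where "D = v_binom (i + int r) r"
  define e where "e = (int n - 2*i - 2*int r) * (int n - 2*j + 2*int r) + int r * (int r - 1)"
  have s: "v_bracket (int r + 1) \<noteq> 0" by simp
  have P1: "v_bracket (int n - j + 1) * v_falling (int n + int r - (j - 1)) r = P"
    unfolding P_def v_falling_Suc by (simp add: algebra_simps)
  have P2: "v_falling (int n + int (Suc r) - j) (Suc r) = P"
    unfolding P_def by (simp add: algebra_simps)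
  have P3: "v_bracket (int n - j + int r + 1) * v_falling (int n + int r - j) r = P"
    unfolding P_def v_falling_Suc' by (simp add: algebra_simps)
  have D2: "v_binom (i - 1 + int (Suc r)) (Suc r) = D * v_bracket i / v_bracket (int r + 1)"
    using v_binom_Suc[of "i + int r" r] by (simp add: D_def)
  have D3: "v_binom (i + int (Suc r)) (Suc r) = v_bracket (i + int r + 1) * D / v_bracket (int r + 1)"
    using v_binom_Suc'[of "i + int r" r] by (simp add: D_def add.assoc add.commute[of 1])
  have e1: "(int n - 2*i - 2*int r) * (int n - 2*(j - 1) + 2*int r) + int r * (int r - 1)
      = e + 2 * (int n - 2 * i - 2 * int r)"
    by (simp add: e_def algebra_simps)
  have e2: "(int n - 2*(i - 1) - 2*int (Suc r)) * (int n - 2*j + 2*int (Suc r))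
        + int (Suc r) * (int (Suc r) - 1)
      = e + 2 * (int n - 2 * i - 2 * int r) + 2 * int r"
    by (simp add: e_def algebra_simps)
  have e3: "(int n - 2*i - 2*int (Suc r)) * (int n - 2*j + 2*int (Suc r))
        + int (Suc r) * (int (Suc r) - 1)
      = e + 2 * (int n - 2 * i - 2 * int r) - 2 * (int n - 2 * j + 2 * int r) - 4 + 2 * int r"
    by (simp add: e_def algebra_simps)
  let ?c = "P * D / v_bracket (int r + 1)"
  have t1: "v_bracket (int n - i + 1) * f_minus n (i - 1) j (Suc r)
      = ?c * (qp (e + 2 * (int n - 2 * i - 2 * int r) + 2 * int r) * v_bracket (int n - i + 1)
          * v_bracket i)"
    unfolding f_minus_qp e2 P2 D2 by (simp add: ac_simps)
  have t2: "qp (2 * (int n - 2 * i)) * v_bracket (int n - j + 1) * f_minus n i (j - 1) r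
      = ?c * (qp (2 * (int n - 2 * i) + (e + 2 * (int n - 2 * i - 2 * int r)))
          * v_bracket (int r + 1))"
    unfolding f_minus_qp e1 P1[symmetric] D_def[symmetric] qp_mult[symmetric]
    using s by (simp add: ac_simps)
  have t3: "v_bracket (int n - j + int r + 1) * f_minus n i j r
      = ?c * (qp e * v_bracket (int r + 1))"
    unfolding f_minus_qp e_def[symmetric] P3[symmetric] D_def[symmetric]
    using s by (simp add: ac_simps)
  have t4: "qp (2 * (int n - 2 * (j - 1 - int r))) * v_bracket (int n - i - int r) * f_minus n i j (Suc r)
      = ?c * (qp (2 * (int n - 2 * (j - 1 - int r)) +
          (e + 2 * (int n - 2 * i - 2 * int r) - 2 * (int n - 2 * j + 2 * int r) - 4 + 2 * int r))
          * v_bracket (int n - i - int r) * v_bracket (i + int r + 1))"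
    unfolding f_minus_qp e3 P2 D3 qp_mult[symmetric] by (simp add: ac_simps)
  have "qp (e + 2 * (int n - 2 * i - 2 * int r) + 2 * int r) * v_bracket (int n - i + 1) * v_bracket i
      + qp (2 * (int n - 2 * i) + (e + 2 * (int n - 2 * i - 2 * int r))) * v_bracket (int r + 1)
    = qp e * v_bracket (int r + 1) + qp (2 * (int n - 2 * (j - 1 - int r)) +
          (e + 2 * (int n - 2 * i - 2 * int r) - 2 * (int n - 2 * j + 2 * int r) - 4 + 2 * int r))
          * v_bracket (int n - i - int r) * v_bracket (i + int r + 1)"
    by (simp add: v_bracket_qp ring_distribs qp_mult mult.assoc) (simp add: algebra_simps)
  then show ?thesis unfolding t1 t2 t3 t4 by (simp only: distrib_left[symmetric])
qed

text \<open>The entry from the incoming pair \<open>(i, j)\<close> to the outgoing pair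
  \<open>(x, y)\<close>, each read from left to right. Colors range over all integers, so that the
  intertwining relation holds without boundary terms.\<close>

definition R_entry :: "nat \<Rightarrow> int \<Rightarrow> int \<Rightarrow> int \<Rightarrow> int \<Rightarrow> int \<Rightarrow> ratfun" where
  "R_entry n \<epsilon> i j x y =
     (if i + j = x + y \<and> (if \<epsilon> = 1 then y \<le> i else x \<le> j)
      then R_factor n \<epsilon> i j (nat (if \<epsilon> = 1 then i - y else j - x)) else 0)"

lemma R_entry_plus:
  "x = j + int r \<Longrightarrow> y = i - int r \<Longrightarrow> R_entry n 1 i j x y = f_plus n i j r"
  by (simp add: R_entry_def R_factor_def)

lemma R_entry_minus:
  "\<epsilon> \<noteq> 1 \<Longrightarrow> x = j - int r \<Longrightarrow> y = i + int r \<Longrightarrow> R_entry n \<epsilon> i j x y = f_minus n i j r"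
  by (simp add: R_entry_def R_factor_def)

lemma R_entry_intertwines:
  "v_bracket (int n - i + 1) * R_entry n \<epsilon> (i - 1) j x y
     + qp (2 * (int n - 2 * i)) * v_bracket (int n - j + 1) * R_entry n \<epsilon> i (j - 1) x y
   = v_bracket (int n - x) * R_entry n \<epsilon> i j (x + 1) y
     + qp (2 * (int n - 2 * x)) * v_bracket (int n - y) * R_entry n \<epsilon> i j x (y + 1)"
  (is "?a1 * ?A1 + ?a2 * ?A2 = ?a3 * ?A3 + ?a4 * ?A4")
proof (cases "i + j = x + y + 1")
  case False
  then have "?A1 = 0" "?A2 = 0" "?A3 = 0" "?A4 = 0" by (auto simp: R_entry_def)
  then show ?thesis by simp
next
  case sum: True
  show ?thesis
  proof (cases "\<epsilon> = 1")
    case True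
    \<comment> \<open>The case \<open>y = i\<close> would be \<open>r = -1\<close> in the general
      formula: two terms survive, both with decrease 0. For larger \<open>y\<close> all four
      vanish.\<close>
    consider r where "y = i - 1 - int r" | "y = i" | "y > i"
      using nonneg_int_cases[of "i - 1 - y"] by (metis diff_diff_eq2 diff_ge_0_iff_ge
        add_diff_cancel_left' linorder_less_linear zle_diff1_eq)
    then show ?thesis
    proof cases
      case (1 r)
      have x: "x = j + int r" using sum 1 by simp
      have eqs: "int n - x = int n - j - int r" "int n - y = int n - i + int r + 1"
        using x 1 by simp_all
      have "?A1 = f_plus n (i - 1) j r" "?A2 = f_plus n i (j - 1) (Suc r)"
        "?A3 = f_plus n i j (Suc r)" "?A4 = f_plus n i j r"
        unfolding True by (rule R_entry_plus; simp add: x 1)+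
      moreover have "?a3 = v_bracket (int n - j - int r)" 
        "?a4 = qp (2 * (int n - 2 * (j + int r))) * v_bracket (int n - i + int r + 1)"
        unfolding eqs unfolding x by (rule refl)+
      ultimately show ?thesis using f_plus_intertwines[of n i j r] by (simp only:)
    next
      case 2
      have x: "x = j - 1" using sum 2 by simp
      have "?A1 = 0" "?A4 = 0" using True 2 by (auto simp: R_entry_def)
      moreover have "?A2 = f_plus n i (j - 1) 0" "?A3 = f_plus n i j 0"
        unfolding True by (rule R_entry_plus; simp add: x 2)+
      moreover have "int n - x = int n - j + 1" using x by simp
      then have "?a3 = v_bracket (int n - j + 1)" by (simp only:)
      moreover have "2 * (int n - 2 * i) - (int n - 2 * i) * (int n - 2 * (j - 1))
        = - ((int n - 2 * i) * (int n - 2 * j))" by (simp add: algebra_simps)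
      ultimately show ?thesis
        by (simp add: f_plus_qp v_binom_def qp_mult_left qp_mult mult.commute[of _ "v_bracket _"] mult.assoc)
    next
      case 3
      then have "?A1 = 0" "?A2 = 0" "?A3 = 0" "?A4 = 0" using True by (auto simp: R_entry_def)
      then show ?thesis by simp
    qed
  next
    case False
    consider r where "x = j - 1 - int r" | "x = j" | "x > j"
      using nonneg_int_cases[of "j - 1 - x"] by (metis diff_diff_eq2 diff_ge_0_iff_ge
        add_diff_cancel_left' linorder_less_linear zle_diff1_eq)
    then show ?thesis
    proof cases
      case (1 r)
      have y: "y = i + int r" using sum 1 by simp
      have eqs: "int n - x = int n - j + int r + 1" "int n - y = int n - i - int r"
        using y 1 by simp_all
      have "?A1 = f_minus n (i - 1) j (Suc r)" "?A2 = f_minus n i (j - 1) r"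
        "?A3 = f_minus n i j r" "?A4 = f_minus n i j (Suc r)"
        by (rule R_entry_minus[OF False]; simp add: y 1)+
      moreover have "?a3 = v_bracket (int n - j + int r + 1)"
        "?a4 = qp (2 * (int n - 2 * (j - 1 - int r))) * v_bracket (int n - i - int r)"
        unfolding eqs unfolding 1 by (rule refl)+
      ultimately show ?thesis using f_minus_intertwines[of n i j r] by (simp only:)
    next
      case 2
      have y: "y = i - 1" using sum 2 by simp
      have "?A2 = 0" "?A3 = 0" using False 2 by (auto simp: R_entry_def)
      moreover have "?A1 = f_minus n (i - 1) j 0" "?A4 = f_minus n i j 0"
        by (rule R_entry_minus[OF False]; simp add: y 2)+
      moreover have "int n - y = int n - i + 1" using y by simp
      then have "?a4 = qp (2 * (int n - 2 * j)) * v_bracket (int n - i + 1)" using 2 by (simp only:)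
      moreover have "2 * (int n - 2 * j) + (int n - 2 * i) * (int n - 2 * j)
        = (int n - 2 * (i - 1)) * (int n - 2 * j)" by (simp add: algebra_simps)
      ultimately show ?thesis
        by (simp add: f_minus_qp v_binom_def qp_mult_left qp_mult mult.commute[of _ "v_bracket _"] mult.assoc)
    next
      case 3
      then have "?A1 = 0" "?A2 = 0" "?A3 = 0" "?A4 = 0" using False by (auto simp: R_entry_def)
      then show ?thesis by simp
    qed
  qed
qed

text \<open>At a negative crossing the decrease is \<open>r = y + 1\<close>, and the quantum
  binomial of \<open>r - 1\<close> over \<open>r\<close> is 0. At a positive one the overstrand
  would have to increase.\<close>

lemma R_entry_eq_0_left: "y \<ge> 0 \<Longrightarrow> R_entry n \<epsilon> (-1) j x y = 0"
  by (auto simp: R_entry_def R_factor_def f_minus_def v_binom_def v_falling_eq_0)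

lemma R_entry_eq_0_right: "x \<ge> 0 \<Longrightarrow> R_entry n \<epsilon> i (-1) x y = 0"
  by (auto simp: R_entry_def R_factor_def f_plus_def v_binom_def v_falling_eq_0)

section \<open>Quantum factorials and charge conjugation\<close>

lemma v_falling_add: "v_falling a (r + s) = v_falling a r * v_falling (a - int r) s"
  by (induction s) (simp_all add: v_falling_Suc algebra_simps)

text \<open>The quantum factorial not normalized by powers of the bracket of 1. For negative
  arguments it is 1, so it never vanishes.\<close>

definition v_fact :: "int \<Rightarrow> ratfun" where
  "v_fact a = v_falling a (nat a)"

lemma v_fact_nonzero [simp]: "v_fact a \<noteq> 0"
  by (cases "a \<ge> 0") (auto simp: v_fact_def v_falling_nonzero)

lemma v_falling_eq_fact:
  assumes "a \<ge> int r"
  shows "v_falling a r = v_fact a / v_fact (a - int r)"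
proof -
  have "nat a = r + nat (a - int r)" using assms by auto
  then have "v_fact a = v_falling a r * v_fact (a - int r)"
    unfolding v_fact_def by (metis v_falling_add)
  then show ?thesis by simp
qed

lemma v_binom_eq_fact:
  assumes "b \<ge> 0"
  shows "v_binom (b + int r) r = v_fact (b + int r) / (v_fact (int r) * v_fact b)"
  using v_falling_eq_fact[of r "b + int r"] assms
  by (simp add: v_binom_def) (simp add: v_fact_def)

text \<open>Multiplied by the gauges of the outgoing colors, the binomial and the falling factorial
  of a crossing combine to an expression that is invariant under conjugation. The Gaussian exponent
  \<open>- (2 * i\<^sup>2)\<close> balances the change of \<open>(n - 2 * i) * (n - 2 * j)\<close>
  when \<open>r\<close> passes from one strand to the other.\<close>

definition gauge :: "nat \<Rightarrow> int \<Rightarrow> ratfun" where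
  "gauge n i = v_fact i * v_fact (int n - i) * qp (- (2 * i\<^sup>2))"

lemma gauge_nonzero [simp]: "gauge n i \<noteq> 0"
  by (simp add: gauge_def)

text \<open>
  Charge conjugation \<open>i \<mapsto> n - i\<close> turns the rotated \<open>R\<close>-matrix back into the \<open>R\<close>-matrix, up to
  a diagonal change of basis.
\<close>

lemma f_plus_conjugate:
  assumes "0 \<le> x" "x + int r \<le> int n" "0 \<le> i" "i + int r \<le> int n"
  shows "f_plus n (i + int r) x r * (gauge n x * gauge n (i + int r))
    = f_plus n (int n - i) (int n - (x + int r)) r * (gauge n i * gauge n (x + int r))"
proof -
  have 1: "v_binom (int n - (x + int r) + int r) r
      = v_fact (int n - x) / (v_fact (int r) * v_fact (int n - (x + int r)))"
    using v_binom_eq_fact[of "int n - (x + int r)" r] assms by simp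
  have 2: "v_falling (int n + int r - (i + int r)) r = v_fact (int n - i) / v_fact (int n - (i + int r))"
    using v_falling_eq_fact[of r "int n - i"] assms by (simp add: algebra_simps)
  have 3: "v_falling (int n + int r - (int n - i)) r = v_fact (i + int r) / v_fact i"
    using v_falling_eq_fact[of r "i + int r"] assms by (simp add: algebra_simps)
  have e: "qp (- ((int n - 2*(i + int r)) * (int n - 2*x) + int r * (int r - 1)))
        * qp (- (2 * x\<^sup>2)) * qp (- (2 * (i + int r)\<^sup>2))
      = qp (- ((int n - 2*(int n - i)) * (int n - 2*(int n - (x + int r))) + int r * (int r - 1)))
        * qp (- (2 * i\<^sup>2)) * qp (- (2 * (x + int r)\<^sup>2))"
    by (simp add: qp_mult) (simp add: algebra_simps power2_eq_square)
  have "f_plus n (i + int r) x r * (gauge n x * gauge n (i + int r))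
    = (-1) ^ r * v_fact (x + int r) * v_fact (int n - i) * v_fact (int n - x) * v_fact (i + int r)
        / v_fact (int r) * (qp (- ((int n - 2*(i + int r)) * (int n - 2*x) + int r * (int r - 1)))
        * qp (- (2 * x\<^sup>2)) * qp (- (2 * (i + int r)\<^sup>2)))"
    unfolding f_plus_qp 2 v_binom_eq_fact[OF assms(1)] gauge_def by (simp add: ac_simps)
  also have "\<dots> = f_plus n (int n - i) (int n - (x + int r)) r * (gauge n i * gauge n (x + int r))"
    unfolding f_plus_qp e 1 3 gauge_def by (simp add: ac_simps)
  finally show ?thesis .
qed

lemma f_minus_conjugate:
  assumes "0 \<le> y" "y + int r \<le> int n" "0 \<le> j" "j + int r \<le> int n"
  shows "f_minus n y (j + int r) r * (gauge n y * gauge n (j + int r))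
    = f_minus n (int n - (y + int r)) (int n - j) r * (gauge n j * gauge n (y + int r))"
proof -
  have 1: "v_binom (int n - (y + int r) + int r) r
      = v_fact (int n - y) / (v_fact (int r) * v_fact (int n - (y + int r)))"
    using v_binom_eq_fact[of "int n - (y + int r)" r] assms by simp
  have 2: "v_falling (int n + int r - (j + int r)) r = v_fact (int n - j) / v_fact (int n - (j + int r))"
    using v_falling_eq_fact[of r "int n - j"] assms by (simp add: algebra_simps)
  have 3: "v_falling (int n + int r - (int n - j)) r = v_fact (j + int r) / v_fact j"
    using v_falling_eq_fact[of r "j + int r"] assms by (simp add: algebra_simps)
  have e: "qp ((int n - 2*y - 2*int r) * (int n - 2*(j + int r) + 2*int r) + int r * (int r - 1))
        * qp (- (2 * y\<^sup>2)) * qp (- (2 * (j + int r)\<^sup>2))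
      = qp ((int n - 2*(int n - (y + int r)) - 2 * int r) * (int n - 2*(int n - j) + 2 * int r)
            + int r * (int r - 1))
        * qp (- (2 * j\<^sup>2)) * qp (- (2 * (y + int r)\<^sup>2))"
    by (simp add: qp_mult) (simp add: algebra_simps power2_eq_square)
  have "f_minus n y (j + int r) r * (gauge n y * gauge n (j + int r))
    = v_fact (y + int r) * v_fact (int n - j) * v_fact (int n - y) * v_fact (j + int r)
        / v_fact (int r) * (qp ((int n - 2*y - 2*int r) * (int n - 2*(j + int r) + 2*int r)
          + int r * (int r - 1)) * qp (- (2 * y\<^sup>2)) * qp (- (2 * (j + int r)\<^sup>2)))"
    unfolding f_minus_qp 2 v_binom_eq_fact[OF assms(1)] gauge_def by (simp add: ac_simps)
  also have "\<dots> = f_minus n (int n - (y + int r)) (int n - j) r * (gauge n j * gauge n (y + int r))"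
    unfolding f_minus_qp e 1 3 gauge_def by (simp add: ac_simps)
  finally show ?thesis .
qed

section \<open>From symmetric symbols in v to one-sided symbols in t\<close>

text \<open>Each bracket \<open>{a}\<close> is \<open>- qp (- (2 * a))\<close> times
  \<open>1 - t ^ a\<close>. The resulting sign will cancel the \<open>(-1) ^ r\<close> of
  \<open>f_plus\<close>; with \<open>t\<close> inverted no sign arises, in accordance with
  \<open>f_minus\<close>.\<close>

lemma v_falling_t_falling_plus:
  "v_falling a r = (-1) ^ r * qp (- (2 * int r * a) + int r * (int r - 1)) * t_falling (qp 4) a r"
proof (induction r)
  case (Suc r)
  have "v_bracket (a - int r) = - (qp (- (2 * (a - int r))) * (1 - qp 4 powi (a - int r)))"
    unfolding qp_powi by (simp add: v_bracket_qp right_diff_distrib qp_mult)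
  then have "v_falling a (Suc r) = (-1) ^ Suc r
      * (qp (- (2 * int r * a) + int r * (int r - 1)) * qp (- (2 * (a - int r))))
      * t_falling (qp 4) a (Suc r)"
    unfolding v_falling_Suc Suc by (simp add: t_falling_def)
  then show ?case unfolding qp_mult by (simp add: algebra_simps)
qed (simp add: t_falling_def)

lemma v_falling_t_falling_minus:
  "v_falling a r = qp (2 * int r * a - int r * (int r - 1)) * t_falling (qp (- 4)) a r"
proof (induction r)
  case (Suc r)
  have "v_bracket (a - int r) = qp (2 * (a - int r)) * (1 - qp (- 4) powi (a - int r))"
    unfolding qp_powi by (simp add: v_bracket_qp right_diff_distrib qp_mult)
  then have "v_falling a (Suc r) = (qp (2 * int r * a - int r * (int r - 1)) * qp (2 * (a - int r)))
      * t_falling (qp (- 4)) a (Suc r)"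
    unfolding v_falling_Suc Suc by (simp add: t_falling_def)
  then show ?case unfolding qp_mult by (simp add: algebra_simps)
qed (simp add: t_falling_def)

lemma t_int_nonzero: "e \<noteq> 0 \<Longrightarrow> k > 0 \<Longrightarrow> t_int (qp e) k \<noteq> 0"
  by (simp add: t_int_def qp_power qp_eq_1_iff)

lemma t_fact_0 [simp]: "t_fact x 0 = 1"
  by (simp add: t_fact_def)

lemma t_fact_Suc: "t_fact x (Suc k) = t_fact x k * t_int x (Suc k)"
  by (simp add: t_fact_def)

lemma t_fact_nonzero: "e \<noteq> 0 \<Longrightarrow> t_fact (qp e) k \<noteq> 0"
  by (induction k) (simp_all add: t_fact_Suc t_int_nonzero)

text \<open>The sign \<open>e\<close> selects the base \<open>t\<close> or its inverse. The powers
  of the bracket of 1 will cancel in binomials.\<close>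

lemma v_fact_t_fact:
  assumes "e = 1 \<or> e = - 1"
  shows "v_fact (int m) = v_bracket 1 ^ m * qp (- (e * (int m * (int m - 1)))) * t_fact (qp (4 * e)) m"
proof (induction m)
  case (Suc m)
  let ?k = "int (Suc m)"
  have "v_fact ?k = v_bracket ?k * v_fact (int m)"
    using v_falling_Suc'[of ?k m] by (simp add: v_fact_def nat_add_distrib)
  moreover have "v_bracket ?k = v_bracket 1 * qp (- (e * 2 * int m)) * t_int (qp (4 * e)) (Suc m)"
  proof -
    have *: "v_bracket a = of_int e * (qp (- (2 * e * a)) * (qp (4 * e * a) - 1))" for a
      using assms by (auto simp: v_bracket_qp right_diff_distrib qp_mult)
    have [simp]: "qp (e * 4) \<noteq> 1" using assms by (auto simp: qp_eq_1_iff)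
    have "v_bracket 1 * qp (- (e * 2 * int m)) * t_int (qp (4 * e)) (Suc m)
      = of_int e * (qp (- (2 * e)) * qp (- (e * 2 * int m)) * (qp (4 * e * ?k) - 1))"
      using *[of 1] unfolding t_int_def qp_power by (simp only: mult_1_right) (simp add: ac_simps)
    also have "\<dots> = v_bracket ?k"
      unfolding *[of ?k] qp_mult by (simp add: algebra_simps)
    finally show ?thesis by simp
  qed
  ultimately have "v_fact ?k = v_bracket 1 ^ Suc m
      * (qp (- (e * (int m * (int m - 1)))) * qp (- (e * 2 * int m))) * t_fact (qp (4 * e)) (Suc m)"
    using Suc by (simp add: t_fact_Suc)
  then show ?case unfolding qp_mult by (simp add: algebra_simps)
qed (simp add: v_fact_def)

lemma v_binom_t_binom:
  assumes "e = 1 \<or> e = - 1"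
  shows "v_binom (int b + int r) r = qp (- (2 * e * int b * int r)) * t_binom (qp (4 * e)) (b + r) b"
proof -
  have "v_binom (int b + int r) r = v_fact (int (b + r)) / (v_fact (int r) * v_fact (int b))"
    using v_binom_eq_fact[of "int b" r] by simp
  also have "\<dots> = qp (- (e * (int (b + r) * (int (b + r) - 1)))) /
        (qp (- (e * (int r * (int r - 1)))) * qp (- (e * (int b * (int b - 1)))))
        * t_binom (qp (4 * e)) (b + r) b"
    unfolding v_fact_t_fact[OF assms] t_binom_def
    by (simp add: power_add)
  also have "qp (- (e * (int (b + r) * (int (b + r) - 1)))) /
        (qp (- (e * (int r * (int r - 1)))) * qp (- (e * (int b * (int b - 1)))))
      = qp (- (2 * e * int b * int r))"
    by (simp add: qp_mult power_int_diff[symmetric]) (simp add: algebra_simps)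
  finally show ?thesis .
qed

text \<open>The exponent is sorted by its destination: \<open>- (int n)\<^sup>2\<close> goes to the
  writhe, \<open>4 * (int n * b)\<close> stays at the crossing, \<open>- 4 * (b * i)\<close> goes to
  \<open>exc\<close>, and the last term will be the increment of a potential.\<close>

lemma f_plus_t:
  assumes "0 \<le> b"
  shows "f_plus n (i + int r) b r
    = qp (- (int n)\<^sup>2 + 4 * (int n * b) - 4 * (b * i) + 2 * (int n + int r) * (i - b))
      * t_binom (qp (- 4)) (nat (b + int r)) (nat b) * t_falling (qp 4) (int n - i) r"
proof -
  obtain m where m: "b = int m" using assms nonneg_int_cases by blast
  have *: "v_binom (b + int r) r = qp (2 * b * int r) * t_binom (qp (- 4)) (nat (b + int r)) (nat b)"
    using v_binom_t_binom[of "- 1" m r] m by (simp add: nat_add_distrib)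
  have "v_falling (int n + int r - (i + int r)) r
      = (-1) ^ r * qp (- (2 * int r * (int n - i)) + int r * (int r - 1)) * t_falling (qp 4) (int n - i) r"
    using v_falling_t_falling_plus[of "int n - i" r] by simp
  then have "f_plus n (i + int r) b r = ((-1) ^ r * (-1) ^ r) *
      (qp (- ((int n - 2*(i + int r)) * (int n - 2*b) + int r * (int r - 1))) *
       qp (2 * b * int r) * qp (- (2 * int r * (int n - i)) + int r * (int r - 1)))
      * t_binom (qp (- 4)) (nat (b + int r)) (nat b) * t_falling (qp 4) (int n - i) r"
    unfolding f_plus_qp * by (simp only: ac_simps)
  then show ?thesis
    unfolding qp_mult power_add[symmetric] by (simp add: algebra_simps power2_eq_square)
qed

lemma f_minus_t:
  assumes "0 \<le> b"
  shows "f_minus n b (i + int r) r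
    = qp ((int n)\<^sup>2 - 4 * (int n * b) + 4 * (b * i) - 2 * (int n - int r) * (i - b))
      * t_binom (qp 4) (nat (b + int r)) (nat b) * t_falling (qp (- 4)) (int n - i) r"
proof -
  obtain m where m: "b = int m" using assms nonneg_int_cases by blast
  have *: "v_binom (b + int r) r = qp (- (2 * b * int r)) * t_binom (qp 4) (nat (b + int r)) (nat b)"
    using v_binom_t_binom[of "1" m r] m by (simp add: nat_add_distrib)
  have "v_falling (int n + int r - (i + int r)) r
      = qp (2 * int r * (int n - i) - int r * (int r - 1)) * t_falling (qp (- 4)) (int n - i) r"
    using v_falling_t_falling_minus[of "int n - i" r] by simp
  then have "f_minus n b (i + int r) r =
      (qp ((int n - 2*b - 2*int r) * (int n - 2*(i + int r) + 2*int r) + int r * (int r - 1)) *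
       qp (- (2 * b * int r)) * qp (2 * int r * (int n - i) - int r * (int r - 1)))
      * t_binom (qp 4) (nat (b + int r)) (nat b) * t_falling (qp (- 4)) (int n - i) r"
    unfolding f_minus_qp * by (simp only: ac_simps)
  then show ?thesis
    unfolding qp_mult by (simp add: algebra_simps power2_eq_square)
qed

section \<open>Integrality: Laurent polynomials in q\<close>

lemma laurent_polysI: "x = Fract p 1 * qp (- int k) \<Longrightarrow> x \<in> laurent_polys"
  by (auto simp: laurent_polys_def)

lemma Fract_laurent: "Fract p 1 \<in> laurent_polys"
  by (rule laurent_polysI[of _ p 0]) simp

lemma laurent_mult:
  assumes "x \<in> laurent_polys" "y \<in> laurent_polys"
  shows "x * y \<in> laurent_polys"
proof -
  obtain p k p' k' where "x = Fract p 1 * qp (- int k)" "y = Fract p' 1 * qp (- int k')"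
    using assms by (auto simp: laurent_polys_def)
  then have "x * y = (Fract p 1 * Fract p' 1) * (qp (- int k) * qp (- int k'))"
    by (simp only: ac_simps)
  then show ?thesis
    by (intro laurent_polysI[of _ "p * p'" "k + k'"]) (simp add: qp_mult algebra_simps)
qed

lemma qp_laurent: "qp k \<in> laurent_polys"
proof (cases "k \<ge> 0")
  case True
  then have "qp k = Fract (monom 1 (nat k)) 1"
    by (simp add: power_int_def q_var_power)
  then show ?thesis by (simp add: Fract_laurent)
next
  case False
  then show ?thesis by (intro laurent_polysI[of _ 1 "nat (- k)"]) (simp add: One_fract_def[symmetric])
qed

lemma laurent_add:
  assumes "x \<in> laurent_polys" "y \<in> laurent_polys"
  shows "x + y \<in> laurent_polys"
proof -
  obtain p k p' k' where *: "x = Fract p 1 * qp (- int k)" "y = Fract p' 1 * qp (- int k')"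
    using assms by (auto simp: laurent_polys_def)
  have "qp (- int k) = Fract (monom 1 k') 1 * qp (- int (k + k'))"
    "qp (- int k') = Fract (monom 1 k) 1 * qp (- int (k + k'))"
    unfolding q_var_power[symmetric] power_int_of_nat[symmetric] qp_mult by simp_all
  then have "x + y = (Fract p 1 * Fract (monom 1 k') 1 + Fract p' 1 * Fract (monom 1 k) 1)
      * qp (- int (k + k'))"
    unfolding * by (simp only: ring_distribs mult.assoc)
  then show ?thesis
    by (intro laurent_polysI[of _ "p * monom 1 k' + p' * monom 1 k" "k + k'"]) simp
qed

lemma laurent_diff:
  assumes "x \<in> laurent_polys" "y \<in> laurent_polys"
  shows "x - y \<in> laurent_polys"
proof -
  have "- 1 \<in> laurent_polys"
    using Fract_laurent[of "- 1"] minus_fract[of "1::int poly" 1] by (simp add: One_fract_def)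
  then have "x + (- 1) * y \<in> laurent_polys"
    using assms by (intro laurent_add laurent_mult)
  then show ?thesis by simp
qed

lemma laurent_1: "1 \<in> laurent_polys"
  using qp_laurent[of 0] by simp

lemma laurent_sum: "(\<And>a. a \<in> A \<Longrightarrow> f a \<in> laurent_polys) \<Longrightarrow> sum f A \<in> laurent_polys"
  using Fract_laurent[of 0]
  by (induction A rule: infinite_finite_induct) (simp_all add: laurent_add Zero_fract_def[symmetric])

lemma laurent_prod: "(\<And>a. a \<in> A \<Longrightarrow> f a \<in> laurent_polys) \<Longrightarrow> prod f A \<in> laurent_polys"
  by (induction A rule: infinite_finite_induct) (simp_all add: laurent_mult laurent_1)

lemma t_int_add: "t_int x (a + b) = t_int x a + x ^ a * t_int x b"
  by (simp add: t_int_def add_divide_distrib[symmetric] power_add algebra_simps)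

text \<open>Comes from splitting the quantum integer of \<open>Suc a\<close> as \<open>Suc b\<close>
  plus the rest. The strict inequality keeps the natural number \<open>a - Suc b\<close> from being
  truncated; the case \<open>b = a\<close> is a diagonal binomial, equal to 1.\<close>

lemma t_binom_Pascal:
  assumes e: "e \<noteq> 0" and "b < a"
  shows "t_binom (qp e) (Suc a) (Suc b)
    = t_binom (qp e) a b + qp e ^ Suc b * t_binom (qp e) a (Suc b)"
proof -
  obtain c where c: "a = Suc (b + c)" using \<open>b < a\<close> less_iff_Suc_add by auto
  have nz: "t_fact (qp e) k \<noteq> 0" "t_int (qp e) (Suc k) \<noteq> 0" for k
    using e by (simp_all add: t_fact_nonzero t_int_nonzero)
  have "t_int (qp e) (Suc a) = t_int (qp e) (Suc b) + qp e ^ Suc b * t_int (qp e) (Suc c)"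
    using t_int_add[of "qp e" "Suc b" "Suc c"] c by simp
  moreover have "a - b = Suc c" "a - Suc b = c" "Suc a - Suc b = Suc c" using c by simp_all
  ultimately show ?thesis
    unfolding t_binom_def using nz
    by (simp add: t_fact_Suc[of _ a] t_fact_Suc[of _ b] t_fact_Suc[of _ c] field_simps)
qed

lemma t_binom_laurent:
  assumes e: "e \<noteq> 0"
  shows "b \<le> a \<Longrightarrow> t_binom (qp e) a b \<in> laurent_polys"
proof (induction a arbitrary: b)
  case 0
  then show ?case by (simp add: t_binom_def laurent_1)
next
  case (Suc a)
  have one: "t_binom (qp e) k 0 = 1" "t_binom (qp e) k k = 1" for k
    using e by (simp_all add: t_binom_def t_fact_nonzero)
  show ?case
  proof (cases "b = 0 \<or> b = Suc a")
    case True
    then show ?thesis using one laurent_1 by metis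
  next
    case False
    then obtain d where "b = Suc d" "d < a" using Suc.prems by (cases b) auto
    then show ?thesis
      using t_binom_Pascal[OF e] Suc.IH qp_laurent by (simp add: laurent_add laurent_mult qp_power
        flip: power_Suc)
  qed
qed

lemma t_falling_laurent: "t_falling (qp e) a b \<in> laurent_polys"
  unfolding t_falling_def qp_powi by (intro laurent_prod laurent_diff laurent_1 qp_laurent)

lemma t_pow_laurent: "t_pow x \<in> laurent_polys"
  by (simp add: t_pow_def qp_laurent)

section \<open>Commutation with E and the partial trace\<close>

definition colorings :: "nat \<Rightarrow> nat \<Rightarrow> (nat \<Rightarrow> int) set" where
  "colorings S n = {1..S} \<rightarrow>\<^sub>E {0..int n}"

lemma finite_colorings [simp]: "finite (colorings S n)"
  by (simp add: colorings_def finite_PiE)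

lemma colorings_range: "c \<in> colorings S n \<Longrightarrow> l \<in> {1..S} \<Longrightarrow> 0 \<le> c l \<and> c l \<le> int n"
  by (auto simp: colorings_def PiE_iff)

lemma colorings_upd:
  "c \<in> colorings S n \<Longrightarrow> l \<in> {1..S} \<Longrightarrow> 0 \<le> a \<Longrightarrow> a \<le> int n \<Longrightarrow> c(l := a) \<in> colorings S n"
  by (auto simp: colorings_def PiE_iff extensional_def)

text \<open>
  \<open>E\<close> lowers a color \<open>a\<close> to \<open>a - 1\<close> with coefficient \<open>{n - a + 1}\<close>.  On a product of strings
  it is the sum over \<open>l\<close> of its action on string \<open>l\<close>, weighted by \<open>v\<^sup>n\<^sup>-\<^sup>2\<^sup>c\<close> for the color \<open>c\<close> of
  each string to the left of \<open>l\<close>.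
\<close>

definition prefix_weight :: "nat \<Rightarrow> (nat \<Rightarrow> int) \<Rightarrow> nat \<Rightarrow> ratfun" where
  "prefix_weight n c l = qp (2 * (\<Sum>m\<in>{1..<l}. int n - 2 * c m))"

text \<open>The \<open>R\<close>-matrix on the tensor factors \<open>k\<close> and
  \<open>k + 1\<close>, tensored with identities, from the coloring \<open>c\<close> below to
  \<open>c'\<close> above.\<close>

definition kernel :: "nat \<Rightarrow> nat \<Rightarrow> nat \<Rightarrow> int \<Rightarrow> (nat \<Rightarrow> int) \<Rightarrow> (nat \<Rightarrow> int) \<Rightarrow> ratfun" where
  "kernel n S k \<epsilon> c c' =
     (if \<forall>p\<in>{1..S} - {k, k + 1}. c' p = c p
      then R_entry n \<epsilon> (c k) (c (k + 1)) (c' k) (c' (k + 1)) else 0)"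

text \<open>A crossing cannot repair the color -1: on an uninvolved string it persists, while
  \<open>c'\<close> is nonnegative, and on the strings \<open>k\<close> and \<open>k + 1\<close> the
  matrix entry is 0. So lowering a color 0 below a crossing contributes nothing.\<close>

lemma kernel_lower_0:
  assumes "c \<in> colorings S n" "c' \<in> colorings S n" "1 \<le> k" "k < S" "l \<in> {1..S}" "c l = 0"
  shows "kernel n S k \<epsilon> (c(l := c l - 1)) c' = 0"
proof -
  have nonneg: "0 \<le> c' p" if "p \<in> {1..S}" for p
    using colorings_range[OF assms(2) that] by simp
  consider "l = k" | "l = k + 1" | "l \<noteq> k" "l \<noteq> k + 1" by blast
  then show ?thesis
  proof cases
    case 1
    then show ?thesis using assms nonneg[of "k + 1"]
      by (simp add: kernel_def R_entry_eq_0_left)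
  next
    case 2
    then show ?thesis using assms nonneg[of k]
      by (simp add: kernel_def R_entry_eq_0_right)
  next
    case 3
    then have "l \<in> {1..S} - {k, k + 1}" "c' l \<noteq> (c(l := c l - 1)) l"
      using assms(5,6) nonneg[of l] by auto
    then show ?thesis unfolding kernel_def by (metis (no_types, lifting))
  qed
qed

lemma kernel_nonzeroD:
  assumes "kernel n S k \<epsilon> c c' \<noteq> 0"
  shows "\<And>p. p \<in> {1..S} \<Longrightarrow> p \<noteq> k \<Longrightarrow> p \<noteq> k + 1 \<Longrightarrow> c' p = c p"
    and "c k + c (k + 1) = c' k + c' (k + 1)"
  using assms by (auto simp: kernel_def R_entry_def split: if_splits)

text \<open>A crossing preserves the total color of \<open>k\<close> and \<open>k + 1\<close>, so a
  prefix with both strings or neither keeps its weight; \<open>l = k + 1\<close> is the one prefix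
  that separates them.\<close>

lemma prefix_sum_cong:
  fixes c c' :: "nat \<Rightarrow> int"
  assumes "\<And>p. p \<in> {1..<l} \<Longrightarrow> p \<noteq> k \<Longrightarrow> p \<noteq> k + 1 \<Longrightarrow> c' p = c p"
    and "l \<noteq> k + 1" "1 \<le> k" "c k + c (k + 1) = c' k + c' (k + 1)"
  shows "prefix_weight n c l = prefix_weight n c' l"
proof -
  have "(\<Sum>m\<in>{1..<l}. int n - 2 * c m) = (\<Sum>m\<in>{1..<l}. int n - 2 * c' m)"
  proof (cases "l \<le> k")
    case True
    then show ?thesis using assms(1) by (intro sum.cong) auto
  next
    case False
    then have "{1..<l} = insert k (insert (k + 1) ({1..<l} - {k, k + 1}))"
      using assms(2,3) by auto
    moreover have "(\<Sum>m\<in>{1..<l} - {k, k + 1}. int n - 2 * c m)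
        = (\<Sum>m\<in>{1..<l} - {k, k + 1}. int n - 2 * c' m)"
      using assms(1) by (intro sum.cong) auto
    moreover have "(\<Sum>m\<in>insert k (insert (k + 1) X). f m) = f k + (f (k + 1) + sum f X)"
      if "finite X" "k \<notin> X" "k + 1 \<notin> X" for X and f :: "nat \<Rightarrow> int"
      using that by simp
    ultimately show ?thesis using assms(4)
      by (smt (verit) Diff_iff finite_Diff finite_atLeastLessThan insertI1 insertI2)
  qed
  then show ?thesis by (simp add: prefix_weight_def)
qed

text \<open>Away from the crossing the summands agree one by one. Those for \<open>k\<close> and
  \<open>k + 1\<close> agree only jointly, by the relation for two strings multiplied by their
  common prefix weight.\<close>

lemma kernel_intertwines:
  assumes "1 \<le> k" "k < S"
  shows "(\<Sum>l\<in>{1..S}. v_bracket (int n - c' l) * prefix_weight n c' l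
            * kernel n S k \<epsilon> c (c'(l := c' l + 1)))
       = (\<Sum>l\<in>{1..S}. v_bracket (int n - c l + 1) * prefix_weight n c l
            * kernel n S k \<epsilon> (c(l := c l - 1)) c')"
    (is "sum ?L _ = sum ?R _")
proof -
  let ?A = "{1..S} - {k, k + 1}"
  have split: "sum f {1..S} = sum f ?A + (f k + f (k + 1))" for f :: "nat \<Rightarrow> ratfun"
  proof -
    have "{1..S} = insert k (insert (k + 1) ?A)" using assms by auto
    then have "sum f {1..S} = sum f (insert k (insert (k + 1) ?A))" by simp
    then show ?thesis by (simp add: algebra_simps)
  qed
  have "?L l = ?R l" if l: "l \<in> ?A" for l
  proof -
    have *: "kernel n S k \<epsilon> c (c'(l := c' l + 1)) = kernel n S k \<epsilon> (c(l := c l - 1)) c'"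
    proof -
      have "(\<forall>p\<in>?A. (c'(l := c' l + 1)) p = c p) \<longleftrightarrow> (\<forall>p\<in>?A. c' p = (c(l := c l - 1)) p)"
        by (intro ball_cong) auto
      then show ?thesis using l by (simp add: kernel_def)
    qed
    show ?thesis
    proof (cases "kernel n S k \<epsilon> c (c'(l := c' l + 1)) = 0")
      case True
      then show ?thesis using * by simp
    next
      case False
      note D = kernel_nonzeroD[OF False]
      have "int n - c' l = int n - c l + 1" using D(1)[of l] l by auto
      moreover have "prefix_weight n c l = prefix_weight n c' l"
      proof (rule prefix_sum_cong)
        show "c' p = c p" if "p \<in> {1..<l}" "p \<noteq> k" "p \<noteq> k + 1" for p
          using D(1)[of p] that l by auto
      qed (use assms l D(2) in auto)
      ultimately show ?thesis using * by (simp only:)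
    qed
  qed
  then have "sum ?L ?A = sum ?R ?A" by simp
  moreover have "?L k + ?L (k + 1) = ?R k + ?R (k + 1)"
  proof (cases "\<forall>p\<in>?A. c' p = c p")
    case True
    have pk: "prefix_weight n c' k = prefix_weight n c k"
      unfolding prefix_weight_def using True assms by (intro arg_cong[of _ _ qp] arg_cong[of _ _ "(*) 2"] sum.cong) auto
    have pk1: "prefix_weight n d (k + 1) = prefix_weight n d k * qp (2 * (int n - 2 * d k))" for d
      unfolding prefix_weight_def qp_mult using assms by (simp add: algebra_simps)
    let ?M = "R_entry n \<epsilon>"
    have "?L k + ?L (k + 1) = prefix_weight n c k *
      (v_bracket (int n - c' k) * ?M (c k) (c (k + 1)) (c' k + 1) (c' (k + 1))
     + qp (2 * (int n - 2 * c' k)) * v_bracket (int n - c' (k + 1)) * ?M (c k) (c (k + 1)) (c' k) (c' (k + 1) + 1))"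
      using True by (simp add: kernel_def pk pk1[of c', simplified] algebra_simps)
    also have "\<dots> = prefix_weight n c k * (v_bracket (int n - c k + 1) * ?M (c k - 1) (c (k + 1)) (c' k) (c' (k + 1))
     + qp (2 * (int n - 2 * c k)) * v_bracket (int n - c (k + 1) + 1) * ?M (c k) (c (k + 1) - 1) (c' k) (c' (k + 1)))"
      unfolding R_entry_intertwines ..
    also have "\<dots> = ?R k + ?R (k + 1)"
      using True by (simp add: kernel_def pk1[of c, simplified] algebra_simps)
    finally show ?thesis .
  next
    case False
    then have "kernel n S k \<epsilon> c (c'(l := c' l + 1)) = 0" "kernel n S k \<epsilon> (c(l := c l - 1)) c' = 0"
      if "l = k \<or> l = k + 1" for l
      unfolding kernel_def using that by auto
    then show ?thesis by simp
  qed
  ultimately show ?thesis unfolding split by simp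
qed

text \<open>\<open>P\<close> is a condition insensitive to string \<open>l\<close>: trivial for the
  braid operator, and a fixed first color for the trace.\<close>

lemma sum_shift:
  assumes "l \<in> {1..S}" and "\<And>z t. P (z(l := t)) \<longleftrightarrow> P z"
  shows "(\<Sum>z | z \<in> colorings S n \<and> P z \<and> z l \<ge> 1. G z)
    = (\<Sum>y | y \<in> colorings S n \<and> P y \<and> y l < int n. G (y(l := y l + 1)))"
  by (rule sum.reindex_bij_witness[of _ "\<lambda>y. y(l := y l + 1)" "\<lambda>z. z(l := z l - 1)"])
    (use assms colorings_range in \<open>fastforce intro!: colorings_upd\<close>)+

section \<open>The braid operator and its commutation with E\<close>

primrec transfer ::
  "nat \<Rightarrow> nat \<Rightarrow> (nat \<Rightarrow> nat) \<Rightarrow> (nat \<Rightarrow> int) \<Rightarrow> nat \<Rightarrow> (nat \<Rightarrow> int) \<Rightarrow> (nat \<Rightarrow> int) \<Rightarrow> ratfun" where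
  "transfer n S k \<epsilon> 0 c c' = of_bool (c = c')"
| "transfer n S k \<epsilon> (Suc h) c c' =
     (\<Sum>z\<in>colorings S n. transfer n S k \<epsilon> h c z * kernel n S (k h) (\<epsilon> h) z c')"

text \<open>Here the intermediate colors are truncated. The lower end of the range shows up as the
  condition \<open>c l \<ge> 1\<close>; the upper one is hidden in
  \<open>v_bracket (int n - c' l)\<close>, which is 0 for \<open>c' l = n\<close>.\<close>

lemma transfer_intertwines:
  assumes "\<And>v. v < h \<Longrightarrow> 1 \<le> k v \<and> k v < S"
    and "c \<in> colorings S n" "c' \<in> colorings S n"
  shows "(\<Sum>l\<in>{1..S}. v_bracket (int n - c' l) * prefix_weight n c' l
            * transfer n S k \<epsilon> h c (c'(l := c' l + 1)))
       = (\<Sum>l\<in>{1..S}. if c l \<ge> 1 then v_bracket (int n - c l + 1) * prefix_weight n c l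
            * transfer n S k \<epsilon> h (c(l := c l - 1)) c' else 0)"
  using assms
proof (induction h arbitrary: c')
  case 0
  have "v_bracket (int n - c' l) * prefix_weight n c' l * of_bool (c = c'(l := c' l + 1))
      = (if c l \<ge> 1 then v_bracket (int n - c l + 1) * prefix_weight n c l
            * of_bool (c(l := c l - 1) = c') else 0)" if l: "l \<in> {1..S}" for l
  proof (cases "c = c'(l := c' l + 1)")
    case True
    have "c' l \<ge> 0" using colorings_range[OF 0(3) l] by simp
    moreover have "prefix_weight n c l = prefix_weight n c' l"
      using True by (simp add: prefix_weight_def)
    ultimately show ?thesis using True by (simp add: algebra_simps)
  next
    case False
    then have "c(l := c l - 1) \<noteq> c'" by auto
    with False show ?thesis by simp
  qed
  then show ?case unfolding transfer.simps by (rule sum.cong[OF refl])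
next
  case (Suc h)
  let ?C = "colorings S n"
  let ?T = "transfer n S k \<epsilon> h" and ?M = "kernel n S (k h) (\<epsilon> h)"
  have k: "1 \<le> k h" "k h < S" using Suc.prems(1)[of h] by auto
  have IH: "(\<Sum>l\<in>{1..S}. v_bracket (int n - y l) * prefix_weight n y l * ?T c (y(l := y l + 1)))
       = (\<Sum>l\<in>{1..S}. if c l \<ge> 1 then v_bracket (int n - c l + 1) * prefix_weight n c l
            * ?T (c(l := c l - 1)) y else 0)" if "y \<in> ?C" for y
    using Suc.IH[OF _ Suc.prems(2) that] Suc.prems(1) less_SucI by blast
  \<comment> \<open>This moves \<open>E\<close> from the crossing to the operator below it by the
    substitution \<open>z = y(l := y l + 1)\<close>. Terms with \<open>z l = 0\<close> vanish by
    \<open>kernel_lower_0\<close> and those with \<open>y l = n\<close> by the bracket, so both sums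
    extend to all colorings.\<close>
  have shift: "(\<Sum>z\<in>?C. ?T c z * (v_bracket (int n - z l + 1) * prefix_weight n z l * ?M (z(l := z l - 1)) c'))
    = (\<Sum>y\<in>?C. v_bracket (int n - y l) * prefix_weight n y l * ?T c (y(l := y l + 1)) * ?M y c')"
    if l: "l \<in> {1..S}" for l
  proof -
    let ?G = "\<lambda>z. ?T c z * (v_bracket (int n - z l + 1) * prefix_weight n z l * ?M (z(l := z l - 1)) c')"
    have "sum ?G ?C = sum ?G {z. z \<in> ?C \<and> True \<and> z l \<ge> 1}"
    proof (rule sum.mono_neutral_right)
      show "\<forall>z\<in>?C - {z. z \<in> ?C \<and> True \<and> z l \<ge> 1}. ?G z = 0"
      proof
        fix z assume z: "z \<in> ?C - {z. z \<in> ?C \<and> True \<and> z l \<ge> 1}"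
        then have "z l = 0" using colorings_range[of z S n l] l by force
        then show "?G z = 0" using kernel_lower_0[of z S n c' "k h" l] z Suc.prems k l by simp
      qed
    qed auto
    also have "\<dots> = (\<Sum>y | y \<in> ?C \<and> True \<and> y l < int n. ?G (y(l := y l + 1)))"
      by (rule sum_shift[OF l]) simp
    also have "\<dots> = (\<Sum>y | y \<in> ?C \<and> True \<and> y l < int n.
        v_bracket (int n - y l) * prefix_weight n y l * ?T c (y(l := y l + 1)) * ?M y c')"
      by (intro sum.cong) (auto simp: prefix_weight_def)
    also have "\<dots> = (\<Sum>y\<in>?C. v_bracket (int n - y l) * prefix_weight n y l * ?T c (y(l := y l + 1)) * ?M y c')"
    proof (rule sum.mono_neutral_left)
      show "\<forall>y\<in>?C - {y. y \<in> ?C \<and> True \<and> y l < int n}.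
          v_bracket (int n - y l) * prefix_weight n y l * ?T c (y(l := y l + 1)) * ?M y c' = 0"
      proof
        fix y assume y: "y \<in> ?C - {y. y \<in> ?C \<and> True \<and> y l < int n}"
        then have "y l = int n" using colorings_range[of y S n l] l by force
        then show "v_bracket (int n - y l) * prefix_weight n y l * ?T c (y(l := y l + 1)) * ?M y c' = 0"
          by simp
      qed
    qed auto
    finally show ?thesis .
  qed
  have "(\<Sum>l\<in>{1..S}. v_bracket (int n - c' l) * prefix_weight n c' l
            * transfer n S k \<epsilon> (Suc h) c (c'(l := c' l + 1)))
    = (\<Sum>z\<in>?C. ?T c z * (\<Sum>l\<in>{1..S}. v_bracket (int n - c' l) * prefix_weight n c' l
            * ?M z (c'(l := c' l + 1))))"
    unfolding transfer.simps sum_distrib_left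
    by (subst sum.swap) (simp add: ac_simps)
  also have "\<dots> = (\<Sum>z\<in>?C. ?T c z * (\<Sum>l\<in>{1..S}. v_bracket (int n - z l + 1) * prefix_weight n z l
            * ?M (z(l := z l - 1)) c'))"
    unfolding kernel_intertwines[OF k] ..
  also have "\<dots> = (\<Sum>l\<in>{1..S}. \<Sum>z\<in>?C. ?T c z * (v_bracket (int n - z l + 1) * prefix_weight n z l
            * ?M (z(l := z l - 1)) c'))"
    unfolding sum_distrib_left by (rule sum.swap)
  also have "\<dots> = (\<Sum>l\<in>{1..S}. \<Sum>y\<in>?C. v_bracket (int n - y l) * prefix_weight n y l
            * ?T c (y(l := y l + 1)) * ?M y c')"
    by (intro sum.cong refl shift)
  also have "\<dots> = (\<Sum>y\<in>?C. (\<Sum>l\<in>{1..S}. v_bracket (int n - y l) * prefix_weight n y l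
            * ?T c (y(l := y l + 1))) * ?M y c')"
    unfolding sum_distrib_right by (rule sum.swap)
  also have "\<dots> = (\<Sum>y\<in>?C. (\<Sum>l\<in>{1..S}. if c l \<ge> 1 then v_bracket (int n - c l + 1)
            * prefix_weight n c l * ?T (c(l := c l - 1)) y else 0) * ?M y c')"
    by (intro sum.cong refl) (simp only: IH)
  also have "\<dots> = (\<Sum>l\<in>{1..S}. \<Sum>y\<in>?C. (if c l \<ge> 1 then v_bracket (int n - c l + 1)
            * prefix_weight n c l * ?T (c(l := c l - 1)) y else 0) * ?M y c')"
    unfolding sum_distrib_right by (rule sum.swap)
  also have "\<dots> = (\<Sum>l\<in>{1..S}. if c l \<ge> 1 then v_bracket (int n - c l + 1) * prefix_weight n c l
            * transfer n S k \<epsilon> (Suc h) (c(l := c l - 1)) c' else 0)"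
    by (intro sum.cong refl) (simp add: sum_distrib_left mult.assoc)
  finally show ?case .
qed

section \<open>The quantum trace over all strings but the first\<close>

definition closure_weight :: "nat \<Rightarrow> nat \<Rightarrow> (nat \<Rightarrow> int) \<Rightarrow> ratfun" where
  "closure_weight n S c = qp (2 * (\<Sum>l\<in>{2..S}. 2 * c l - int n))"

definition partial_trace ::
  "nat \<Rightarrow> nat \<Rightarrow> (nat \<Rightarrow> nat) \<Rightarrow> (nat \<Rightarrow> int) \<Rightarrow> nat \<Rightarrow> int \<Rightarrow> ratfun" where
  "partial_trace n S k \<epsilon> h a =
     (\<Sum>c | c \<in> colorings S n \<and> c 1 = a. closure_weight n S c * transfer n S k \<epsilon> h c c)"

text \<open>Take the commutation relation between the bottom coloring \<open>y(1 := a + 1)\<close>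
  and the top coloring \<open>y\<close> with \<open>y 1 = a\<close>, weight it by the closure and
  sum over \<open>y\<close>. Lowering string 1 at the bottom yields the diagonal entries at
  \<open>a\<close>, raising it at the top those at \<open>a + 1\<close>, both with the factor
  \<open>{n - a}\<close>; all other strings cancel.\<close>

lemma partial_trace_step:
  assumes k: "\<And>v. v < h \<Longrightarrow> 1 \<le> k v \<and> k v < S" and S: "1 \<le> S" and a: "0 \<le> a" "a < int n"
  shows "partial_trace n S k \<epsilon> h (a + 1) = partial_trace n S k \<epsilon> h a"
proof -
  let ?T = "transfer n S k \<epsilon> h" and ?\<mu> = "closure_weight n S"
  define Y where "Y = {y \<in> colorings S n. y 1 = a}"
  have Y: "finite Y" by (simp add: Y_def)
  define L where "L y l = v_bracket (int n - y l) * prefix_weight n y l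
      * ?T (y(1 := a + 1)) (y(l := y l + 1))" for y l
  define R where "R y l = (if (y(1 := a + 1)) l \<ge> 1
      then v_bracket (int n - (y(1 := a + 1)) l + 1) * prefix_weight n (y(1 := a + 1)) l
            * ?T (y(1 := a + 1, l := (y(1 := a + 1)) l - 1)) y else 0)" for y l
  have LR: "(\<Sum>l\<in>{1..S}. L y l) = (\<Sum>l\<in>{1..S}. R y l)" if "y \<in> Y" for y
    unfolding L_def R_def
    by (rule transfer_intertwines[OF k]) (use that a S in \<open>auto simp: Y_def intro!: colorings_upd\<close>)
  have one: "{1..S} = insert 1 {2..S}" using S by auto
  \<comment> \<open>Shifting the color of string \<open>l\<close> turns the matrix entries of one
    side into those of the other. The closure weight then gains \<open>qp 4\<close>, and the prefix
    weight, whose first color is \<open>a + 1\<close> instead of \<open>a\<close>, supplies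
    \<open>qp (- 4)\<close>.\<close>
  have "(\<Sum>y\<in>Y. ?\<mu> y * L y l) = (\<Sum>y\<in>Y. ?\<mu> y * R y l)" if l: "l \<in> {2..S}" for l
  proof -
    let ?P = "\<lambda>y::nat \<Rightarrow> int. y 1 = a"
    let ?G = "\<lambda>y. ?\<mu> y * (v_bracket (int n - y l + 1) * prefix_weight n (y(1 := a + 1)) l
            * ?T (y(1 := a + 1, l := y l - 1)) y)"
    have l': "l \<in> {1..S}" "l \<noteq> 1" using l by auto
    have "(\<Sum>y\<in>Y. ?\<mu> y * R y l) = (\<Sum>y\<in>Y. if y l \<ge> 1 then ?G y else 0)"
      using l' by (intro sum.cong refl) (simp add: R_def)
    also have "\<dots> = sum ?G {y. y \<in> colorings S n \<and> ?P y \<and> y l \<ge> 1}"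
      unfolding sum.inter_filter[OF Y, symmetric] by (rule sum.cong) (auto simp: Y_def)
    also have "\<dots> = (\<Sum>y | y \<in> colorings S n \<and> ?P y \<and> y l < int n. ?G (y(l := y l + 1)))"
      by (rule sum_shift[OF l'(1)]) (use l' in simp)
    also have "\<dots> = (\<Sum>y | y \<in> colorings S n \<and> ?P y \<and> y l < int n. ?\<mu> y * L y l)"
    proof (intro sum.cong refl)
      fix y assume "y \<in> {y \<in> colorings S n. ?P y \<and> y l < int n}"
      then have y: "y 1 = a" by simp
      have "(\<Sum>m\<in>{2..S}. 2 * (y(l := y l + 1)) m - int n)
          = (\<Sum>m\<in>{2..S}. (2 * y m - int n) + (if m = l then 2 else 0))"
        by (intro sum.cong) auto
      also have "\<dots> = (\<Sum>m\<in>{2..S}. 2 * y m - int n) + 2"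
        unfolding sum.distrib using l by simp
      finally have 1: "?\<mu> (y(l := y l + 1)) = qp 4 * ?\<mu> y"
        unfolding closure_weight_def qp_mult by (simp only: distrib_left) (simp add: add.commute)
      have "(\<Sum>m\<in>{1..<l}. int n - 2 * (y(l := y l + 1, 1 := a + 1)) m)
          = (\<Sum>m\<in>{1..<l}. (int n - 2 * y m) - (if m = 1 then 2 else 0))"
        using y by (intro sum.cong) auto
      also have "\<dots> = (\<Sum>m\<in>{1..<l}. int n - 2 * y m) - 2"
        unfolding sum_subtractf using l by simp
      finally have 2: "prefix_weight n (y(l := y l + 1, 1 := a + 1)) l = qp (- 4) * prefix_weight n y l"
        unfolding prefix_weight_def qp_mult by (simp only: right_diff_distrib) (simp add: add.commute)
      have 3: "y(l := y l + 1, 1 := a + 1, l := (y(l := y l + 1)) l - 1) = y(1 := a + 1)"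
        using l' by auto
      have 4: "q_var ^ 4 * qp (- 4) = 1" using qp_mult[of 4 "- 4"] by simp
      show "?G (y(l := y l + 1)) = ?\<mu> y * L y l"
        unfolding 1 2 3 L_def by (simp add: ac_simps 4)
    qed
    also have "\<dots> = (\<Sum>y\<in>Y. ?\<mu> y * L y l)"
    proof (rule sum.mono_neutral_left[OF Y])
      show "\<forall>y\<in>Y - {y \<in> colorings S n. ?P y \<and> y l < int n}. ?\<mu> y * L y l = 0"
      proof
        fix y assume y: "y \<in> Y - {y \<in> colorings S n. ?P y \<and> y l < int n}"
        then have "y l = int n" using colorings_range[of y S n l] l' by (force simp: Y_def)
        then show "?\<mu> y * L y l = 0" by (simp add: L_def)
      qed
    qed (auto simp: Y_def)
    finally show ?thesis ..
  qed
  then have rest: "(\<Sum>l\<in>{2..S}. \<Sum>y\<in>Y. ?\<mu> y * L y l) = (\<Sum>l\<in>{2..S}. \<Sum>y\<in>Y. ?\<mu> y * R y l)"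
    by (rule sum.cong[OF refl])
  have "(\<Sum>y\<in>Y. ?\<mu> y * (\<Sum>l\<in>{1..S}. L y l)) = (\<Sum>y\<in>Y. ?\<mu> y * (\<Sum>l\<in>{1..S}. R y l))"
    by (intro sum.cong refl) (simp only: LR)
  then have "(\<Sum>y\<in>Y. ?\<mu> y * L y 1) + (\<Sum>l\<in>{2..S}. \<Sum>y\<in>Y. ?\<mu> y * L y l)
      = (\<Sum>y\<in>Y. ?\<mu> y * R y 1) + (\<Sum>l\<in>{2..S}. \<Sum>y\<in>Y. ?\<mu> y * R y l)"
    unfolding one
    by (simp add: distrib_left sum.distrib sum_distrib_left sum.swap[of _ "{2..S}" Y])
  then have "(\<Sum>y\<in>Y. ?\<mu> y * L y 1) = (\<Sum>y\<in>Y. ?\<mu> y * R y 1)"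
    unfolding rest by simp
  moreover have "(\<Sum>y\<in>Y. ?\<mu> y * R y 1) = v_bracket (int n - a) * partial_trace n S k \<epsilon> h a"
    unfolding partial_trace_def sum_distrib_left using a
    by (intro sum.cong) (auto simp: Y_def R_def prefix_weight_def)
  moreover have "(\<Sum>y\<in>Y. ?\<mu> y * L y 1) = v_bracket (int n - a) * partial_trace n S k \<epsilon> h (a + 1)"
  proof -
    have "(\<Sum>y\<in>Y. ?\<mu> y * L y 1) = (\<Sum>y\<in>Y. v_bracket (int n - a) *
        (?\<mu> (y(1 := a + 1)) * ?T (y(1 := a + 1)) (y(1 := a + 1))))"
      by (intro sum.cong) (auto simp: Y_def L_def prefix_weight_def closure_weight_def)
    also have "\<dots> = (\<Sum>c | c \<in> colorings S n \<and> c 1 = a + 1. v_bracket (int n - a) * (?\<mu> c * ?T c c))"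
      by (rule sum.reindex_bij_witness[of _ "\<lambda>c. c(1 := a)" "\<lambda>y. y(1 := a + 1)"])
        (use S a in \<open>auto simp: Y_def intro!: colorings_upd\<close>)
    finally show ?thesis by (simp add: partial_trace_def sum_distrib_left)
  qed
  \<comment> \<open>The bracket of \<open>n - a\<close> is cancelled, which is possible because
    \<open>a < n\<close>.\<close>
  ultimately show ?thesis using a by auto
qed

lemma partial_trace_const:
  assumes "\<And>v. v < h \<Longrightarrow> 1 \<le> k v \<and> k v < S" and "1 \<le> S" and "a \<le> n"
  shows "partial_trace n S k \<epsilon> h (int a) = partial_trace n S k \<epsilon> h 0"
  using assms(3)
proof (induction a)
  case (Suc a)
  then show ?case
    using partial_trace_step[of h k S "int a" n \<epsilon>] assms(1,2) by (simp add: add.commute)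
qed simp

section \<open>Matrix products as sums over paths of colorings\<close>

text \<open>Paths are extensional on \<open>{..h}\<close>, so that forgetting the top level is
  inverse to appending one.\<close>

lemma transfer_paths:
  "c \<in> colorings S n \<Longrightarrow> c' \<in> colorings S n \<Longrightarrow> transfer n S k \<epsilon> h c c' =
    (\<Sum>F | F \<in> {..h} \<rightarrow>\<^sub>E colorings S n \<and> F 0 = c \<and> F h = c'.
       \<Prod>v<h. kernel n S (k v) (\<epsilon> v) (F v) (F (Suc v)))"
proof (induction h arbitrary: c')
  case 0
  have "{F. F \<in> {..0} \<rightarrow>\<^sub>E colorings S n \<and> F 0 = c \<and> F 0 = c'}
      = (if c = c' then {\<lambda>x\<in>{..0::nat}. c} else {})"
    using 0 by (auto simp: PiE_iff extensional_def fun_eq_iff)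
  then show ?case by simp
next
  case (Suc h)
  let ?C = "colorings S n"
  let ?K = "\<lambda>F v. kernel n S (k v) (\<epsilon> v) (F v) (F (Suc v))"
  let ?X = "\<lambda>h z. {F. F \<in> {..h} \<rightarrow>\<^sub>E ?C \<and> F 0 = c \<and> F h = z}"
  let ?Y = "{F. F \<in> {..Suc h} \<rightarrow>\<^sub>E ?C \<and> F 0 = c \<and> F (Suc h) = c'}"
  have "transfer n S k \<epsilon> (Suc h) c c' = (\<Sum>z\<in>?C. \<Sum>F\<in>?X h z.
      (\<Prod>v<h. ?K F v) * kernel n S (k h) (\<epsilon> h) (F h) c')"
    unfolding transfer.simps
    by (intro sum.cong refl) (simp add: Suc.IH[OF Suc.prems(1)] sum_distrib_right)
  also have "\<dots> = (\<Sum>F\<in>(\<Union>z\<in>?C. ?X h z). (\<Prod>v<h. ?K F v) * kernel n S (k h) (\<epsilon> h) (F h) c')"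
    by (rule sum.UNION_disjoint[symmetric])
      (auto intro!: finite_subset[of _ "{..h} \<rightarrow>\<^sub>E ?C"] finite_PiE)
  also have "\<dots> = (\<Sum>F\<in>?Y. \<Prod>v<Suc h. ?K F v)"
  proof (rule sum.reindex_bij_witness[of _ "\<lambda>F. F(Suc h := undefined)" "\<lambda>F. F(Suc h := c')"])
    fix F assume F: "F \<in> (\<Union>z\<in>?C. ?X h z)"
    then show "F(Suc h := c', Suc h := undefined) = F" 
      by (auto simp: PiE_iff extensional_def fun_eq_iff)
    show "F(Suc h := c') \<in> ?Y"
      using F Suc.prems by (auto simp: PiE_iff extensional_def)
    show "(\<Prod>v<Suc h. ?K (F(Suc h := c')) v) = (\<Prod>v<h. ?K F v) * kernel n S (k h) (\<epsilon> h) (F h) c'"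
      by simp
  next
    fix F assume F: "F \<in> ?Y"
    then show "F(Suc h := undefined, Suc h := c') = F" by auto
    show "F(Suc h := undefined) \<in> (\<Union>z\<in>?C. ?X h z)"
      using F by (auto simp: PiE_iff extensional_def)
  qed
  finally show ?case .
qed

lemma partial_trace_paths:
  "partial_trace n S k \<epsilon> h a =
    (\<Sum>F | F \<in> {..h} \<rightarrow>\<^sub>E colorings S n \<and> F 0 = F h \<and> F h 1 = a.
       closure_weight n S (F h) * (\<Prod>v<h. kernel n S (k v) (\<epsilon> v) (F v) (F (Suc v))))"
proof -
  let ?C = "{c. c \<in> colorings S n \<and> c 1 = a}"
  let ?X = "\<lambda>c. {F. F \<in> {..h} \<rightarrow>\<^sub>E colorings S n \<and> F 0 = c \<and> F h = c}"
  let ?W = "\<lambda>F. closure_weight n S (F h) * (\<Prod>v<h. kernel n S (k v) (\<epsilon> v) (F v) (F (Suc v)))"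
  have "partial_trace n S k \<epsilon> h a = (\<Sum>c\<in>?C. sum ?W (?X c))"
    unfolding partial_trace_def
    by (intro sum.cong refl) (simp add: transfer_paths sum_distrib_left)
  also have "\<dots> = sum ?W (\<Union>c\<in>?C. ?X c)"
    by (rule sum.UNION_disjoint[symmetric])
      (auto intro!: finite_subset[of _ "{..h} \<rightarrow>\<^sub>E colorings S n"] finite_PiE)
  also have "(\<Union>c\<in>?C. ?X c) = {F. F \<in> {..h} \<rightarrow>\<^sub>E colorings S n \<and> F 0 = F h \<and> F h 1 = a}"
    by (auto simp: PiE_iff)
  finally show ?thesis .
qed

section \<open>Closed braids and levels\<close>

lemma bij_betw_restrict:
  assumes "bij_betw f A B" "\<And>x. x \<in> A \<Longrightarrow> P x \<longleftrightarrow> Q (f x)"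
  shows "bij_betw f {x \<in> A. P x} {y \<in> B. Q y}"
proof -
  have "f ` {x \<in> A. P x} = {y \<in> f ` A. Q y}" using assms(2) by auto
  moreover have "inj_on f {x \<in> A. P x}"
    using assms(1) by (auto simp: bij_betw_def inj_on_def)
  ultimately show ?thesis using assms(1) by (simp add: bij_betw_def)
qed

text \<open>Both products complete to the product over all levels, one by the factor
  \<open>f 0\<close> and the other by \<open>f h\<close>; only this factor has to be
  cancelled.\<close>

lemma prod_Suc_cyclic:
  fixes f :: "nat \<Rightarrow> 'a::idom"
  assumes "f 0 = f h" "f 0 \<noteq> 0"
  shows "(\<Prod>v<h. f (Suc v)) = (\<Prod>v<h. f v)"
proof -
  have "f 0 * (\<Prod>v<h. f (Suc v)) = f 0 * (\<Prod>v<h. f v)"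
    unfolding prod.lessThan_Suc_shift[symmetric] using assms(1) by simp
  then show ?thesis using assms(2) by simp
qed

text \<open>Four times the exponent is an integer, so the floor in \<open>t_pow\<close> loses
  nothing.\<close>

lemma t_pow_delta':
  "t_pow (delta' K n + of_int (- x))
    = qp (- ((int n)\<^sup>2 * writhe K) + 2 * int n * (int (strings K) - 1) - 4 * x)"
proof -
  have "4 * (- a\<^sup>2 / 4 * w + a / 2 * (m - 1) + - y) = - (a\<^sup>2 * w) + 2 * a * (m - 1) - 4 * y"
    for a w m y :: rat by (simp add: field_simps)
  from this[of "of_nat n" "of_int (writhe K)" "of_nat (strings K)" "of_int x"]
  have "4 * (delta' K n + of_int (- x))
      = of_int (- ((int n)\<^sup>2 * writhe K) + 2 * int n * (int (strings K) - 1) - 4 * x)"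
    by (simp add: delta'_def)
  then show ?thesis unfolding t_pow_def by (simp only: floor_of_int)
qed

section \<open>Points, crossings and pieces of a closed braid\<close>

locale closed_braid =
  fixes K :: braid
  assumes braid: "is_braid K"
begin

abbreviation "S \<equiv> strings K"
abbreviation "H \<equiv> height K"
abbreviation "pos \<equiv> cr_pos K"
abbreviation "nxt \<equiv> next_point K"
abbreviation "nodes \<equiv> over_ins K \<union> under_ins K"

lemma strings_pos: "1 \<le> S"
  using braid by (simp add: is_braid_def)

lemma letter_range: "v < H \<Longrightarrow> braid_word K ! v \<noteq> 0 \<and> \<bar>braid_word K ! v\<bar> < int S"
  using braid nth_mem[of v "braid_word K"] unfolding is_braid_def height_def by blast

lemma pos_range: "v < H \<Longrightarrow> 1 \<le> pos v \<and> pos v < S"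
  using letter_range[of v] unfolding cr_pos_def by linarith

lemma sign_cases: "v < H \<Longrightarrow> cr_sign K v = 1 \<or> cr_sign K v = - 1"
  using letter_range[of v] by (auto simp: cr_sign_def sgn_if)

lemma crossings_iff [simp]: "v \<in> crossings K \<longleftrightarrow> v < H"
  by (simp add: crossings_def)

lemma finite_points [simp]: "finite (points K)"
  by (simp add: points_def)

lemma points_iff: "(v, p) \<in> points K \<longleftrightarrow> v \<le> H \<and> 1 \<le> p \<and> p \<le> S"
  by (auto simp: points_def)

lemma next_point_eq:
  "nxt (v, p) = (if v = H then (0, p) else
     (Suc v, if p = pos v then pos v + 1 else if p = pos v + 1 then pos v else p))"
  by (auto simp: next_point_def over_in_def over_out_def under_in_def under_out_def
      left_in_def left_out_def right_in_def right_out_def)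

lemma next_in_points: "x \<in> points K \<Longrightarrow> nxt x \<in> points K"
  using pos_range by (cases x) (auto simp: next_point_eq points_iff Suc_le_eq)

lemma next_inj: "inj_on nxt (points K)"
  by (rule inj_onI) (auto simp: next_point_eq split: if_splits)

text \<open>The successor map permutes the finite set of points, so the braid can also be followed
  backwards in exactly one way; finding the start of an overcrossing arc relies on this.\<close>

lemma next_surj: "nxt ` points K = points K"
  using next_in_points next_inj by (intro endo_inj_surj) auto

lemma next_over [simp]: "v < H \<Longrightarrow> nxt (over_in K v) = over_out K v"
  and next_under [simp]: "v < H \<Longrightarrow> nxt (under_in K v) = under_out K v"
  by (auto simp: next_point_eq over_in_def over_out_def under_in_def under_out_def
      left_in_def left_out_def right_in_def right_out_def)

lemma crossing_points:
  assumes "v < H"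
  shows "over_in K v \<in> points K" "under_in K v \<in> points K"
    "over_out K v \<in> points K" "under_out K v \<in> points K"
    "left_in K v \<in> points K" "right_in K v \<in> points K"
    "left_out K v \<in> points K" "right_out K v \<in> points K"
  using pos_range[OF assms] assms
  by (auto simp: over_in_def over_out_def under_in_def under_out_def
      left_in_def left_out_def right_in_def right_out_def points_iff)

lemma fst_crossing [simp]:
  "fst (over_in K v) = v" "fst (under_in K v) = v"
  "fst (over_out K v) = Suc v" "fst (under_out K v) = Suc v"
  by (auto simp: over_in_def over_out_def under_in_def under_out_def
      left_in_def left_out_def right_in_def right_out_def)

lemma over_neq_under: "over_in K v \<noteq> under_in K w" "over_out K v \<noteq> under_out K w"
proof -
  have "over_in K v \<noteq> under_in K v" "over_out K v \<noteq> under_out K v"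
    by (auto simp: over_in_def over_out_def under_in_def under_out_def
      left_in_def left_out_def right_in_def right_out_def)
  then show "over_in K v \<noteq> under_in K w" "over_out K v \<noteq> under_out K w"
    using fst_crossing by (metis, metis nat.inject)
qed

lemma over_in_notin_under_ins: "over_in K v \<notin> under_ins K"
  by (auto simp: under_ins_def over_neq_under)

lemma over_ins_iff: "x \<in> over_ins K \<longleftrightarrow> fst x < H \<and> x = over_in K (fst x)"
  and under_ins_iff: "x \<in> under_ins K \<longleftrightarrow> fst x < H \<and> x = under_in K (fst x)"
  by (auto simp: over_ins_def under_ins_def crossings_def image_iff)

lemma nodes_iff: "(v, p) \<in> nodes \<longleftrightarrow> v < H \<and> (p = pos v \<or> p = pos v + 1)"
  unfolding Un_iff over_ins_iff under_ins_iff
  by (simp add: over_in_def under_in_def left_in_def right_in_def) blast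

lemma cut_step_iff: "(x, y) \<in> cut_step K B \<longleftrightarrow> x \<in> points K \<and> x \<notin> B \<and> y = nxt x"
  unfolding cut_step_def by blast

lemma cut_piece_refl [simp]: "x \<in> cut_piece K B x"
  by (simp add: cut_piece_def)

lemma cut_piece_sym: "y \<in> cut_piece K B x \<Longrightarrow> x \<in> cut_piece K B y"
proof -
  have "sym (cut_step K B \<union> (cut_step K B)\<inverse>)" unfolding sym_def by blast
  from sym_rtrancl[OF this] show "y \<in> cut_piece K B x \<Longrightarrow> x \<in> cut_piece K B y"
    unfolding cut_piece_def sym_def by blast
qed

lemma cut_piece_eq:
  assumes "y \<in> cut_piece K B x"
  shows "cut_piece K B y = cut_piece K B x"
proof -
  let ?R = "cut_step K B \<union> (cut_step K B)\<inverse>"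
  have "(x, y) \<in> ?R\<^sup>*" "(y, x) \<in> ?R\<^sup>*"
    using assms cut_piece_sym[OF assms] by (simp_all add: cut_piece_def)
  then have "(y, z) \<in> ?R\<^sup>* \<longleftrightarrow> (x, z) \<in> ?R\<^sup>*" for z
    using rtrancl_trans[of x y ?R z] rtrancl_trans[of y x ?R z] by iprover
  then show ?thesis unfolding cut_piece_def by (rule Collect_cong)
qed

lemma cut_piece_next:
  assumes "x \<in> points K" "x \<notin> B"
  shows "cut_piece K B (nxt x) = cut_piece K B x"
proof (rule cut_piece_eq)
  have "(x, nxt x) \<in> cut_step K B" using assms by (simp add: cut_step_iff)
  then show "nxt x \<in> cut_piece K B x" unfolding cut_piece_def by blast
qed

lemma cut_piece_const:
  assumes "\<And>x. x \<in> points K \<Longrightarrow> x \<notin> B \<Longrightarrow> g (nxt x) = g x" and "y \<in> cut_piece K B x"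
  shows "g y = g x"
proof -
  have "(x, y) \<in> (cut_step K B \<union> (cut_step K B)\<inverse>)\<^sup>*"
    using assms(2) by (simp add: cut_piece_def)
  then show ?thesis
    by (induction rule: rtrancl_induct) (use assms(1) in \<open>auto simp: cut_step_iff\<close>)
qed

lemma cut_piece_points:
  assumes "x \<in> points K"
  shows "cut_piece K B x \<subseteq> points K"
proof
  fix y assume "y \<in> cut_piece K B x"
  then have "(x, y) \<in> (cut_step K B \<union> (cut_step K B)\<inverse>)\<^sup>*" by (simp add: cut_piece_def)
  then show "y \<in> points K"
    by (induction rule: rtrancl_induct) (use assms next_in_points in \<open>auto simp: cut_step_iff\<close>)
qed

lemma part_arc_next: "x \<in> points K \<Longrightarrow> x \<notin> nodes \<Longrightarrow> part_arc K (nxt x) = part_arc K x"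
  unfolding part_arc_def by (rule cut_piece_next) auto

lemma part_arc_in [simp]: "x \<in> points K \<Longrightarrow> part_arc K x \<in> part_arcs K"
  by (simp add: part_arcs_def)

text \<open>The representative picked by \<open>SOME\<close> is immaterial once \<open>g\<close> is
  constant along all steps that do not pass a crossing.\<close>

definition part_coloring_of :: "(point \<Rightarrow> int) \<Rightarrow> part_coloring" where
  "part_coloring_of g = (\<lambda>P\<in>part_arcs K. g (SOME x. x \<in> P))"

lemma part_coloring_of_extensional: "part_coloring_of g \<in> extensional (part_arcs K)"
  by (simp add: part_coloring_of_def)

lemma col_at_part_coloring_of:
  assumes "\<And>x. x \<in> points K \<Longrightarrow> x \<notin> nodes \<Longrightarrow> g (nxt x) = g x" and "x \<in> points K"
  shows "col_at K (part_coloring_of g) x = g x"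
proof -
  have "(SOME y. y \<in> part_arc K x) \<in> part_arc K x"
    by (rule someI[of _ x]) (simp add: part_arc_def)
  then have "g (SOME y. y \<in> part_arc K x) = g x"
    using cut_piece_const[of nodes g] assms(1) unfolding part_arc_def by blast
  then show ?thesis using assms(2) by (simp add: part_coloring_of_def)
qed

lemma part_coloring_eqI:
  assumes "s \<in> extensional (part_arcs K)" "s' \<in> extensional (part_arcs K)"
    and "\<And>x. x \<in> points K \<Longrightarrow> col_at K s x = col_at K s' x"
  shows "s = s'"
  by (rule extensionalityI[OF assms(1,2)]) (auto simp: part_arcs_def assms(3))

section \<open>Flows as cyclic sequences of level colorings\<close>

text \<open>Monotonicity and the base color are left out, so that one bijection with level sequences
  serves both kinds of states and the conjugated ones; \<open>bij_betw_restrict\<close> imposes the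
  conditions afterwards.\<close>

definition flows :: "nat \<Rightarrow> part_coloring set" where
  "flows n = {s. is_flow K s \<and> (\<forall>P\<in>part_arcs K. s P \<in> {0..int n})}"

definition flow_step :: "nat \<Rightarrow> (nat \<Rightarrow> int) \<Rightarrow> (nat \<Rightarrow> int) \<Rightarrow> bool" where
  "flow_step v c c' \<longleftrightarrow> (\<forall>p\<in>{1..S} - {pos v, pos v + 1}. c' p = c p) \<and>
     c (pos v) + c (pos v + 1) = c' (pos v) + c' (pos v + 1)"

definition level_flows :: "nat \<Rightarrow> (nat \<Rightarrow> nat \<Rightarrow> int) set" where
  "level_flows n = {F \<in> {..H} \<rightarrow>\<^sub>E colorings S n. F 0 = F H \<and> (\<forall>v<H. flow_step v (F v) (F (Suc v)))}"

definition levels :: "part_coloring \<Rightarrow> nat \<Rightarrow> nat \<Rightarrow> int" where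
  "levels s = (\<lambda>v\<in>{..H}. \<lambda>p\<in>{1..S}. col_at K s (v, p))"

lemma levels_eq: "(v, p) \<in> points K \<Longrightarrow> levels s v p = col_at K s (v, p)"
  by (simp add: levels_def points_iff)

lemma levels_crossing:
  assumes "v < H"
  shows "col_at K s (left_in K v) = levels s v (pos v)"
    "col_at K s (right_in K v) = levels s v (pos v + 1)"
    "col_at K s (left_out K v) = levels s (Suc v) (pos v)"
    "col_at K s (right_out K v) = levels s (Suc v) (pos v + 1)"
  using crossing_points(5-8)[OF assms]
  by (simp_all add: levels_eq left_in_def right_in_def left_out_def right_out_def)

text \<open>A coloring of part arcs is a coloring of points that changes only at crossings. Since
  part arcs continue through the closure, the top and bottom levels must agree.\<close>

lemma levels_bij: "bij_betw levels (flows n) (level_flows n)"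
proof (rule bij_betw_byWitness[where f' = "\<lambda>F. part_coloring_of (\<lambda>(v, p). F v p)"])
  have const: "(\<lambda>(v, p). F v p) (nxt x) = (\<lambda>(v, p). F v p) x"
    if F: "F \<in> level_flows n" and x: "x \<in> points K" "x \<notin> nodes" for F x
  proof -
    obtain v p where vp: "x = (v, p)" by (cases x)
    show ?thesis
    proof (cases "v = H")
      case True
      then show ?thesis using F vp by (simp add: next_point_eq level_flows_def)
    next
      case False
      then have "v < H" "p \<in> {1..S} - {pos v, pos v + 1}"
        using x nodes_iff[of v p] by (auto simp: vp points_iff)
      then show ?thesis using F False by (auto simp: vp next_point_eq level_flows_def flow_step_def)
    qed
  qed
  have col: "col_at K (part_coloring_of (\<lambda>(v, p). F v p)) (v, p) = F v p"
    if "F \<in> level_flows n" "(v, p) \<in> points K" for F v p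
    using col_at_part_coloring_of[of "\<lambda>(v, p). F v p" "(v, p)"] const[OF that(1)] that(2) by simp
  show "levels ` flows n \<subseteq> level_flows n"
  proof clarify
    fix s assume s: "s \<in> flows n"
    have "levels s v \<in> colorings S n" if "v \<le> H" for v
      using s that by (auto simp: levels_def colorings_def flows_def points_iff)
    moreover have "levels s 0 = levels s H"
    proof
      show "levels s 0 p = levels s H p" for p
        using part_arc_next[of "(H, p)"] by (auto simp: levels_def next_point_eq nodes_iff points_iff simp del: Un_iff)
    qed
    moreover have "flow_step v (levels s v) (levels s (Suc v))" if v: "v < H" for v
      unfolding flow_step_def
    proof (intro conjI ballI)
      show "levels s (Suc v) p = levels s v p" if "p \<in> {1..S} - {pos v, pos v + 1}" for p
        using part_arc_next[of "(v, p)"] v that by (auto simp: levels_def next_point_eq nodes_iff points_iff simp del: Un_iff)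
      show "levels s v (pos v) + levels s v (pos v + 1) = levels s (Suc v) (pos v) + levels s (Suc v) (pos v + 1)"
        using s v unfolding levels_crossing[OF v, symmetric] by (simp add: flows_def is_flow_def)
    qed
    ultimately show "levels s \<in> level_flows n"
      by (auto simp: level_flows_def levels_def)
  qed
  show "(\<lambda>F. part_coloring_of (\<lambda>(v, p). F v p)) ` level_flows n \<subseteq> flows n"
  proof clarify
    fix F assume F: "F \<in> level_flows n"
    let ?s = "part_coloring_of (\<lambda>(v, p). F v p)"
    have "F v p \<in> {0..int n}" if "(v, p) \<in> points K" for v p
      using F that colorings_range[of "F v" S n p] by (auto simp: level_flows_def points_iff)
    then have "\<forall>P\<in>part_arcs K. ?s P \<in> {0..int n}"
      using col[OF F] by (fastforce simp: part_arcs_def)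
    moreover have "is_flow K ?s"
      unfolding is_flow_def
    proof (intro conjI ballI)
      fix v assume "v \<in> crossings K"
      then have v: "v < H" by simp
      show "col_at K ?s (left_in K v) + col_at K ?s (right_in K v)
          = col_at K ?s (left_out K v) + col_at K ?s (right_out K v)"
        using crossing_points(5-8)[OF v] F v
        by (simp add: left_in_def right_in_def left_out_def right_out_def col[OF F] level_flows_def flow_step_def)
    qed (rule part_coloring_of_extensional)
    ultimately show "?s \<in> flows n" by (simp add: flows_def)
  qed
  show "\<forall>s\<in>flows n. part_coloring_of (\<lambda>(v, p). levels s v p) = s"
  proof
    fix s assume s: "s \<in> flows n"
    then have F: "levels s \<in> level_flows n" using \<open>levels ` flows n \<subseteq> level_flows n\<close> by blast
    show "part_coloring_of (\<lambda>(v, p). levels s v p) = s"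
    proof (rule part_coloring_eqI)
      show "s \<in> extensional (part_arcs K)" using s by (simp add: flows_def is_flow_def)
      show "col_at K (part_coloring_of (\<lambda>(v, p). levels s v p)) x = col_at K s x"
        if "x \<in> points K" for x
        using col[OF F] that levels_eq by (cases x) auto
    qed (rule part_coloring_of_extensional)
  qed
  show "\<forall>F\<in>level_flows n. levels (part_coloring_of (\<lambda>(v, p). F v p)) = F"
  proof
    fix F assume F: "F \<in> level_flows n"
    then have F': "F \<in> {..H} \<rightarrow>\<^sub>E colorings S n" by (simp add: level_flows_def)
    have "(if v \<le> H then \<lambda>p\<in>{1..S}. col_at K (part_coloring_of (\<lambda>(v, p). F v p)) (v, p) else undefined) = F v" for v
    proof (cases "v \<le> H")
      case True
      then have "F v \<in> extensional {1..S}" using F' by (auto simp: colorings_def PiE_iff)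
      then show ?thesis using True col[OF F]
        by (auto simp: points_iff extensional_def fun_eq_iff)
    next
      case False
      then show ?thesis using F' by (auto simp: PiE_iff extensional_def)
    qed
    then show "levels (part_coloring_of (\<lambda>(v, p). F v p)) = F"
      unfolding levels_def restrict_def[of _ "{..H}"] atMost_iff by (rule ext)
  qed
qed

lemma minus_states_eq:
  "minus_states K n = {s \<in> flows n. (\<forall>v\<in>crossings K. col_at K s (over_in K v) \<ge> col_at K s (over_out K v))
     \<and> closure_col K s 1 = 0}"
  by (auto simp: minus_states_def flows_def)

lemma plus_states_eq:
  "plus_states K n = {s \<in> flows n. (\<forall>v\<in>crossings K. col_at K s (over_in K v) \<le> col_at K s (over_out K v))
     \<and> closure_col K s 1 = 0}"
  by (auto simp: plus_states_def flows_def)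

definition over_col :: "nat \<Rightarrow> (nat \<Rightarrow> int) \<Rightarrow> (nat \<Rightarrow> int) \<Rightarrow> int \<times> int" where
  "over_col v c c' = (if cr_sign K v = 1 then (c (pos v), c' (pos v + 1)) else (c (pos v + 1), c' (pos v)))"

lemma over_col_levels:
  assumes "v < H"
  shows "over_col v (levels s v) (levels s (Suc v)) = (col_at K s (over_in K v), col_at K s (over_out K v))"
  by (simp add: over_col_def over_in_def over_out_def levels_crossing[OF assms])

text \<open>The support of the crossing matrix encodes the conditions of a \<open>(-)\<close>-state
  at that crossing, so closed paths of nonzero weight are flows that decrease weakly along
  overstrands.\<close>

lemma kernel_eq:
  "kernel n S (pos v) (cr_sign K v) c c' =
     (if flow_step v c c' \<and> fst (over_col v c c') \<ge> snd (over_col v c c')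
      then R_factor n (cr_sign K v) (c (pos v)) (c (pos v + 1))
             (nat (fst (over_col v c c') - snd (over_col v c c'))) else 0)"
  by (auto simp: kernel_def flow_step_def R_entry_def over_col_def)

lemma closure_col_levels: "l \<in> {1..S} \<Longrightarrow> closure_col K s l = levels s H l"
  by (simp add: closure_col_def levels_eq points_iff)

lemma qp_sum: "finite A \<Longrightarrow> (\<Prod>a\<in>A. qp (f a)) = qp (\<Sum>a\<in>A. f a)"
  by (induction A rule: finite_induct) (simp_all add: qp_mult)

lemma partial_trace_flows:
  "partial_trace n S pos (cr_sign K) H a =
    (\<Sum>F | F \<in> level_flows n \<and> (\<forall>v<H. fst (over_col v (F v) (F (Suc v))) \<ge> snd (over_col v (F v) (F (Suc v))))
         \<and> F H 1 = a.
       closure_weight n S (F H) * (\<Prod>v<H. kernel n S (pos v) (cr_sign K v) (F v) (F (Suc v))))"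
  (is "_ = sum ?W ?A")
proof -
  let ?B = "{F. F \<in> {..H} \<rightarrow>\<^sub>E colorings S n \<and> F 0 = F H \<and> F H 1 = a}"
  have "sum ?W ?A = sum ?W ?B"
  proof (rule sum.mono_neutral_left)
    show "finite ?B" by (rule finite_subset[of _ "{..H} \<rightarrow>\<^sub>E colorings S n"]) (auto intro: finite_PiE)
    show "\<forall>F\<in>?B - ?A. ?W F = 0"
    proof
      fix F assume F: "F \<in> ?B - ?A"
      then obtain v where "v < H" "\<not> (flow_step v (F v) (F (Suc v))
          \<and> fst (over_col v (F v) (F (Suc v))) \<ge> snd (over_col v (F v) (F (Suc v))))"
        by (auto simp: level_flows_def)
      then have "kernel n S (pos v) (cr_sign K v) (F v) (F (Suc v)) = 0"
        unfolding kernel_eq by presburger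
      then show "?W F = 0" using \<open>v < H\<close> by auto
    qed
  qed (auto simp: level_flows_def)
  then show ?thesis unfolding partial_trace_paths by simp
qed

lemma colored_jones_trace: "colored_jones n K = partial_trace n S pos (cr_sign K) H 0"
proof -
  let ?A = "{F \<in> level_flows n. (\<forall>v<H. fst (over_col v (F v) (F (Suc v))) \<ge> snd (over_col v (F v) (F (Suc v))))
         \<and> F H 1 = 0}"
  have bij: "bij_betw levels (minus_states K n) ?A"
    unfolding minus_states_eq
    by (rule bij_betw_restrict[OF levels_bij])
      (use strings_pos in \<open>auto simp: over_col_levels closure_col_levels\<close>)
  have "colored_jones n K = (\<Sum>s\<in>minus_states K n. closure_weight n S (levels s H) *
      (\<Prod>v<H. kernel n S (pos v) (cr_sign K v) (levels s v) (levels s (Suc v))))"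
    unfolding colored_jones_def
  proof (intro sum.cong refl arg_cong2[of _ _ _ _ "(*)"])
    fix s assume s: "s \<in> minus_states K n"
    then have A: "levels s \<in> ?A" using bij by (auto simp: bij_betw_def)
    show "(\<Prod>l=2..S. v_pow (of_int (- int n + 2 * closure_col K s l))) = closure_weight n S (levels s H)"
      unfolding v_pow_of_int closure_weight_def qp_sum[OF finite_atLeastAtMost] sum_distrib_left
      by (intro arg_cong[of _ _ qp] sum.cong) (auto simp: closure_col_levels)
    show "(\<Prod>c\<in>crossings K. R_factor n (cr_sign K c)
        (col_at K s (left_in K c)) (col_at K s (right_in K c))
        (nat (col_at K s (over_in K c) - col_at K s (over_out K c))))
      = (\<Prod>v<H. kernel n S (pos v) (cr_sign K v) (levels s v) (levels s (Suc v)))"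
      unfolding crossings_def
    proof (intro prod.cong refl)
      fix v assume "v \<in> {..<H}"
      then show "R_factor n (cr_sign K v) (col_at K s (left_in K v)) (col_at K s (right_in K v))
          (nat (col_at K s (over_in K v) - col_at K s (over_out K v)))
        = kernel n S (pos v) (cr_sign K v) (levels s v) (levels s (Suc v))"
        using A by (auto simp: kernel_eq level_flows_def over_col_levels levels_crossing)
    qed
  qed
  also have "\<dots> = (\<Sum>F\<in>?A. closure_weight n S (F H) *
      (\<Prod>v<H. kernel n S (pos v) (cr_sign K v) (F v) (F (Suc v))))"
    by (rule sum.reindex_bij_betw[OF bij])
  finally show ?thesis unfolding partial_trace_flows by simp
qed

section \<open>Orientation reversal and comparison of the local factors\<close>

definition plus_factor :: "nat \<Rightarrow> part_coloring \<Rightarrow> nat \<Rightarrow> ratfun" where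
  "plus_factor n s v =
     (let a = col_at K s (over_out K v); b = col_at K s (under_out K v);
          r = nat (a - col_at K s (over_in K v))
      in if cr_sign K v = 1 then f_plus n a b r else f_minus n b a r)"

lemma Z_R_eq:
  "Z_R n K s = (\<Prod>l=2..S. qp (2 * (int n - 2 * closure_col K s l))) * (\<Prod>v<H. plus_factor n s v)"
proof -
  let ?a = "\<lambda>v. col_at K s (over_out K v)" and ?b = "\<lambda>v. col_at K s (under_out K v)"
  let ?r = "\<lambda>v. nat (?a v - col_at K s (over_in K v))"
  let ?p = "\<lambda>v. f_plus n (?a v) (?b v) (?r v)" and ?m = "\<lambda>v. f_minus n (?b v) (?a v) (?r v)"
  have "(\<Prod>v | v \<in> {..<H} \<and> cr_sign K v = 1. ?p v) * (\<Prod>v | v \<in> {..<H} \<and> cr_sign K v = - 1. ?m v)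
    = (\<Prod>v\<in>{..<H}. (if cr_sign K v = 1 then ?p v else 1) * (if cr_sign K v = - 1 then ?m v else 1))"
    by (simp only: prod.inter_filter[OF finite_lessThan] prod.distrib)
  also have "\<dots> = (\<Prod>v<H. plus_factor n s v)"
    using sign_cases by (intro prod.cong) (auto simp: plus_factor_def Let_def)
  finally show ?thesis
    unfolding Z_R_def Let_def v_pow_of_int crossings_def mult.assoc by simp
qed

lemma flow_range:
  assumes "s \<in> flows n" "x \<in> points K"
  shows "0 \<le> col_at K s x" "col_at K s x \<le> int n"
  using assms by (auto simp: flows_def)

lemma flow_over_under:
  assumes "s \<in> flows n" "v < H"
  shows "col_at K s (over_in K v) + col_at K s (under_in K v)
       = col_at K s (over_out K v) + col_at K s (under_out K v)"
proof -
  have "col_at K s (left_in K v) + col_at K s (right_in K v)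
      = col_at K s (left_out K v) + col_at K s (right_out K v)"
    using assms by (simp add: flows_def is_flow_def)
  then show ?thesis by (simp add: over_in_def under_in_def over_out_def under_out_def)
qed

text \<open>For both signs the gauges of the outgoing colors stand on one side and those of the
  incoming colors on the other, which is the form that cancels between consecutive levels.\<close>

lemma plus_factor_conjugate:
  assumes s: "s \<in> flows n" and v: "v < H" and le: "col_at K s (over_in K v) \<le> col_at K s (over_out K v)"
  shows "plus_factor n s v * (gauge n (col_at K s (left_out K v)) * gauge n (col_at K s (right_out K v)))
    = R_factor n (cr_sign K v) (int n - col_at K s (left_in K v)) (int n - col_at K s (right_in K v))
        (nat (col_at K s (over_out K v) - col_at K s (over_in K v)))
      * (gauge n (col_at K s (left_in K v)) * gauge n (col_at K s (right_in K v)))"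
proof -
  define r where "r = nat (col_at K s (over_out K v) - col_at K s (over_in K v))"
  have out: "col_at K s (over_out K v) = col_at K s (over_in K v) + int r"
    and "in": "col_at K s (under_in K v) = col_at K s (under_out K v) + int r"
    using le flow_over_under[OF s v] by (simp_all add: r_def)
  note range = flow_range[OF s crossing_points(1)[OF v]] flow_range[OF s crossing_points(2)[OF v]]
    flow_range[OF s crossing_points(3)[OF v]] flow_range[OF s crossing_points(4)[OF v]]
  have r: "nat (int r) = r" "nat (x + int r - x) = r" for x by simp_all
  show ?thesis
  proof (cases "cr_sign K v = 1")
    case True
    then show ?thesis
      using f_plus_conjugate[of "col_at K s (under_out K v)" r n "col_at K s (over_in K v)"] range out "in"
      by (simp add: plus_factor_def R_factor_def Let_def over_in_def under_in_def over_out_def under_out_def)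
  next
    case False
    then show ?thesis
      using f_minus_conjugate[of "col_at K s (under_out K v)" r n "col_at K s (over_in K v)"] range out "in"
      by (simp add: plus_factor_def R_factor_def Let_def over_in_def under_in_def over_out_def under_out_def
          ac_simps)
  qed
qed

text \<open>The strings not involved in the crossing contribute the same to both levels; the
  statement is cross-multiplied to do without quotients.\<close>

lemma flow_step_prod:
  fixes \<phi> :: "nat \<Rightarrow> int \<Rightarrow> 'a::comm_monoid_mult"
  assumes "v < H" "flow_step v c c'"
  shows "(\<Prod>p\<in>{1..S}. \<phi> p (c' p)) * (\<phi> (pos v) (c (pos v)) * \<phi> (pos v + 1) (c (pos v + 1)))
    = (\<Prod>p\<in>{1..S}. \<phi> p (c p)) * (\<phi> (pos v) (c' (pos v)) * \<phi> (pos v + 1) (c' (pos v + 1)))"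
proof -
  let ?A = "{1..S} - {pos v, pos v + 1}"
  have "{1..S} = insert (pos v) (insert (pos v + 1) ?A)" using pos_range[OF assms(1)] by auto
  then have split: "prod f {1..S} = f (pos v) * (f (pos v + 1) * prod f ?A)" for f :: "nat \<Rightarrow> 'a"
    using prod.insert[of "insert (pos v + 1) ?A" "pos v" f] prod.insert[of ?A "pos v + 1" f] by simp
  have "(\<Prod>p\<in>?A. \<phi> p (c' p)) = (\<Prod>p\<in>?A. \<phi> p (c p))"
    using assms(2) by (intro prod.cong) (auto simp: flow_step_def)
  then show ?thesis unfolding split by (simp add: ac_simps)
qed

lemma levels_flow_step:
  assumes "s \<in> flows n" "v < H"
  shows "flow_step v (levels s v) (levels s (Suc v))"
  using levels_bij[of n] assms by (auto simp: bij_betw_def level_flows_def)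

lemma levels_cyclic:
  assumes "s \<in> flows n"
  shows "levels s 0 = levels s H"
  using levels_bij[of n] assms by (auto simp: bij_betw_def level_flows_def)

definition conjugate :: "nat \<Rightarrow> (nat \<Rightarrow> nat \<Rightarrow> int) \<Rightarrow> nat \<Rightarrow> nat \<Rightarrow> int" where
  "conjugate n F = (\<lambda>v\<in>{..H}. \<lambda>p\<in>{1..S}. int n - F v p)"

lemma conjugate_eq: "v \<le> H \<Longrightarrow> 1 \<le> p \<Longrightarrow> p \<le> S \<Longrightarrow> conjugate n F v p = int n - F v p"
  by (simp add: conjugate_def)

lemma conjugate_level_flows:
  assumes F: "F \<in> level_flows n"
  shows "conjugate n F \<in> level_flows n"
proof -
  have "conjugate n F v \<in> colorings S n" if "v \<le> H" for v
  proof -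
    have "F v \<in> colorings S n" using that F by (auto simp: level_flows_def)
    from colorings_range[OF this] show ?thesis
      using that by (auto simp: conjugate_def colorings_def)
  qed
  moreover have "flow_step v (conjugate n F v) (conjugate n F (Suc v))" if "v < H" for v
  proof -
    have "flow_step v (F v) (F (Suc v))" using F that by (simp add: level_flows_def)
    then show ?thesis using that pos_range[OF that] by (simp add: flow_step_def conjugate_eq)
  qed
  moreover have "conjugate n F 0 = conjugate n F H"
    using F by (simp add: conjugate_def level_flows_def)
  ultimately show ?thesis by (auto simp: level_flows_def conjugate_def)
qed

lemma conjugate_conjugate:
  assumes "F \<in> level_flows n"
  shows "conjugate n (conjugate n F) = F"
proof
  fix v
  show "conjugate n (conjugate n F) v = F v"
  proof (cases "v \<le> H")
    case True
    then have "F v \<in> extensional {1..S}"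
      using assms by (auto simp: level_flows_def colorings_def PiE_iff)
    then show ?thesis using True by (auto simp: conjugate_def extensional_def)
  next
    case False
    then show ?thesis using assms by (auto simp: conjugate_def level_flows_def PiE_iff extensional_def)
  qed
qed

lemma conjugate_bij: "bij_betw (conjugate n) (level_flows n) (level_flows n)"
  by (rule bij_betw_byWitness[where f' = "conjugate n"])
    (auto simp: conjugate_conjugate conjugate_level_flows)

lemma over_col_conjugate:
  assumes "v < H"
  shows "over_col v (conjugate n F v) (conjugate n F (Suc v))
    = (int n - fst (over_col v (F v) (F (Suc v))), int n - snd (over_col v (F v) (F (Suc v))))"
  using assms pos_range[OF assms] by (simp add: over_col_def conjugate_eq)

text \<open>The closure weights agree because \<open>n - 2 * b = 2 * (n - b) - n\<close>. The gauge
  discrepancy at a crossing is the quotient of \<open>G\<close> at two adjacent levels, where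
  \<open>G\<close> collects the gauges of all strings, and \<open>G\<close> has the same value at
  the bottom and the top.\<close>

lemma Z_R_conjugate:
  assumes s: "s \<in> plus_states K n"
  defines "F \<equiv> conjugate n (levels s)"
  shows "Z_R n K s = closure_weight n S (F H) *
    (\<Prod>v<H. kernel n S (pos v) (cr_sign K v) (F v) (F (Suc v)))"
proof -
  have fl: "s \<in> flows n" using s by (simp add: plus_states_eq)
  have le: "col_at K s (over_in K v) \<le> col_at K s (over_out K v)" if "v < H" for v
    using s that by (auto simp: plus_states_eq)
  have F: "F \<in> level_flows n"
    using levels_bij[of n] fl by (auto simp: F_def bij_betw_def intro: conjugate_level_flows)
  define G where "G v = (\<Prod>p\<in>{1..S}. gauge n (levels s v p))" for v
  have G: "G v \<noteq> 0" for v by (simp add: G_def)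
  let ?k = "\<lambda>v. kernel n S (pos v) (cr_sign K v) (F v) (F (Suc v))"
  have step: "plus_factor n s v * G (Suc v) = ?k v * G v" if v: "v < H" for v
  proof -
    let ?gi = "gauge n (col_at K s (left_in K v)) * gauge n (col_at K s (right_in K v))"
    let ?go = "gauge n (col_at K s (left_out K v)) * gauge n (col_at K s (right_out K v))"
    have FS: "flow_step v (F v) (F (Suc v))" using F v by (simp add: level_flows_def)
    have k: "?k v = R_factor n (cr_sign K v) (int n - col_at K s (left_in K v)) (int n - col_at K s (right_in K v))
        (nat (col_at K s (over_out K v) - col_at K s (over_in K v)))"
      unfolding kernel_eq using FS le[OF v] v pos_range[OF v]
      by (simp add: F_def over_col_conjugate over_col_levels levels_crossing conjugate_eq)
    have 1: "plus_factor n s v * ?go = ?k v * ?gi"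
      unfolding k by (rule plus_factor_conjugate[OF fl v le[OF v]])
    have 2: "G (Suc v) * ?gi = G v * ?go"
      using flow_step_prod[OF v levels_flow_step[OF fl v], of "\<lambda>_. gauge n"]
      by (simp add: G_def levels_crossing[OF v])
    have "(plus_factor n s v * G (Suc v)) * ?gi = plus_factor n s v * ?go * G v"
      using 2 by (simp add: ac_simps)
    also have "\<dots> = (?k v * G v) * ?gi" unfolding 1 by (simp add: ac_simps)
    finally show ?thesis by simp
  qed
  have "(\<Prod>v<H. plus_factor n s v) * (\<Prod>v<H. G (Suc v)) = (\<Prod>v<H. ?k v) * (\<Prod>v<H. G v)"
    unfolding prod.distrib[symmetric] by (intro prod.cong refl) (simp add: step)
  moreover have "(\<Prod>v<H. G (Suc v)) = (\<Prod>v<H. G v)"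
    by (rule prod_Suc_cyclic) (simp_all add: G, simp add: G_def levels_cyclic[OF fl])
  ultimately have "(\<Prod>v<H. plus_factor n s v) = (\<Prod>v<H. ?k v)" using G by simp
  moreover have "(\<Prod>l=2..S. qp (2 * (int n - 2 * closure_col K s l))) = closure_weight n S (F H)"
    unfolding closure_weight_def qp_sum[OF finite_atLeastAtMost] sum_distrib_left
    by (intro arg_cong[of _ _ qp] sum.cong) (auto simp: closure_col_levels F_def conjugate_eq)
  ultimately show ?thesis by (simp add: Z_R_eq)
qed

text \<open>Conjugation turns an increase along the overstrand into a decrease and the base color 0
  into \<open>n\<close>.\<close>

lemma plus_states_sum: "(\<Sum>s\<in>plus_states K n. Z_R n K s) = partial_trace n S pos (cr_sign K) H (int n)"
proof -
  let ?A = "{F \<in> level_flows n. (\<forall>v<H. fst (over_col v (F v) (F (Suc v))) \<ge> snd (over_col v (F v) (F (Suc v))))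
         \<and> F H 1 = int n}"
  let ?W = "\<lambda>F. closure_weight n S (F H) *
    (\<Prod>v<H. kernel n S (pos v) (cr_sign K v) (F v) (F (Suc v)))"
  have bij: "bij_betw (conjugate n \<circ> levels) (plus_states K n) ?A"
    unfolding plus_states_eq
    by (rule bij_betw_restrict[OF bij_betw_trans[OF levels_bij conjugate_bij]])
      (use strings_pos in \<open>auto simp: over_col_conjugate over_col_levels closure_col_levels conjugate_eq\<close>)
  have "(\<Sum>s\<in>plus_states K n. Z_R n K s) = (\<Sum>s\<in>plus_states K n. ?W ((conjugate n \<circ> levels) s))"
    by (intro sum.cong) (simp_all add: Z_R_conjugate)
  also have "\<dots> = sum ?W ?A"
    by (rule sum.reindex_bij_betw[OF bij])
  finally show ?thesis unfolding partial_trace_flows by simp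
qed

lemma colored_jones_plus_states: "colored_jones n K = (\<Sum>s\<in>plus_states K n. Z_R n K s)"
  unfolding colored_jones_trace plus_states_sum
  by (rule partial_trace_const[symmetric]) (use pos_range strings_pos in auto)

lemma flow_step_sum:
  fixes \<psi> :: "nat \<Rightarrow> int \<Rightarrow> int"
  assumes "v < H" "flow_step v c c'"
  shows "(\<Sum>p\<in>{1..S}. \<psi> p (c' p)) - (\<Sum>p\<in>{1..S}. \<psi> p (c p))
    = \<psi> (pos v) (c' (pos v)) + \<psi> (pos v + 1) (c' (pos v + 1))
      - \<psi> (pos v) (c (pos v)) - \<psi> (pos v + 1) (c (pos v + 1))"
proof -
  let ?A = "{1..S} - {pos v, pos v + 1}"
  have "{1..S} = insert (pos v) (insert (pos v + 1) ?A)" using pos_range[OF assms(1)] by auto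
  then have split: "sum f {1..S} = f (pos v) + (f (pos v + 1) + sum f ?A)" for f :: "nat \<Rightarrow> int"
    using sum.insert[of "insert (pos v + 1) ?A" "pos v" f] sum.insert[of ?A "pos v + 1" f] by simp
  have "(\<Sum>p\<in>?A. \<psi> p (c' p)) = (\<Sum>p\<in>?A. \<psi> p (c p))"
    using assms(2) by (intro sum.cong) (auto simp: flow_step_def)
  then show ?thesis unfolding split by simp
qed

text \<open>
  The local contributions of the two state models differ by a power of \<open>q\<close> whose exponent is the
  increment of \<open>\<Sum>\<^sub>p c\<^sub>p\<^sup>2 + 2 n p c\<^sub>p\<close> across the crossing, and these increments add up to 0
  around the closed braid.
\<close>

definition potential :: "nat \<Rightarrow> (nat \<Rightarrow> int) \<Rightarrow> int" where
  "potential n c = (\<Sum>p\<in>{1..S}. (c p)\<^sup>2 + 2 * int n * int p * c p)"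

definition arc_factor :: "nat \<Rightarrow> part_coloring \<Rightarrow> nat \<Rightarrow> ratfun" where
  "arc_factor n s v =
     (let i = col_at K s (over_in K v); b = col_at K s (under_out K v); r = col_at K s (over_out K v) - i
      in t_pow (of_int (int n * cr_sign K v * b)) * t_binom (t_pow (of_int (- cr_sign K v))) (nat (b + r)) (nat b) *
         t_falling (t_pow (of_int (cr_sign K v))) (int n - i) (nat r))"

text \<open>The exponent left over is \<open>2 * (n + r) * (i - b)\<close> at a positive crossing.
  The squares of the potential produce the part with \<open>r\<close>; the position weights produce
  the part with \<open>n\<close>, because the two strands exchange neighbouring positions. At a
  negative crossing the exchange runs the other way, and only the part with \<open>n\<close> changes
  sign.\<close>

lemma plus_factor_arc:
  assumes s: "s \<in> flows n" and v: "v < H" and le: "col_at K s (over_in K v) \<le> col_at K s (over_out K v)"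
  shows "plus_factor n s v = qp (- ((int n)\<^sup>2 * cr_sign K v)
      - 4 * (cr_sign K v * col_at K s (under_out K v) * col_at K s (over_in K v))
      + (potential n (levels s (Suc v)) - potential n (levels s v))) * arc_factor n s v"
proof -
  define r where "r = nat (col_at K s (over_out K v) - col_at K s (over_in K v))"
  define i where "i = col_at K s (over_in K v)"
  define b where "b = col_at K s (under_out K v)"
  have out: "col_at K s (over_out K v) = i + int r"
    and "in": "col_at K s (under_in K v) = b + int r"
    using le flow_over_under[OF s v] by (simp_all add: r_def i_def b_def)
  have b: "0 \<le> b" using flow_range[OF s crossing_points(4)[OF v]] by (simp add: b_def)
  have pot: "potential n (levels s (Suc v)) - potential n (levels s v)
    = (col_at K s (left_out K v))\<^sup>2 + 2 * int n * int (pos v) * col_at K s (left_out K v)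
    + ((col_at K s (right_out K v))\<^sup>2 + 2 * int n * int (pos v + 1) * col_at K s (right_out K v))
    - ((col_at K s (left_in K v))\<^sup>2 + 2 * int n * int (pos v) * col_at K s (left_in K v))
    - ((col_at K s (right_in K v))\<^sup>2 + 2 * int n * int (pos v + 1) * col_at K s (right_in K v))"
    using flow_step_sum[OF v levels_flow_step[OF s v], of "\<lambda>p x. x\<^sup>2 + 2 * int n * int p * x"]
    by (simp add: potential_def levels_crossing[OF v])
  show ?thesis
  proof (cases "cr_sign K v = 1")
    case True
    have pot1: "potential n (levels s (Suc v)) - potential n (levels s v) = 2 * (int n + int r) * (i - b)"
      unfolding pot using True "in" out i_def b_def
      by (simp add: over_in_def under_in_def over_out_def under_out_def algebra_simps power2_eq_square)
    have "plus_factor n s v = f_plus n (i + int r) b r"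
      using True out by (simp add: plus_factor_def i_def[symmetric] b_def[symmetric])
    also have "\<dots> = qp (- ((int n)\<^sup>2) - 4 * (b * i) + 2 * (int n + int r) * (i - b)) * (qp (4 * (int n * b))
      * t_binom (qp (- 4)) (nat (b + int r)) (nat b) * t_falling (qp 4) (int n - i) r)"
      unfolding f_plus_t[OF b] mult.assoc[symmetric] qp_mult by (simp add: algebra_simps)
    finally show ?thesis
      unfolding pot1 using True out t_pow_of_int[of 1] t_pow_of_int[of "- 1"] t_pow_of_int[of "int n * b"]
      by (simp add: arc_factor_def i_def[symmetric] b_def[symmetric])
  next
    case False
    then have m: "cr_sign K v = - 1" using sign_cases[OF v] by simp
    have pot1: "potential n (levels s (Suc v)) - potential n (levels s v) = - (2 * (int n - int r) * (i - b))"
      unfolding pot using False "in" out i_def b_def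
      by (simp add: over_in_def under_in_def over_out_def under_out_def algebra_simps power2_eq_square)
    have "plus_factor n s v = f_minus n b (i + int r) r"
      using False out by (simp add: plus_factor_def i_def[symmetric] b_def[symmetric])
    also have "\<dots> = qp ((int n)\<^sup>2 + 4 * (b * i) - 2 * (int n - int r) * (i - b)) * (qp (- (4 * (int n * b)))
      * t_binom (qp 4) (nat (b + int r)) (nat b) * t_falling (qp (- 4)) (int n - i) r)"
      unfolding f_minus_t[OF b] mult.assoc[symmetric] qp_mult by (simp add: algebra_simps)
    finally show ?thesis
      unfolding pot1 using m out t_pow_of_int[of 1] t_pow_of_int[of "- 1"] t_pow_of_int[of "- (int n * b)"]
      by (simp add: arc_factor_def i_def[symmetric] b_def[symmetric])
  qed
qed

lemma Z_R_arc:
  assumes s: "s \<in> plus_states K n"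
  shows "Z_R n K s = t_pow (delta' K n + of_int
      (- ((\<Sum>v\<in>crossings K. cr_sign K v * col_at K s (under_out K v) * col_at K s (over_in K v))
         + (\<Sum>l=2..S. closure_col K s l)))) * (\<Prod>v\<in>crossings K. arc_factor n s v)"
proof -
  have fl: "s \<in> flows n" using s by (simp add: plus_states_eq)
  have le: "col_at K s (over_in K v) \<le> col_at K s (over_out K v)" if "v < H" for v
    using s that by (auto simp: plus_states_eq)
  let ?e = "\<Sum>v<H. cr_sign K v * col_at K s (under_out K v) * col_at K s (over_in K v)"
  let ?\<rho> = "\<Sum>l=2..S. closure_col K s l"
  have tel: "(\<Sum>v<H. potential n (levels s (Suc v)) - potential n (levels s v)) = 0"
    using sum_lessThan_telescope[of "\<lambda>v. potential n (levels s v)" H]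
    by (simp add: levels_cyclic[OF fl])
  have "(\<Prod>v<H. plus_factor n s v) = (\<Prod>v<H. qp (- ((int n)\<^sup>2 * cr_sign K v)
      - 4 * (cr_sign K v * col_at K s (under_out K v) * col_at K s (over_in K v))
      + (potential n (levels s (Suc v)) - potential n (levels s v))) * arc_factor n s v)"
    by (intro prod.cong refl plus_factor_arc[OF fl] le) auto
  also have "\<dots> = qp (- ((int n)\<^sup>2 * writhe K) - 4 * ?e) * (\<Prod>v<H. arc_factor n s v)"
    unfolding prod.distrib qp_sum[OF finite_lessThan] sum.distrib tel unfolding sum_subtractf
    by (simp add: writhe_def crossings_def sum_negf sum_distrib_left)
  finally have 1: "(\<Prod>v<H. plus_factor n s v) = qp (- ((int n)\<^sup>2 * writhe K) - 4 * ?e) * (\<Prod>v<H. arc_factor n s v)" .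
  \<comment> \<open>The closure arcs supply both the term with \<open>strings\<close> in
    \<open>delta'\<close> and the rotation term of \<open>delta\<close>.\<close>
  have 2: "(\<Prod>l=2..S. qp (2 * (int n - 2 * closure_col K s l))) = qp (2 * int n * (int S - 1) - 4 * ?\<rho>)"
    unfolding qp_sum[OF finite_atLeastAtMost] using strings_pos
    by (simp add: right_diff_distrib sum_subtractf sum_distrib_left of_nat_diff algebra_simps)
  show ?thesis
    unfolding Z_R_eq 1 2 crossings_def t_pow_delta' mult.assoc[symmetric] qp_mult
    by (simp add: algebra_simps)
qed

section \<open>The flow lemma\<close>

abbreviation "steps \<equiv> cut_step K (under_ins K)"

abbreviation "circles \<equiv> overcrossing_circles K"

section \<open>Overcrossing circles and overcrossing arcs\<close>

lemma circle_component:
  assumes "C \<in> circles" "x \<in> C"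
  shows "x \<in> points K" "cut_piece K {} x = C" "x \<notin> under_ins K"
proof -
  obtain y where y: "y \<in> points K" "C = cut_piece K {} y"
    using assms(1) by (auto simp: overcrossing_circles_def components_def)
  show "x \<in> points K" using cut_piece_points[OF y(1)] assms(2) y(2) by blast
  show "cut_piece K {} x = C" using cut_piece_eq[of x "{}" y] assms(2) y(2) by blast
  show "x \<notin> under_ins K" using assms by (auto simp: overcrossing_circles_def)
qed

definition on_circle :: "point \<Rightarrow> bool" where
  "on_circle x \<longleftrightarrow> cut_piece K {} x \<in> circles"

lemma on_circle_iff: "x \<in> points K \<Longrightarrow> on_circle x \<longleftrightarrow> cut_piece K {} x \<inter> under_ins K = {}"
  by (simp add: on_circle_def overcrossing_circles_def components_def)

lemma on_circle_ex: "(\<exists>C\<in>circles. x \<in> C) \<longleftrightarrow> on_circle x"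
proof
  assume "\<exists>C\<in>circles. x \<in> C"
  then obtain C where C: "C \<in> circles" "x \<in> C" by blast
  then show "on_circle x" using circle_component(2)[OF C] by (simp add: on_circle_def)
next
  assume "on_circle x"
  then show "\<exists>C\<in>circles. x \<in> C" unfolding on_circle_def using cut_piece_refl by blast
qed

lemma on_circle_next: "x \<in> points K \<Longrightarrow> on_circle (nxt x) \<longleftrightarrow> on_circle x"
  by (simp add: on_circle_def cut_piece_next)

lemma under_in_not_circle: "v < H \<Longrightarrow> \<not> on_circle (under_in K v)"
  using circle_component(3)[of "cut_piece K {} (under_in K v)" "under_in K v"]
  by (auto simp: on_circle_def under_ins_def)

text \<open>A finite set mapped into itself by an injective map is also closed under preimages, so
  \<open>X\<close> contains the whole component of \<open>x\<close>.\<close>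

lemma invariant_circle:
  assumes "X \<subseteq> points K" "x \<in> X" "X \<inter> under_ins K = {}" "nxt ` X \<subseteq> X"
  shows "on_circle x"
proof -
  have "finite X" using finite_subset[OF assms(1) finite_points] .
  moreover have "inj_on nxt X" using next_inj assms(1) inj_on_subset by blast
  ultimately have surj: "nxt ` X = X" using assms(4) by (intro endo_inj_surj)
  have "y \<in> X" if "(x, y) \<in> (cut_step K {} \<union> (cut_step K {})\<inverse>)\<^sup>*" for y
    using that
  proof (induction rule: rtrancl_induct)
    case (step y z)
    from step.hyps(2) consider "z = nxt y" | "z \<in> points K" "y = nxt z"
      unfolding Un_iff converse_iff cut_step_iff by blast
    then show ?case
    proof cases
      case 1
      then show ?thesis using assms(4) step.IH by blast
    next
      case 2
      obtain w where w: "w \<in> X" "y = nxt w" using surj step.IH by blast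
      then have "w = z" using inj_onD[OF next_inj, of w z] 2 assms(1) by auto
      then show ?thesis using w(1) by simp
    qed
  qed (rule assms(2))
  then have "cut_piece K {} x \<subseteq> X" unfolding cut_piece_def by blast
  moreover have "x \<in> points K" using assms(1,2) by blast
  ultimately show ?thesis using assms(3) on_circle_iff[of x] by blast
qed

lemma steps_points: "(x, y) \<in> steps\<^sup>* \<Longrightarrow> x \<in> points K \<Longrightarrow> y \<in> points K"
  by (induction rule: rtrancl_induct) (auto simp: cut_step_iff next_in_points)

lemma steps_points': "(x, y) \<in> steps\<^sup>* \<Longrightarrow> y \<in> points K \<Longrightarrow> x \<in> points K"
  by (induction rule: converse_rtrancl_induct) (auto simp: cut_step_iff)

text \<open>A walk without underpasses that returns to its start repeats forever, so its points form
  an invariant set. Consequently positions on a proper arc are linearly passed, without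
  return.\<close>

lemma cycle_on_circle:
  assumes "x \<in> points K" "(x, x) \<in> steps\<^sup>+"
  shows "on_circle x"
proof (rule invariant_circle[of "{y. (x, y) \<in> steps\<^sup>*}"])
  have returns: "(y, x) \<in> steps\<^sup>+" if "(x, y) \<in> steps\<^sup>*" for y
    using that
  proof (induction rule: rtrancl_induct)
    case (step y z)
    obtain w where "(y, w) \<in> steps" "(w, x) \<in> steps\<^sup>*" using tranclD[OF step.IH] by blast
    moreover have "w = z" using \<open>(y, w) \<in> steps\<close> step.hyps by (simp add: cut_step_iff)
    ultimately show ?case using assms(2) rtrancl_trancl_trancl by metis
  qed (rule assms(2))
  have not_under: "y \<in> points K \<and> y \<notin> under_ins K" if "(x, y) \<in> steps\<^sup>*" for y
    using tranclD[OF returns[OF that]] by (auto simp: cut_step_iff)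
  then show "{y. (x, y) \<in> steps\<^sup>*} \<inter> under_ins K = {}" by blast
  show "nxt ` {y. (x, y) \<in> steps\<^sup>*} \<subseteq> {y. (x, y) \<in> steps\<^sup>*}"
  proof
    fix z assume "z \<in> nxt ` {y. (x, y) \<in> steps\<^sup>*}"
    then obtain y where y: "(x, y) \<in> steps\<^sup>*" "z = nxt y" by blast
    then have "(y, z) \<in> steps" using not_under[OF y(1)] by (simp add: cut_step_iff)
    then show "z \<in> {y. (x, y) \<in> steps\<^sup>*}" using y(1) by simp
  qed
  show "{y. (x, y) \<in> steps\<^sup>*} \<subseteq> points K" using not_under by blast
qed simp

lemma reaches_under_in:
  assumes "x \<in> points K" "\<not> on_circle x"
  obtains v where "v < H" "(x, under_in K v) \<in> steps\<^sup>*"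
proof -
  let ?X = "{y. (x, y) \<in> steps\<^sup>*}"
  have "?X \<subseteq> points K" using steps_points assms(1) by blast
  moreover have "nxt ` ?X \<subseteq> ?X" if "?X \<inter> under_ins K = {}"
  proof
    fix z assume "z \<in> nxt ` ?X"
    then obtain y where y: "(x, y) \<in> steps\<^sup>*" "z = nxt y" by blast
    then have "(y, z) \<in> steps" using that steps_points[OF y(1) assms(1)] by (auto simp: cut_step_iff)
    then show "z \<in> ?X" using y(1) by simp
  qed
  ultimately have "?X \<inter> under_ins K \<noteq> {}" using invariant_circle[of ?X x] assms(2) by blast
  then show ?thesis using that by (auto simp: under_ins_def)
qed

lemma no_step_into_under_out:
  assumes "v < H"
  shows "(z, under_out K v) \<notin> steps"
proof
  assume "(z, under_out K v) \<in> steps"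
  then have z: "z \<in> points K" "z \<notin> under_ins K" "nxt z = nxt (under_in K v)"
    using assms by (auto simp: cut_step_iff)
  then have "z = under_in K v" using inj_onD[OF next_inj z(3) z(1) crossing_points(2)[OF assms]] by simp
  then show False using z(2) assms by (simp add: under_ins_def)
qed

text \<open>Otherwise every point leading to \<open>x\<close> has a predecessor that also leads to
  \<open>x\<close>. By counting, these points are permuted by the successor map; none of them is an
  underpass, so \<open>x\<close> would lie on a circle.\<close>

lemma reached_from_under_out:
  assumes "x \<in> points K" "\<not> on_circle x"
  obtains v where "v < H" "(under_out K v, x) \<in> steps\<^sup>*"
proof (rule ccontr)
  assume "\<not> thesis"
  with that have none: "v < H \<Longrightarrow> (under_out K v, x) \<notin> steps\<^sup>*" for v by blast
  let ?X = "{y. (y, x) \<in> steps\<^sup>*}"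
  have sub: "?X \<subseteq> points K" using steps_points' assms(1) by blast
  have pre: "?X \<subseteq> nxt ` ?X"
  proof
    fix y assume y: "y \<in> ?X"
    then obtain z where z: "z \<in> points K" "y = nxt z" using next_surj sub by blast
    have "z \<notin> under_ins K" using none y z by (auto simp: under_ins_def)
    then have "(z, y) \<in> steps" using z by (simp add: cut_step_iff)
    then show "y \<in> nxt ` ?X" using y z(2) by (auto intro: converse_rtrancl_into_rtrancl)
  qed
  have fin: "finite ?X" using finite_subset[OF sub finite_points] .
  have "nxt ` ?X = ?X"
    by (rule card_seteq[symmetric]) (use pre fin card_image_le in auto)
  moreover have "?X \<inter> under_ins K = {}"
  proof -
    have "(y, nxt y) \<in> steps" if y: "y \<in> ?X" "y \<noteq> x" for y
      using converse_rtranclE[of y x steps] y by (auto simp: cut_step_iff)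
    moreover have "x \<notin> under_ins K"
    proof
      assume "x \<in> under_ins K"
      then obtain v where v: "v < H" "x = under_in K v" by (auto simp: under_ins_def)
      have "nxt x \<in> ?X" using \<open>nxt ` ?X = ?X\<close> by blast
      then show False using none v by simp
    qed
    ultimately show ?thesis by (auto simp: cut_step_iff)
  qed
  ultimately show False using invariant_circle[of ?X x] sub assms(2) by blast
qed

section \<open>Partial sums of the edge colors along an arc\<close>

lemma edgesE:
  assumes "e \<in> edges K"
  obtains v where "v < H" "e = Blue v" | v where "v < H" "e = Red v"
  using assms by (auto simp: edges_def)

lemma finite_edges [simp]: "finite (edges K)"
  by (simp add: edges_def crossings_def)

lemma Blue_Red_edges [simp]: "Blue v \<in> edges K \<longleftrightarrow> v < H" "Red v \<in> edges K \<longleftrightarrow> v < H"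
  by (auto simp: edges_def)

lemma out_inj: "over_out K v = over_out K w \<longleftrightarrow> v = w" "under_out K v = under_out K w \<longleftrightarrow> v = w"
  by (metis fst_crossing(3) nat.inject, metis fst_crossing(4) nat.inject)

lemma head_point_inj: "inj_on (head_point K) (edges K)"
proof (rule inj_onI)
  fix e e' assume "e \<in> edges K" "e' \<in> edges K" and eq: "head_point K e = head_point K e'"
  then show "e = e'"
    by (elim edgesE) (auto simp: out_inj over_neq_under over_neq_under[symmetric])
qed

text \<open>An edge entering at \<open>x\<close> itself is included, unlike in the strict
  \<open>edge_before\<close>. As a red edge enters just after its overpass, the sum of these colors
  is the color of the strand at \<open>x\<close>.\<close>

definition edges_before :: "point \<Rightarrow> edge set" where
  "edges_before x = {e \<in> edges K. (head_point K e, x) \<in> steps\<^sup>*}"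

lemma finite_edges_before [simp]: "finite (edges_before x)"
  by (simp add: edges_before_def)

lemma edges_before_under_out:
  assumes "v < H"
  shows "edges_before (under_out K v) = {Blue v}"
proof -
  have "e = Blue v" if e: "e \<in> edges K" "(head_point K e, under_out K v) \<in> steps\<^sup>*" for e
  proof -
    have "head_point K e = head_point K (Blue v)"
      using e(2) no_step_into_under_out[OF assms] by (auto elim: rtranclE)
    then show ?thesis using inj_onD[OF head_point_inj] e(1) assms by simp
  qed
  then show ?thesis using assms by (auto simp: edges_before_def)
qed

text \<open>By injectivity of the successor map the last step must start at \<open>x\<close>. For
  \<open>x = over_in K v\<close> this translates the strict order at \<open>Red v\<close> into
  \<open>edges_before\<close>.\<close>

lemma steps_into_next:
  assumes "x \<in> points K" "x \<notin> under_ins K"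
  shows "(y, nxt x) \<in> steps\<^sup>+ \<longleftrightarrow> (y, x) \<in> steps\<^sup>*"
proof
  assume "(y, nxt x) \<in> steps\<^sup>+"
  then obtain z where z: "(y, z) \<in> steps\<^sup>*" "(z, nxt x) \<in> steps" using tranclD2 by metis
  then have "z = x" using inj_onD[OF next_inj, of z x] assms(1) by (auto simp: cut_step_iff)
  then show "(y, x) \<in> steps\<^sup>*" using z(1) by simp
next
  assume "(y, x) \<in> steps\<^sup>*"
  moreover have "(x, nxt x) \<in> steps" using assms by (simp add: cut_step_iff)
  ultimately show "(y, nxt x) \<in> steps\<^sup>+" by (rule rtrancl_into_trancl1)
qed

definition flow_val :: "graph_coloring \<Rightarrow> point \<Rightarrow> int" where
  "flow_val f x = (\<Sum>e\<in>edges_before x. fst f e)"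

lemma flow_val_under_out: "v < H \<Longrightarrow> flow_val f (under_out K v) = blue_col f v"
  by (simp add: flow_val_def edges_before_under_out blue_col_def)

text \<open>Off the circles the walk never returns, so edges entering at \<open>nxt x\<close> have
  not been counted yet.\<close>

lemma flow_val_next:
  assumes x: "x \<in> points K" "x \<notin> under_ins K" "\<not> on_circle x"
  shows "flow_val f (nxt x) = flow_val f x + (\<Sum>e | e \<in> edges K \<and> head_point K e = nxt x. fst f e)"
proof -
  have iff: "(y, nxt x) \<in> steps\<^sup>* \<longleftrightarrow> (y, x) \<in> steps\<^sup>* \<or> y = nxt x" for y
    unfolding rtrancl_eq_or_trancl[of y "nxt x"] steps_into_next[OF x(1,2)] by blast
  have "edges_before (nxt x) = edges_before x \<union> {e \<in> edges K. head_point K e = nxt x}"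
    unfolding edges_before_def iff by blast
  moreover have "edges_before x \<inter> {e \<in> edges K. head_point K e = nxt x} = {}"
  proof -
    have "(nxt x, x) \<notin> steps\<^sup>*"
    proof
      assume "(nxt x, x) \<in> steps\<^sup>*"
      moreover have "(x, nxt x) \<in> steps" using x by (simp add: cut_step_iff)
      ultimately have "(x, x) \<in> steps\<^sup>+" by (rule rtrancl_into_trancl2[rotated])
      then show False using cycle_on_circle x by blast
    qed
    then show ?thesis by (auto simp: edges_before_def)
  qed
  ultimately show ?thesis by (simp add: flow_val_def sum.union_disjoint)
qed

lemma flow_val_over_out:
  assumes "v < H" "\<not> on_circle (over_in K v)"
  shows "flow_val f (over_out K v) = flow_val f (over_in K v) + red_col f v"
proof -
  have "{e \<in> edges K. head_point K e = nxt (over_in K v)} = {Red v}"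
    using assms(1) inj_onD[OF head_point_inj, of _ "Red v"] by auto
  then show ?thesis
    using flow_val_next[OF crossing_points(1)[OF assms(1)] over_in_notin_under_ins assms(2), of f] assms(1)
    by (simp add: red_col_def)
qed

lemma flow_val_no_crossing:
  assumes "x \<in> points K" "x \<notin> nodes" "\<not> on_circle x"
  shows "flow_val f (nxt x) = flow_val f x"
proof -
  have "head_point K e \<noteq> nxt x" if "e \<in> edges K" for e
  proof
    assume eq: "head_point K e = nxt x"
    from that obtain y where "y \<in> nodes" "y \<in> points K" "head_point K e = nxt y"
    proof (cases rule: edgesE)
      case (1 v)
      show thesis by (rule that[of "under_in K v"]) (use 1 in \<open>auto simp: under_ins_def crossing_points\<close>)
    next
      case (2 v)
      show thesis by (rule that[of "over_in K v"]) (use 2 in \<open>auto simp: over_ins_def crossing_points\<close>)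
    qed
    then show False using inj_onD[OF next_inj, of x y] assms eq by auto
  qed
  then have empty: "{e \<in> edges K. head_point K e = nxt x} = {}" by blast
  show ?thesis using flow_val_next[of x f] assms unfolding empty by simp
qed

text \<open>The end of the arc has no outgoing step and steps are deterministic, so every zigzag
  starting at the end straightens to a forward walk towards it.\<close>

lemma in_edges_overcrossing_arc:
  assumes "v < H"
  shows "in_edges K (overcrossing_arc K v) = edges_before (under_in K v)"
proof -
  have u: "under_in K v \<in> under_ins K" using assms by (simp add: under_ins_def)
  have "(y, under_in K v) \<in> steps\<^sup>*" if "(under_in K v, y) \<in> (steps \<union> steps\<inverse>)\<^sup>*" for y
    using that
  proof (induction rule: rtrancl_induct)
    case (step y z)
    from step.hyps(2) consider "(y, z) \<in> steps" | "(z, y) \<in> steps" by blast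
    then show ?case
    proof cases
      case 1
      then have "y \<noteq> under_in K v" using u by (auto simp: cut_step_iff)
      then obtain w where "(y, w) \<in> steps" "(w, under_in K v) \<in> steps\<^sup>*"
        using step.IH by (auto elim: converse_rtranclE)
      moreover have "w = z" using 1 \<open>(y, w) \<in> steps\<close> by (simp add: cut_step_iff)
      ultimately show ?thesis by simp
    next
      case 2
      then show ?thesis using step.IH by (rule converse_rtrancl_into_rtrancl)
    qed
  qed simp
  moreover have "y \<in> cut_piece K (under_ins K) (under_in K v)" if "(y, under_in K v) \<in> steps\<^sup>*" for y
  proof (rule cut_piece_sym)
    have "steps\<^sup>* \<subseteq> (steps \<union> steps\<inverse>)\<^sup>*" by (rule rtrancl_mono) blast
    then show "under_in K v \<in> cut_piece K (under_ins K) y" using that by (auto simp: cut_piece_def)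
  qed
  ultimately have iff: "y \<in> cut_piece K (under_ins K) (under_in K v) \<longleftrightarrow> (y, under_in K v) \<in> steps\<^sup>*" for y
    unfolding cut_piece_def by blast
  show ?thesis unfolding in_edges_def overcrossing_arc_def edges_before_def iff ..
qed

lemma edge_range:
  assumes "f \<in> graph_states K n" "v < H"
  shows "0 \<le> blue_col f v" "0 \<le> red_col f v" "vertex_col f v \<le> int n"
  using assms by (auto simp: graph_states_def blue_col_def red_col_def PiE_iff)

lemma red_col_circle:
  assumes f: "f \<in> graph_states K n" and v: "v < H" "on_circle (over_in K v)"
  shows "red_col f v = 0"
proof -
  let ?C = "cut_piece K {} (over_in K v)"
  have C: "?C \<in> circles" using v by (simp add: on_circle_def)
  have "over_out K v \<in> ?C"
    using cut_piece_next[of "over_in K v" "{}"] crossing_points(1)[OF v(1)] v(1)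
      cut_piece_refl[of "over_out K v" "{}"] by simp
  then have "Red v \<in> in_edges K ?C" using v(1) by (simp add: in_edges_def)
  moreover have "(\<Sum>e\<in>in_edges K ?C. fst f e) = 0" using f C by (auto simp: graph_states_def)
  moreover have "\<And>e. e \<in> in_edges K ?C \<Longrightarrow> 0 \<le> fst f e"
    using f by (auto simp: graph_states_def in_edges_def PiE_iff)
  moreover have "finite (in_edges K ?C)" by (simp add: in_edges_def)
  ultimately show ?thesis using sum_nonneg_eq_0_iff[of "in_edges K ?C" "fst f"] by (simp add: red_col_def)
qed

section \<open>The coloring induced by a graph state\<close>

text \<open>A circle can get a single color: for a graph state its incoming edges have nonnegative
  colors with sum 0.\<close>

definition point_col :: "graph_coloring \<Rightarrow> point \<Rightarrow> int" where
  "point_col f x = (if on_circle x then snd f (cut_piece K {} x) else flow_val f x)"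

lemma point_col_circle_next:
  "x \<in> points K \<Longrightarrow> on_circle x \<Longrightarrow> point_col f (nxt x) = point_col f x"
  by (simp add: point_col_def on_circle_next cut_piece_next)

lemma point_col_no_crossing:
  "x \<in> points K \<Longrightarrow> x \<notin> nodes \<Longrightarrow> point_col f (nxt x) = point_col f x"
  by (cases "on_circle x") (simp add: point_col_circle_next, simp add: point_col_def on_circle_next flow_val_no_crossing)

lemma not_circle_under_out: "v < H \<Longrightarrow> \<not> on_circle (under_out K v)"
  using on_circle_next[OF crossing_points(2)] under_in_not_circle by simp

lemma on_circle_over_out: "v < H \<Longrightarrow> on_circle (over_out K v) \<longleftrightarrow> on_circle (over_in K v)"
  using on_circle_next[OF crossing_points(1)] by simp

lemma point_col_under_out: "v < H \<Longrightarrow> point_col f (under_out K v) = blue_col f v"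
  by (simp add: point_col_def not_circle_under_out flow_val_under_out)

lemma point_col_over_out:
  assumes "f \<in> graph_states K n" "v < H"
  shows "point_col f (over_out K v) = point_col f (over_in K v) + red_col f v"
proof (cases "on_circle (over_in K v)")
  case True
  then show ?thesis
    using point_col_circle_next[OF crossing_points(1)[OF assms(2)], of f] assms red_col_circle by simp
next
  case False
  then show ?thesis using assms(2) by (simp add: point_col_def on_circle_over_out flow_val_over_out)
qed

text \<open>This is the balance condition at the vertex: at the end of its arc all incoming edges
  have been passed.\<close>

lemma point_col_under_in:
  assumes "f \<in> graph_states K n" "v < H"
  shows "point_col f (under_in K v) = vertex_col f v"
proof -
  have "(\<Sum>e\<in>in_edges K (overcrossing_arc K v). fst f e) = vertex_col f v"
    using assms by (auto simp: graph_states_def)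
  then show ?thesis
    using assms(2) by (simp add: point_col_def under_in_not_circle flow_val_def in_edges_overcrossing_arc)
qed

text \<open>Colors grow along an arc, so the bound on \<open>vertex_col\<close> at its end controls
  the whole arc.\<close>

lemma point_col_range:
  assumes f: "f \<in> graph_states K n" and x: "x \<in> points K"
  shows "point_col f x \<in> {0..int n}"
proof (cases "on_circle x")
  case True
  then show ?thesis using f by (auto simp: point_col_def graph_states_def on_circle_def PiE_iff)
next
  case False
  then obtain v where v: "v < H" "(x, under_in K v) \<in> steps\<^sup>*" using reaches_under_in x by blast
  have nonneg: "0 \<le> fst f e" if "e \<in> edges_before y" for e y
    using f that by (auto simp: graph_states_def edges_before_def PiE_iff)
  have "edges_before x \<subseteq> edges_before (under_in K v)"
    using v(2) by (auto simp: edges_before_def)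
  then have "flow_val f x \<le> flow_val f (under_in K v)"
    unfolding flow_val_def using nonneg[of _ "under_in K v"] by (intro sum_mono2) auto
  also have "\<dots> \<le> int n"
    using point_col_under_in[OF f v(1)] edge_range(3)[OF f v(1)] v(1)
    by (simp add: point_col_def under_in_not_circle)
  finally show ?thesis using False nonneg by (simp add: point_col_def flow_val_def sum_nonneg)
qed

lemma circle_choice_point:
  assumes "circle_choice K ch" "C \<in> circles"
  obtains x where "x \<in> C" "ch C = part_arc K x"
proof -
  obtain x where x: "ch C = part_arc K x"
    using assms by (auto simp: circle_choice_def part_arcs_def)
  have "x \<in> part_arc K x" by (simp add: part_arc_def)
  then have "x \<in> C" using x assms by (auto simp: circle_choice_def)
  then show ?thesis using that x by blast
qed

lemma col_at_point_col:
  "x \<in> points K \<Longrightarrow> col_at K (part_coloring_of (point_col f)) x = point_col f x"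
  by (rule col_at_part_coloring_of) (rule point_col_no_crossing)

lemma inducesD:
  assumes "induces K ch f s"
  shows "v < H \<Longrightarrow> col_at K s (under_out K v) = blue_col f v"
    and "v < H \<Longrightarrow> col_at K s (over_out K v) = col_at K s (over_in K v) + red_col f v"
    and "v < H \<Longrightarrow> col_at K s (under_in K v) = blue_col f v + red_col f v"
    and "C \<in> circles \<Longrightarrow> s (ch C) = snd f C"
proof -
  have *: "col_at K s (under_out K v) = blue_col f v"
      "col_at K s (over_out K v) = col_at K s (over_in K v) + red_col f v"
      "col_at K s (under_out K v) = col_at K s (under_in K v) - red_col f v" if "v < H"
    using assms that crossings_iff[of v] unfolding induces_def by blast+
  then show "v < H \<Longrightarrow> col_at K s (under_out K v) = blue_col f v"
    "v < H \<Longrightarrow> col_at K s (over_out K v) = col_at K s (over_in K v) + red_col f v" by blast+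
  show "v < H \<Longrightarrow> col_at K s (under_in K v) = blue_col f v + red_col f v" using * by simp
  show "C \<in> circles \<Longrightarrow> s (ch C) = snd f C" using assms unfolding induces_def by blast
qed

lemma induces_point_col:
  assumes ch: "circle_choice K ch" and f: "f \<in> graph_states K n"
  shows "induces K ch f (part_coloring_of (point_col f))"
proof -
  have "part_coloring_of (point_col f) (ch C) = snd f C" if C: "C \<in> circles" for C
  proof -
    obtain x where x: "x \<in> C" "ch C = part_arc K x" using circle_choice_point[OF ch C] .
    then show ?thesis using circle_component[OF C x(1)] C
      by (simp add: col_at_point_col point_col_def on_circle_def)
  qed
  then show ?thesis
    unfolding induces_def using part_coloring_of_extensional
    by (auto simp: col_at_point_col crossing_points point_col_under_out point_col_over_out[OF f]
        point_col_under_in[OF f] vertex_col_def)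
qed

lemma induces_unique:
  assumes ch: "circle_choice K ch" and f: "f \<in> graph_states K n" and s: "induces K ch f s"
  shows "s = part_coloring_of (point_col f)"
proof (rule part_coloring_eqI)
  show "s \<in> extensional (part_arcs K)" using s by (simp add: induces_def)
  have ind: "col_at K s (under_out K v) = blue_col f v"
      "col_at K s (over_out K v) = col_at K s (over_in K v) + red_col f v"
      "col_at K s (under_in K v) = vertex_col f v" if "v < H" for v
    using inducesD[OF s] that by (simp_all add: vertex_col_def)
  txt \<open>The difference of the colorings is constant along every component and vanishes somewhere on it.\<close>
  define d where "d x = col_at K s x - point_col f x" for x
  have "d (nxt x) = d x" if x: "x \<in> points K" for x
  proof -
    consider v where "v < H" "x = over_in K v" | v where "v < H" "x = under_in K v" | "x \<notin> nodes"
      using over_ins_iff[of x] under_ins_iff[of x] by blast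
    then show ?thesis
    proof cases
      case (1 v)
      then show ?thesis by (simp add: d_def ind point_col_over_out[OF f])
    next
      case (2 v)
      then show ?thesis by (simp add: d_def ind point_col_under_out point_col_under_in[OF f])
    next
      case 3
      then show ?thesis using x by (simp add: d_def part_arc_next point_col_no_crossing)
    qed
  qed
  then have const: "d y = d x" if "y \<in> cut_piece K {} x" for x y
    using cut_piece_const[of "{}" d] that by blast
  show "col_at K s x = col_at K (part_coloring_of (point_col f)) x" if x: "x \<in> points K" for x
  proof -
    have "d x = 0"
    proof (cases "on_circle x")
      case True
      then have C: "cut_piece K {} x \<in> circles" by (simp add: on_circle_def)
      obtain y where y: "y \<in> cut_piece K {} x" "ch (cut_piece K {} x) = part_arc K y"
        using circle_choice_point[OF ch C] .
      have "s (ch (cut_piece K {} x)) = snd f (cut_piece K {} x)"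
        using inducesD(4)[OF s C] .
      then have "d y = 0"
        using circle_component(2)[OF C y(1)] C y(2) by (simp add: d_def point_col_def on_circle_def)
      then show ?thesis using const[OF y(1)] by simp
    next
      case False
      then obtain v where v: "v < H" "under_in K v \<in> cut_piece K {} x"
        using on_circle_iff[OF x] by (auto simp: under_ins_def)
      then have "d (under_in K v) = 0" by (simp add: d_def ind point_col_under_in[OF f])
      then show ?thesis using const[OF v(2)] by simp
    qed
    then show ?thesis using col_at_point_col[OF x] by (simp add: d_def)
  qed
qed (rule part_coloring_of_extensional)

lemma induces_ex1:
  "circle_choice K ch \<Longrightarrow> f \<in> graph_states K n \<Longrightarrow> \<exists>!s. induces K ch f s"
  using induces_point_col induces_unique by blast

lemma flow_map_eqI:
  assumes "circle_choice K ch" "f \<in> graph_states K n" "induces K ch f s"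
  shows "flow_map K ch f = s"
  unfolding flow_map_def using assms induces_ex1 by (blast intro: the1_equality)

lemma flow_map_induces:
  assumes "circle_choice K ch" "f \<in> graph_states K n"
  shows "induces K ch f (flow_map K ch f)"
  unfolding flow_map_def using induces_ex1[OF assms] by (rule theI')

text \<open>Colors are constant on circles, so the value is the same for every choice
  \<open>ch\<close> of part arcs.\<close>

lemma flow_map_col:
  assumes "circle_choice K ch" "f \<in> graph_states K n" "x \<in> points K"
  shows "col_at K (flow_map K ch f) x = point_col f x"
  using flow_map_eqI[OF assms(1,2) induces_point_col[OF assms(1,2)]]
    col_at_point_col[OF assms(3)] by simp

text \<open>Off the circles, the edges strictly before \<open>Red v\<close> are those that enter up
  to the overpass at \<open>v\<close>, and their sum is the color there. On a circle the convention
  in \<open>before_sum\<close> says the same.\<close>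

lemma before_sum_eq:
  assumes "circle_choice K ch" "f \<in> graph_states K n" and v: "v < H"
  shows "before_sum K ch f v = col_at K (flow_map K ch f) (over_in K v)"
proof (cases "on_circle (over_in K v)")
  case True
  then show ?thesis
    using on_circle_ex[of "over_out K v"] on_circle_over_out[OF v] by (simp add: before_sum_def)
next
  case False
  have "{e \<in> edges K. edge_before K e (Red v)} = edges_before (over_in K v)"
    using steps_into_next[OF crossing_points(1)[OF v] over_in_notin_under_ins] v
    by (simp add: edge_before_def edges_before_def)
  then show ?thesis
    using False on_circle_ex[of "over_out K v"] on_circle_over_out[OF v]
      flow_map_col[OF assms(1,2) crossing_points(1)[OF v]]
    by (simp add: before_sum_def point_col_def flow_val_def)
qed

lemma flow_map_plus_state:
  assumes ch: "circle_choice K ch" and f: "f \<in> based_graph_states K ch n"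
  shows "flow_map K ch f \<in> plus_states K n"
proof -
  have f': "f \<in> graph_states K n" using f by (simp add: based_graph_states_def)
  let ?s = "flow_map K ch f"
  note ind = inducesD[OF flow_map_induces[OF ch f']]
  have "is_flow K ?s"
    unfolding is_flow_def
  proof (intro conjI ballI)
    fix v assume "v \<in> crossings K"
    then have "col_at K ?s (over_in K v) + col_at K ?s (under_in K v)
        = col_at K ?s (over_out K v) + col_at K ?s (under_out K v)"
      by (simp add: ind)
    then show "col_at K ?s (left_in K v) + col_at K ?s (right_in K v)
        = col_at K ?s (left_out K v) + col_at K ?s (right_out K v)"
      by (simp add: over_in_def under_in_def over_out_def under_out_def split: if_splits)
  next
    show "?s \<in> extensional (part_arcs K)"
      using flow_map_induces[OF ch f'] by (simp add: induces_def)
  qed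
  moreover have "?s P \<in> {0..int n}" if "P \<in> part_arcs K" for P
    using that point_col_range[OF f'] flow_map_col[OF ch f'] by (auto simp: part_arcs_def)
  moreover have "col_at K ?s (over_in K v) \<le> col_at K ?s (over_out K v)" if "v \<in> crossings K" for v
    using that edge_range(2)[OF f', of v] by (simp add: ind)
  moreover have "closure_col K ?s 1 = 0" using f by (simp add: based_graph_states_def)
  ultimately show ?thesis by (simp add: plus_states_def)
qed

lemma flow_map_inj:
  assumes ch: "circle_choice K ch"
  shows "inj_on (flow_map K ch) (graph_states K n)"
proof (rule inj_onI)
  fix f f' assume f: "f \<in> graph_states K n" "f' \<in> graph_states K n"
    and eq: "flow_map K ch f = flow_map K ch f'"
  note ind = inducesD[OF flow_map_induces[OF ch f(1), unfolded eq]]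
    and ind' = inducesD[OF flow_map_induces[OF ch f(2)]]
  have "fst f = fst f'"
  proof (rule PiE_ext)
    show "fst f \<in> edges K \<rightarrow>\<^sub>E {0..int n}" "fst f' \<in> edges K \<rightarrow>\<^sub>E {0..int n}"
      using f by (auto simp: graph_states_def)
    fix e assume "e \<in> edges K"
    then show "fst f e = fst f' e"
    proof (cases rule: edgesE)
      case (1 v)
      then show ?thesis using ind(1)[of v] ind'(1)[of v] by (simp add: blue_col_def)
    next
      case (2 v)
      have "red_col f v = red_col f' v" using ind(2)[of v] ind'(2)[of v] 2 by simp
      then show ?thesis using 2 by (simp add: red_col_def)
    qed
  qed
  moreover have "snd f = snd f'"
  proof (rule PiE_ext)
    show "snd f \<in> circles \<rightarrow>\<^sub>E {0..int n}" "snd f' \<in> circles \<rightarrow>\<^sub>E {0..int n}"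
      using f by (auto simp: graph_states_def)
    show "snd f C = snd f' C" if "C \<in> circles" for C
      using ind(4)[OF that] ind'(4)[OF that] by simp
  qed
  ultimately show "f = f'" by (rule prod_eqI)
qed

section \<open>The inverse of the flow map\<close>

definition graph_coloring_of :: "(point set \<Rightarrow> point set) \<Rightarrow> part_coloring \<Rightarrow> graph_coloring" where
  "graph_coloring_of ch s =
     (\<lambda>e\<in>edges K. case e of Blue v \<Rightarrow> col_at K s (under_out K v)
        | Red v \<Rightarrow> col_at K s (over_out K v) - col_at K s (over_in K v),
      \<lambda>C\<in>circles. s (ch C))"

lemma graph_coloring_of_cols:
  assumes "v < H"
  shows "blue_col (graph_coloring_of ch s) v = col_at K s (under_out K v)"
    "red_col (graph_coloring_of ch s) v = col_at K s (over_out K v) - col_at K s (over_in K v)"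
  using assms by (simp_all add: graph_coloring_of_def blue_col_def red_col_def)

text \<open>A circle has only overpasses, where a \<open>(+)\<close>-state does not decrease; over
  one full turn the nonnegative increments sum to 0.\<close>

lemma plus_state_circle:
  assumes s: "s \<in> plus_states K n" and C: "C \<in> circles" and x: "x \<in> C"
  shows "col_at K s (nxt x) = col_at K s x"
proof -
  have next_in: "nxt y \<in> C" if "y \<in> C" for y
    using cut_piece_next[of y "{}"] circle_component[OF C that] cut_piece_refl[of "nxt y" "{}"] by simp
  have sub: "C \<subseteq> points K" using circle_component(1)[OF C] by blast
  then have fin: "finite C" using finite_points finite_subset by metis
  have inj: "inj_on nxt C" using next_inj sub inj_on_subset by blast
  have "nxt ` C = C" using fin inj next_in by (intro endo_inj_surj) auto
  then have "(\<Sum>y\<in>C. col_at K s (nxt y)) = (\<Sum>y\<in>C. col_at K s y)"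
    using sum.reindex[OF inj, of "col_at K s"] by simp
  then have "(\<Sum>y\<in>C. col_at K s (nxt y) - col_at K s y) = 0" by (simp add: sum_subtractf)
  moreover have "0 \<le> col_at K s (nxt y) - col_at K s y" if "y \<in> C" for y
  proof (cases "y \<in> over_ins K")
    case True
    then obtain v where "v < H" "y = over_in K v" using over_ins_iff[of y] by blast
    then show ?thesis using s by (simp add: plus_states_def)
  next
    case False
    then show ?thesis using part_arc_next[of y] circle_component[OF C that] by simp
  qed
  ultimately have "\<forall>y\<in>C. col_at K s (nxt y) - col_at K s y = 0"
    using sum_nonneg_eq_0_iff[OF fin, of "\<lambda>y. col_at K s (nxt y) - col_at K s y"] by blast
  then show ?thesis using x by simp
qed

text \<open>Follow the arc from its beginning: the blue edge gives the initial color, and each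
  overpass adds its red edge.\<close>

lemma flow_val_graph_coloring_of:
  assumes x: "x \<in> points K" "\<not> on_circle x"
  shows "flow_val (graph_coloring_of ch s) x = col_at K s x"
proof -
  let ?f = "graph_coloring_of ch s"
  obtain v where v: "v < H" "(under_out K v, x) \<in> steps\<^sup>*" using reached_from_under_out[OF x] .
  from v(2) have "\<not> on_circle x \<and> flow_val ?f x = col_at K s x"
  proof (induction rule: rtrancl_induct)
    case base
    then show ?case using v(1) by (simp add: not_circle_under_out flow_val_under_out graph_coloring_of_cols)
  next
    case (step y z)
    then have y: "y \<in> points K" "y \<notin> under_ins K" "z = nxt y" by (auto simp: cut_step_iff)
    have "flow_val ?f (nxt y) = col_at K s (nxt y)"
    proof (cases "y \<in> over_ins K")
      case True
      then obtain w where "w < H" "y = over_in K w" using over_ins_iff[of y] by blast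
      then show ?thesis using step.IH by (simp add: flow_val_over_out graph_coloring_of_cols)
    next
      case False
      then show ?thesis using step.IH y by (simp add: flow_val_no_crossing part_arc_next)
    qed
    then show ?case using step.IH y by (simp add: on_circle_next)
  qed
  then show ?thesis by simp
qed

lemma graph_coloring_of_graph_state:
  assumes ch: "circle_choice K ch" and s: "s \<in> plus_states K n"
  shows "graph_coloring_of ch s \<in> graph_states K n" "induces K ch (graph_coloring_of ch s) s"
proof -
  let ?f = "graph_coloring_of ch s"
  have ran: "0 \<le> s P" "s P \<le> int n" if "P \<in> part_arcs K" for P
    using s that by (auto simp: plus_states_def)
  have mono: "col_at K s (over_in K v) \<le> col_at K s (over_out K v)" if "v < H" for v
    using s that by (simp add: plus_states_def)
  have flow: "col_at K s (over_in K v) + col_at K s (under_in K v)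
       = col_at K s (over_out K v) + col_at K s (under_out K v)" if "v < H" for v
  proof -
    have "col_at K s (left_in K v) + col_at K s (right_in K v)
      = col_at K s (left_out K v) + col_at K s (right_out K v)"
      using s that by (simp add: plus_states_def is_flow_def)
    then show ?thesis by (simp add: over_in_def under_in_def over_out_def under_out_def)
  qed
  have vertex: "vertex_col ?f v = col_at K s (under_in K v)" if "v < H" for v
    using flow[OF that] that by (simp add: vertex_col_def graph_coloring_of_cols)
  have "fst ?f e \<in> {0..int n}" if "e \<in> edges K" for e
    using that
  proof (cases rule: edgesE)
    case (1 v)
    then show ?thesis by (simp add: graph_coloring_of_def ran crossing_points)
  next
    case (2 v)
    have "col_at K s (over_out K v) \<le> int n" "0 \<le> col_at K s (over_in K v)"
      using 2 by (simp_all add: ran crossing_points)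
    then show ?thesis using 2 mono[of v] by (simp add: graph_coloring_of_def)
  qed
  then have "fst ?f \<in> edges K \<rightarrow>\<^sub>E {0..int n}" by (auto simp: graph_coloring_of_def)
  moreover have "snd ?f \<in> circles \<rightarrow>\<^sub>E {0..int n}"
    using ch by (auto simp: graph_coloring_of_def circle_choice_def ran)
  moreover have "(\<Sum>e\<in>in_edges K (overcrossing_arc K v). fst ?f e) = vertex_col ?f v" if v: "v < H" for v
    using flow_val_graph_coloring_of[OF crossing_points(2)[OF v] under_in_not_circle[OF v], of ch s]
    by (simp add: in_edges_overcrossing_arc[OF v] vertex[OF v] flow_val_def)
  moreover have "vertex_col ?f v \<le> int n" if "v < H" for v
    using that by (simp add: vertex ran crossing_points)
  \<comment> \<open>Only red edges can enter a circle, and their colors are the increments of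
    \<open>s\<close> along it.\<close>
  moreover have "(\<Sum>e\<in>in_edges K C. fst ?f e) = 0" if C: "C \<in> circles" for C
  proof (rule sum.neutral, intro ballI)
    fix e assume "e \<in> in_edges K C"
    then have e: "e \<in> edges K" "head_point K e \<in> C" by (auto simp: in_edges_def)
    have circ: "on_circle (head_point K e)" using circle_component[OF C e(2)] C by (simp add: on_circle_def)
    from e(1) show "fst ?f e = 0"
    proof (cases rule: edgesE)
      case (1 v)
      then show ?thesis using circ not_circle_under_out by simp
    next
      case (2 v)
      then have "cut_piece K {} (over_in K v) = C"
        using cut_piece_next[of "over_in K v" "{}"] crossing_points(1)[of v] circle_component(2)[OF C e(2)]
        by simp
      then have "over_in K v \<in> C" using cut_piece_refl by blast
      from plus_state_circle[OF s C this] show ?thesis using 2 by (simp add: graph_coloring_of_def)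
    qed
  qed
  ultimately show "?f \<in> graph_states K n" by (simp add: graph_states_def mem_Times_iff)
  show "induces K ch ?f s"
    unfolding induces_def
  proof (intro conjI ballI)
    show "s \<in> extensional (part_arcs K)" using s by (simp add: plus_states_def is_flow_def)
    show "s (ch C) = snd ?f C" if "C \<in> circles" for C using that by (simp add: graph_coloring_of_def)
    fix v assume "v \<in> crossings K"
    then have v: "v < H" by simp
    show "col_at K s (under_out K v) = blue_col ?f v"
      "col_at K s (over_out K v) = col_at K s (over_in K v) + red_col ?f v"
      "col_at K s (under_out K v) = col_at K s (under_in K v) - red_col ?f v"
      using flow[OF v] by (simp_all add: graph_coloring_of_cols[OF v])
  qed
qed

lemma flow_map_bij:
  assumes ch: "circle_choice K ch"
  shows "bij_betw (flow_map K ch) (based_graph_states K ch n) (plus_states K n)"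
  unfolding bij_betw_def
proof
  show "inj_on (flow_map K ch) (based_graph_states K ch n)"
    using flow_map_inj[OF ch, of n] by (auto simp: based_graph_states_def inj_on_def)
  have "s \<in> flow_map K ch ` based_graph_states K ch n" if s: "s \<in> plus_states K n" for s
  proof -
    note g = graph_coloring_of_graph_state[OF ch s]
    have "flow_map K ch (graph_coloring_of ch s) = s" using flow_map_eqI[OF ch g] .
    moreover from this have "graph_coloring_of ch s \<in> based_graph_states K ch n"
      using g(1) s by (simp add: based_graph_states_def plus_states_def)
    ultimately show ?thesis by (metis imageI)
  qed
  then show "flow_map K ch ` based_graph_states K ch n = plus_states K n"
    using flow_map_plus_state[OF ch] by blast
qed

section \<open>The state sum on the arc-graph\<close>

lemma arc_factor_flow_map:
  assumes ch: "circle_choice K ch" and f: "f \<in> graph_states K n" and v: "v < H"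
  shows "arc_factor n (flow_map K ch f) v =
    t_pow (of_int (int n * cr_sign K v * blue_col f v)) *
    t_binom (t_pow (of_int (- cr_sign K v))) (nat (vertex_col f v)) (nat (blue_col f v)) *
    t_falling (t_pow (of_int (cr_sign K v))) (int n - before_sum K ch f v) (nat (red_col f v))"
  using inducesD(1,2)[OF flow_map_induces[OF ch f] v] before_sum_eq[OF ch f v]
  unfolding arc_factor_def Let_def vertex_col_def by simp

lemma arc_factor_laurent:
  assumes s: "s \<in> plus_states K n" and v: "v < H"
  shows "arc_factor n s v \<in> laurent_polys"
proof -
  let ?b = "col_at K s (under_out K v)"
  let ?r = "col_at K s (over_out K v) - col_at K s (over_in K v)"
  have "0 \<le> ?r" using s v by (simp add: plus_states_def)
  then have "nat ?b \<le> nat (?b + ?r)" by (intro nat_mono) simp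
  moreover have "4 * (- cr_sign K v) \<noteq> 0" using sign_cases[OF v] by auto
  ultimately show ?thesis
    unfolding arc_factor_def Let_def t_pow_of_int
    by (intro laurent_mult qp_laurent t_binom_laurent t_falling_laurent)
qed

lemma Z_R_flow_map:
  assumes ch: "circle_choice K ch" and f: "f \<in> based_graph_states K ch n"
  shows "Z_R n K (flow_map K ch f) = t_pow (delta' K n + of_int (delta K ch f)) *
    (\<Prod>v\<in>crossings K. arc_factor n (flow_map K ch f) v)"
proof -
  have f': "f \<in> graph_states K n" using f by (simp add: based_graph_states_def)
  have "exc K ch f = (\<Sum>v\<in>crossings K. cr_sign K v * col_at K (flow_map K ch f) (under_out K v)
      * col_at K (flow_map K ch f) (over_in K v))"
    unfolding exc_def using inducesD(1)[OF flow_map_induces[OF ch f']] before_sum_eq[OF ch f']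
    by (intro sum.cong) simp_all
  then show ?thesis
    unfolding Z_R_arc[OF flow_map_plus_state[OF ch f]] delta_def rot_def by simp
qed

end

theorem theorem6p2:
  fixes n :: nat and K :: braid and ch :: "point set \<Rightarrow> point set"
  assumes "n \<ge> 1" and "is_braid K" and "circle_choice K ch"
  shows
    "colored_jones n K =
       t_pow (delta' K n) * (\<Sum>f\<in>based_graph_states K ch n. t_pow (of_int (delta K ch f)) *
         (\<Prod>v\<in>crossings K.
            t_pow (of_int (int n * cr_sign K v * blue_col f v)) *
            t_binom (t_pow (of_int (- cr_sign K v))) (nat (vertex_col f v)) (nat (blue_col f v)) *
            t_falling (t_pow (of_int (cr_sign K v))) (int n - before_sum K ch f v)
              (nat (red_col f v))))
     \<and> colored_jones n K \<in> laurent_polys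
     \<and> (\<forall>f\<in>graph_states K n. \<exists>!s. induces K ch f s)
     \<and> bij_betw (flow_map K ch) (based_graph_states K ch n) (plus_states K n)
     \<and> (\<forall>f\<in>based_graph_states K ch n.
         t_pow (delta' K n + of_int (delta K ch f)) *
         (\<Prod>v\<in>crossings K.
            t_pow (of_int (int n * cr_sign K v * blue_col f v)) *
            t_binom (t_pow (of_int (- cr_sign K v))) (nat (vertex_col f v)) (nat (blue_col f v)) *
            t_falling (t_pow (of_int (cr_sign K v))) (int n - before_sum K ch f v)
              (nat (red_col f v)))
         = Z_R n K (flow_map K ch f))"
proof -
  interpret closed_braid K using assms(2) by unfold_locales
  note ch = assms(3)
  let ?B = "based_graph_states K ch n"
  define P where "P f = (\<Prod>v\<in>crossings K.
            t_pow (of_int (int n * cr_sign K v * blue_col f v)) *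
            t_binom (t_pow (of_int (- cr_sign K v))) (nat (vertex_col f v)) (nat (blue_col f v)) *
            t_falling (t_pow (of_int (cr_sign K v))) (int n - before_sum K ch f v)
              (nat (red_col f v)))" for f
  have P: "P f = (\<Prod>v\<in>crossings K. arc_factor n (flow_map K ch f) v)" if "f \<in> ?B" for f
    unfolding P_def using that
    by (intro prod.cong refl arc_factor_flow_map[OF ch, symmetric]) (auto simp: based_graph_states_def)
  have Z: "t_pow (delta' K n + of_int (delta K ch f)) * P f = Z_R n K (flow_map K ch f)"
    if "f \<in> ?B" for f
    using P[OF that] Z_R_flow_map[OF ch that] by simp
  \<comment> \<open>Reversal of orientation enters here, as an identity of sums; the comparison with
    the arc-graph is termwise.\<close>
  have J: "colored_jones n K = (\<Sum>f\<in>?B. Z_R n K (flow_map K ch f))"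
    unfolding colored_jones_plus_states
    by (rule sum.reindex_bij_betw[OF flow_map_bij[OF ch], symmetric])
  then have sum: "colored_jones n K = t_pow (delta' K n) * (\<Sum>f\<in>?B. t_pow (of_int (delta K ch f)) * P f)"
    unfolding sum_distrib_left by (simp add: Z[symmetric] t_pow_add_int mult.assoc)
  have "colored_jones n K \<in> laurent_polys"
    unfolding J using flow_map_plus_state[OF ch] ch
    by (intro laurent_sum)
      (auto simp: Z_R_flow_map intro!: laurent_mult t_pow_laurent laurent_prod arc_factor_laurent)
  then show ?thesis
    using sum Z flow_map_bij[OF ch] induces_ex1[OF ch] unfolding P_def by blast
qed

end
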